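(* Let $a,b,c,d,e,f,h$ be nonzero complex numbers, $s=\dfrac{a^3q^3}{bcdef}$, and let $a_n,b_n$, $W_1,W_2$, $X_n^{(1),\frac{s}{h}q^{n-1}}$, $X_n^{(2),\frac{q^{n+1}}{h}}$ be as in the context. Then, with all products over $p\in\{b,c,d,e,f\}$, $$\cfrac{1}{a_0-\cfrac{b_1}{a_1-\cfrac{b_2}{a_2-\cdots}}}=\frac{W_2X_0^{(1),\frac{s}{hq}}-W_1X_0^{(2),\frac qh}}{b_0\bigl(W_2X_{-1}^{(1),\frac{s}{hq^2}}-W_1X_{-1}^{(2),\frac1h}\bigr)}=\frac{(1-\frac{s}{h^2q})(1-\frac{s}{h^2q^2})}{q}\cdot\frac{\mathcal N}{\mathcal D},$$ where $$\mathcal N=W_2\,\frac{(\frac{aq}{h})_\infty}{(\frac{s}{hq},\frac{s}{ahq})_\infty\prod_p(\frac{aq}{ph})_\infty}\,\Phi^{(\frac{s}{hq})}\Bigl(a;b,c,d,e,f,\tfrac{s}{hq},h;q\Bigr)-W_1\,\frac{(\frac{s}{ah})_\infty}{(\frac qh,\frac ah)_\infty\prod_p(\frac{ps}{ahq})_\infty}\,\Phi^{(\frac qh)}\Bigl(\tfrac qa;\tfrac qb,\tfrac qc,\tfrac qd,\tfrac qe,\tfrac qf,\tfrac{hq^2}{s},\tfrac qh;q\Bigr),$$ $$\mathcal D=W_2\,\frac{(1-\frac1h)\prod_p(1-\frac{ps}{ahq^2})\,(\frac ah)_\infty}{(\frac{s}{hq},\frac{s}{ahq^2})_\infty\prod_p(\frac{aq}{ph})_\infty}\,\Phi^{(\frac{s}{hq^2})}\Bigl(a;b,c,d,e,f,\tfrac{s}{hq^2},hq;q\Bigr)$$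 $$\qquad-W_1\,\frac{(1-\frac{s}{hq^2})\prod_p(1-\frac{a}{ph})\,(\frac{s}{ahq})_\infty}{(\frac qh,\frac{a}{qh})_\infty\prod_p(\frac{ps}{aqh})_\infty}\,\Phi^{(\frac1h)}\Bigl(\tfrac qa;\tfrac qb,\tfrac qc,\tfrac qd,\tfrac qe,\tfrac qf,\tfrac{hq^3}{s},\tfrac1h;q\Bigr).$$
   Context: Throughout $q\in\mathbb C$, $0<|q|<1$; $(x)_0=1$, $(x)_k=\prod_{j=0}^{k-1}(1-xq^j)$, $(x)_\infty=\prod_{j\ge 0}(1-xq^j)$, and $(x_1,\dots,x_r)_k=\prod_i (x_i)_k$ for $k\in\mathbb{Z}_{\ge0}\cup\{\infty\}$. Products over letters are with multiplicity. Define $${}_{10}W_9(a;p_1,\dots,p_7;q)=\sum_{k=0}^\infty \frac{1-aq^{2k}}{1-a}\,\frac{(a,p_1,\dots,p_7)_k}{(q,aq/p_1,\dots,aq/p_7)_k}\,q^k\quad(p_1\cdots p_7=a^3q^2),$$ $${}_8W_7(a;p_1,\dots,p_5;z)=\sum_{k=0}^\infty \frac{1-aq^{2k}}{1-a}\,\frac{(a,p_1,\dots,p_5)_k}{(q,aq/p_1,\dots,aq/p_5)_k}\,z^k,\qquad z=\frac{a^2q^2}{p_1\cdots p_5},$$ and for the distinguished parameter $p=p_i$ (the superscript names which parameter in the list is distinguished) $$\Phi^{(p)}(a;p_1,\dots,p_7;q)={}_{10}W_9(a;p_1,\dots,p_7;q)+\frac{(aq,\,p_i/a)_\infty}{(p_i^2q/a,\,a/p_i)_\infty}\prod_{j\ne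 i}\frac{(p_j,\;p_iq/p_j)_\infty}{(aq/p_j,\;p_ip_j/a)_\infty}\;{}_{10}W_9\Bigl(\tfrac{p_i^2}{a};\,p_i,\bigl(\tfrac{p_ip_j}{a}\bigr)_{j\ne i};q\Bigr).$$ Recurrence coefficients: $$a_n=A_n+B_n+\frac{sq^{2n-1}}{ah^2}\,\frac{(1-\frac{s}{aq^2})(1-b)(1-c)(1-d)(1-e)(1-f)}{(1-\frac{aq^{n+1}}{h})(1-\frac{sq^{n-2}}{ah})},\qquad b_n=A_{n-1}B_n,$$ $$A_n=\frac{(1-\frac{sq^{n-1}}{h})(1-\frac{sq^{n-1}}{ah})\prod_{p\in\{b,c,d,e,f\}}(1-\frac{aq^{n+1}}{ph})}{(1-\frac{sq^{2n}}{h^2})(1-\frac{sq^{2n-1}}{h^2})(1-\frac{aq^{n+1}}{h})},\qquad B_n=\frac{q(1-\frac{q^n}{h})(1-\frac{aq^n}{h})\prod_{p\in\{b,c,d,e,f\}}(1-\frac{psq^{n-2}}{ah})}{(1-\frac{sq^{2n-1}}{h^2})(1-\frac{sq^{2n-2}}{h^2})(1-\frac{sq^{n-2}}{ah})}.$$ $W_1={}_8W_7(a;b,c,d,e,f;\frac{s}{aq})$ for $|s/(aq)|<1$ and its analytic continuation (in the parameters) otherwise; $W_2={}_8W_7(\frac qa;\frac qb,\frac qc,\frac qd,\frac qe,\frac qf;\frac{aq^2}{s})$ for $|aq^2/s|<1$ and its analytic continuation otherwise. $$X^{(1),\frac shq^{n-1}}_n=\frac{(\frac{sq^{2n-1}}{h^2},\frac{aq^{n+1}}{h})_\infty}{(\frac{sq^{n-1}}{h},\frac{sq^{n-1}}{ah})_\infty\prod_{p\in\{b,c,d,e,f\}}(\frac{aq^{n+1}}{ph})_\infty}\,\Phi^{(\frac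 shq^{n-1})}\Bigl(a;b,c,d,e,f,\tfrac{sq^{n-1}}{h},hq^{-n};q\Bigr),$$ $$X^{(2),\frac{q^{n+1}}{h}}_n=\frac{(\frac{sq^{2n-1}}{h^2},\frac{sq^{n}}{ah})_\infty}{(\frac{q^{n+1}}{h},\frac{aq^{n}}{h})_\infty\prod_{p\in\{b,c,d,e,f\}}(\frac{psq^{n-1}}{ah})_\infty}\,\Phi^{(\frac{q^{n+1}}{h})}\Bigl(\tfrac qa;\tfrac qb,\tfrac qc,\tfrac qd,\tfrac qe,\tfrac qf,\tfrac{hq^{-n+2}}{s},\tfrac{q^{n+1}}{h};q\Bigr).$$ Standing assumption: parameters are such that no zero denominators (singularities) occur. *)

theory Defs
  imports "HOL-Analysis.Analysis"
begin

section \<open>q-shifted factorials\<close>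

definition qpoch :: "complex \<Rightarrow> complex \<Rightarrow> nat \<Rightarrow> complex" where
  "qpoch q x k = (\<Prod>j<k. 1 - x * q ^ j)"

definition qpoch_inf :: "complex \<Rightarrow> complex \<Rightarrow> complex" where
  "qpoch_inf q x = prodinf (\<lambda>j. 1 - x * q ^ j)"

definition qpochs :: "complex \<Rightarrow> complex list \<Rightarrow> nat \<Rightarrow> complex" where
  "qpochs q xs k = prod_list (map (\<lambda>x. qpoch q x k) xs)"

definition qpochs_inf :: "complex \<Rightarrow> complex list \<Rightarrow> complex" where
  "qpochs_inf q xs = prod_list (map (qpoch_inf q) xs)"

section \<open>Very-well-poised series\<close>

text \<open>The common shape of the two series: five parameters and argument \<open>z\<close> give the series 8W7,
  seven parameters and argument \<open>q\<close> give the series 10W9.\<close>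

definition vwp_series :: "complex \<Rightarrow> complex \<Rightarrow> complex list \<Rightarrow> complex \<Rightarrow> complex" where
  "vwp_series q a ps z =
     (\<Sum>k. (1 - a * q ^ (2 * k)) / (1 - a)
          * (qpochs q (a # ps) k / qpochs q (q # map (\<lambda>p. a * q / p) ps) k) * z ^ k)"

definition vwp_nonsing :: "complex \<Rightarrow> complex \<Rightarrow> complex list \<Rightarrow> bool" where
  "vwp_nonsing q a ps \<longleftrightarrow> 1 - a \<noteq> 0 \<and> (\<forall>k. qpochs q (q # map (\<lambda>p. a * q / p) ps) k \<noteq> 0)"

definition W10_9 :: "complex \<Rightarrow> complex \<Rightarrow> complex list \<Rightarrow> complex" where
  "W10_9 q a ps = vwp_series q a ps q"

text \<open>In \<open>Phi q a p rs\<close> the distinguished parameter \<open>p\<close> is listed separately and \<open>rs\<close> are the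
  other six parameters; this loses nothing because the series are symmetric in their parameters.\<close>

definition Phi :: "complex \<Rightarrow> complex \<Rightarrow> complex \<Rightarrow> complex list \<Rightarrow> complex" where
  "Phi q a p rs =
     W10_9 q a (p # rs)
     + qpochs_inf q [a * q, p / a] / qpochs_inf q [p\<^sup>2 * q / a, a / p]
       * prod_list (map (\<lambda>r. qpochs_inf q [r, p * q / r] / qpochs_inf q [a * q / r, p * r / a]) rs)
       * W10_9 q (p\<^sup>2 / a) (p # map (\<lambda>r. p * r / a) rs)"

definition Phi_nonsing :: "complex \<Rightarrow> complex \<Rightarrow> complex \<Rightarrow> complex list \<Rightarrow> bool" where
  "Phi_nonsing q a p rs \<longleftrightarrow>
     vwp_nonsing q a (p # rs)
     \<and> vwp_nonsing q (p\<^sup>2 / a) (p # map (\<lambda>r. p * r / a) rs)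
     \<and> qpochs_inf q [p\<^sup>2 * q / a, a / p] \<noteq> 0
     \<and> (\<forall>r\<in>set rs. qpochs_inf q [a * q / r, p * r / a] \<noteq> 0)"

section \<open>The series 8W7 and its analytic continuation in the parameters\<close>

type_synonym complex6 = "complex \<times> complex \<times> complex \<times> complex \<times> complex \<times> complex"

text \<open>Holomorphy in six complex variables: real Frechet differentiability with a derivative that is
  complex linear.\<close>

definition holomorphic6_on :: "(complex6 \<Rightarrow> complex) \<Rightarrow> complex6 set \<Rightarrow> bool" where
  "holomorphic6_on F U \<longleftrightarrow>
     (\<forall>x\<in>U. \<exists>A1 A2 A3 A4 A5 A6.
        (F has_derivative
          (\<lambda>(u1, u2, u3, u4, u5, u6). A1*u1 + A2*u2 + A3*u3 + A4*u4 + A5*u5 + A6*u6)) (at x))"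

definition W8_7_arg :: "complex \<Rightarrow> complex6 \<Rightarrow> complex" where
  "W8_7_arg q = (\<lambda>(a, b, c, d, e, f). a\<^sup>2 * q\<^sup>2 / (b * c * d * e * f))"

definition W8_7_series :: "complex \<Rightarrow> complex6 \<Rightarrow> complex" where
  "W8_7_series q x =
     (case x of (a, b, c, d, e, f) \<Rightarrow> vwp_series q a [b, c, d, e, f] (W8_7_arg q x))"

text \<open>The terms of the series are \<open>z\<^sup>k g(q\<^sup>k)\<close> with \<open>g\<close> analytic near 0, so besides the zeros of the
  denominators of its terms the only singularities of the continuation are poles where
  \<open>z q\<^sup>k = 1\<close> for some natural number \<open>k\<close>.\<close>

definition W8_7_nonsing :: "complex \<Rightarrow> complex6 \<Rightarrow> bool" where
  "W8_7_nonsing q x \<longleftrightarrow>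
     (case x of (a, b, c, d, e, f) \<Rightarrow>
        0 \<notin> {a, b, c, d, e, f} \<and> vwp_nonsing q a [b, c, d, e, f]
        \<and> (\<forall>k::nat. W8_7_arg q x * q ^ k \<noteq> 1))"

definition W8_7_continuation :: "complex \<Rightarrow> (complex6 \<Rightarrow> complex) \<Rightarrow> bool" where
  "W8_7_continuation q F \<longleftrightarrow>
     holomorphic6_on F {x. W8_7_nonsing q x}
     \<and> (\<forall>x. W8_7_nonsing q x \<and> norm (W8_7_arg q x) < 1 \<longrightarrow> F x = W8_7_series q x)"

text \<open>For \<open>0 < |q| < 1\<close> the nonsingular set is the complement in \<open>(\<complex> - {0})\<^sup>6\<close> of a locally finite
  union of analytic hypersurfaces, hence open and connected. By the identity theorem the
  continuation is therefore unique on that set, and the choice below does not matter there.\<close>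

definition W8_7 :: "complex \<Rightarrow> complex6 \<Rightarrow> complex" where
  "W8_7 q x =
     (if norm (W8_7_arg q x) < 1 then W8_7_series q x
      else (SOME F. W8_7_continuation q F) x)"

section \<open>Recurrence coefficients and solutions\<close>

text \<open>Throughout, \<open>ps\<close> is the list \<open>[b, c, d, e, f]\<close>. The index \<open>n\<close> is an integer since
  \<open>n = -1\<close> is needed.\<close>

definition coeff_A ::
  "complex \<Rightarrow> complex \<Rightarrow> complex list \<Rightarrow> complex \<Rightarrow> complex \<Rightarrow> int \<Rightarrow> complex" where
  "coeff_A q a ps s h n =
     ((1 - s * q powi (n - 1) / h) * (1 - s * q powi (n - 1) / (a * h))
       * prod_list (map (\<lambda>p. 1 - a * q powi (n + 1) / (p * h)) ps))
     / ((1 - s * q powi (2 * n) / h\<^sup>2) * (1 - s * q powi (2 * n - 1) / h\<^sup>2)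
         * (1 - a * q powi (n + 1) / h))"

definition coeff_B ::
  "complex \<Rightarrow> complex \<Rightarrow> complex list \<Rightarrow> complex \<Rightarrow> complex \<Rightarrow> int \<Rightarrow> complex" where
  "coeff_B q a ps s h n =
     (q * (1 - q powi n / h) * (1 - a * q powi n / h)
       * prod_list (map (\<lambda>p. 1 - p * s * q powi (n - 2) / (a * h)) ps))
     / ((1 - s * q powi (2 * n - 1) / h\<^sup>2) * (1 - s * q powi (2 * n - 2) / h\<^sup>2)
         * (1 - s * q powi (n - 2) / (a * h)))"

definition coeff_a ::
  "complex \<Rightarrow> complex \<Rightarrow> complex list \<Rightarrow> complex \<Rightarrow> complex \<Rightarrow> int \<Rightarrow> complex" where
  "coeff_a q a ps s h n =
     coeff_A q a ps s h n + coeff_B q a ps s h n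
     + s * q powi (2 * n - 1) / (a * h\<^sup>2)
       * (((1 - s / (a * q\<^sup>2)) * prod_list (map (\<lambda>p. 1 - p) ps))
          / ((1 - a * q powi (n + 1) / h) * (1 - s * q powi (n - 2) / (a * h))))"

definition coeff_b ::
  "complex \<Rightarrow> complex \<Rightarrow> complex list \<Rightarrow> complex \<Rightarrow> complex \<Rightarrow> int \<Rightarrow> complex" where
  "coeff_b q a ps s h n = coeff_A q a ps s h (n - 1) * coeff_B q a ps s h n"

text \<open>The coefficients that occur are \<open>a\<^sub>n\<close> and \<open>b\<^sub>n\<close> for \<open>n \<ge> 0\<close>, hence \<open>A\<^sub>n\<close> for \<open>n \<ge> -1\<close> and
  \<open>B\<^sub>n\<close> for \<open>n \<ge> 0\<close>. The denominator of the third summand of \<open>a\<^sub>n\<close> consists of factors of the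
  denominators of \<open>A\<^sub>n\<close> and \<open>B\<^sub>n\<close>.\<close>

definition coeff_nonsing ::
  "complex \<Rightarrow> complex \<Rightarrow> complex \<Rightarrow> complex \<Rightarrow> bool" where
  "coeff_nonsing q a s h \<longleftrightarrow>
     (\<forall>n\<ge>-1. (1 - s * q powi (2 * n) / h\<^sup>2) * (1 - s * q powi (2 * n - 1) / h\<^sup>2)
              * (1 - a * q powi (n + 1) / h) \<noteq> 0)
     \<and> (\<forall>n\<ge>0. (1 - s * q powi (2 * n - 1) / h\<^sup>2) * (1 - s * q powi (2 * n - 2) / h\<^sup>2)
              * (1 - s * q powi (n - 2) / (a * h)) \<noteq> 0)"

definition X1_den ::
  "complex \<Rightarrow> complex \<Rightarrow> complex list \<Rightarrow> complex \<Rightarrow> complex \<Rightarrow> int \<Rightarrow> complex" where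
  "X1_den q a ps s h n =
     qpochs_inf q [s * q powi (n - 1) / h, s * q powi (n - 1) / (a * h)]
     * prod_list (map (\<lambda>p. qpoch_inf q (a * q powi (n + 1) / (p * h))) ps)"

definition X1 ::
  "complex \<Rightarrow> complex \<Rightarrow> complex list \<Rightarrow> complex \<Rightarrow> complex \<Rightarrow> int \<Rightarrow> complex" where
  "X1 q a ps s h n =
     qpochs_inf q [s * q powi (2 * n - 1) / h\<^sup>2, a * q powi (n + 1) / h] / X1_den q a ps s h n
     * Phi q a (s / h * q powi (n - 1)) (ps @ [h * q powi (- n)])"

definition X1_nonsing ::
  "complex \<Rightarrow> complex \<Rightarrow> complex list \<Rightarrow> complex \<Rightarrow> complex \<Rightarrow> int \<Rightarrow> bool" where
  "X1_nonsing q a ps s h n \<longleftrightarrow>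
     X1_den q a ps s h n \<noteq> 0
     \<and> Phi_nonsing q a (s / h * q powi (n - 1)) (ps @ [h * q powi (- n)])"

definition X2_den ::
  "complex \<Rightarrow> complex \<Rightarrow> complex list \<Rightarrow> complex \<Rightarrow> complex \<Rightarrow> int \<Rightarrow> complex" where
  "X2_den q a ps s h n =
     qpochs_inf q [q powi (n + 1) / h, a * q powi n / h]
     * prod_list (map (\<lambda>p. qpoch_inf q (p * s * q powi (n - 1) / (a * h))) ps)"

definition X2 ::
  "complex \<Rightarrow> complex \<Rightarrow> complex list \<Rightarrow> complex \<Rightarrow> complex \<Rightarrow> int \<Rightarrow> complex" where
  "X2 q a ps s h n =
     qpochs_inf q [s * q powi (2 * n - 1) / h\<^sup>2, s * q powi n / (a * h)] / X2_den q a ps s h n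
     * Phi q (q / a) (q powi (n + 1) / h) (map (\<lambda>p. q / p) ps @ [h * q powi (- n + 2) / s])"

definition X2_nonsing ::
  "complex \<Rightarrow> complex \<Rightarrow> complex list \<Rightarrow> complex \<Rightarrow> complex \<Rightarrow> int \<Rightarrow> bool" where
  "X2_nonsing q a ps s h n \<longleftrightarrow>
     X2_den q a ps s h n \<noteq> 0
     \<and> Phi_nonsing q (q / a) (q powi (n + 1) / h) (map (\<lambda>p. q / p) ps @ [h * q powi (- n + 2) / s])"

section \<open>Continued fractions\<close>

text \<open>Numerators and denominators of the approximants of
  \<open>1 / (\<alpha> 0 - \<beta> 1 / (\<alpha> 1 - \<beta> 2 / (\<alpha> 2 - \<dots>)))\<close>: the approximant of index \<open>Suc n\<close> is the truncation
  that ends with \<open>\<alpha> n\<close>. Using the quotient of the two rather than nested division avoids the value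
  0 that Isabelle assigns to a division by zero in an intermediate tail.\<close>

fun cf_num :: "(nat \<Rightarrow> complex) \<Rightarrow> (nat \<Rightarrow> complex) \<Rightarrow> nat \<Rightarrow> complex" where
  "cf_num \<alpha> \<beta> 0 = 0"
| "cf_num \<alpha> \<beta> (Suc 0) = 1"
| "cf_num \<alpha> \<beta> (Suc (Suc n)) = \<alpha> (Suc n) * cf_num \<alpha> \<beta> (Suc n) - \<beta> (Suc n) * cf_num \<alpha> \<beta> n"

fun cf_den :: "(nat \<Rightarrow> complex) \<Rightarrow> (nat \<Rightarrow> complex) \<Rightarrow> nat \<Rightarrow> complex" where
  "cf_den \<alpha> \<beta> 0 = 1"
| "cf_den \<alpha> \<beta> (Suc 0) = \<alpha> 0"
| "cf_den \<alpha> \<beta> (Suc (Suc n)) = \<alpha> (Suc n) * cf_den \<alpha> \<beta> (Suc n) - \<beta> (Suc n) * cf_den \<alpha> \<beta> n"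

definition cf_has_value :: "(nat \<Rightarrow> complex) \<Rightarrow> (nat \<Rightarrow> complex) \<Rightarrow> complex \<Rightarrow> bool" where
  "cf_has_value \<alpha> \<beta> L \<longleftrightarrow>
     (\<forall>\<^sub>F n in sequentially. cf_den \<alpha> \<beta> n \<noteq> 0)
     \<and> (\<lambda>n. cf_num \<alpha> \<beta> n / cf_den \<alpha> \<beta> n) \<longlonglongrightarrow> L"

end

theory Submission
  imports Defs "HOL-Complex_Analysis.Conformal_Mappings"
begin

text \<open>Up to the factor \<open>1 - a\<close>, the function \<open>\<Phi>\<close> is the difference of the sums of one weight over
  the two lattices \<open>q\<^sup>k\<close> and \<open>p q\<^sup>k / a\<close>. A contiguous combination of three shifted weights telescopes
  along each lattice, because two antisymmetric functions of \<open>x\<close> agree as soon as the associated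
  quadratic polynomials in \<open>1/x + a x\<close> agree at three points. The boundary terms at infinity are equal
  on both lattices, hence \<open>X\<^sup>(\<^sup>1\<^sup>)\<close> solves the recurrence. The coefficients are invariant when
  every parameter \<open>p\<close> is replaced by \<open>q / p\<close>, which is a divided difference identity at seven nodes,
  so \<open>X\<^sup>(\<^sup>2\<^sup>)\<close> solves it as well.

  The sums of \<open>z\<^sup>k q\<^sup>i\<^sup>k\<close> against the terms of 8W7 satisfy a linear relation in \<open>i\<close>. Solved downwards
  from large \<open>i\<close> it yields the continuation of 8W7, and passing to the limit in the corresponding
  relation for \<open>\<Phi>\<close> gives \<open>X\<^sup>(\<^sup>1\<^sup>)\<^sub>n \<longlonglongrightarrow> W\<^sub>1\<close> and \<open>X\<^sup>(\<^sup>2\<^sup>)\<^sub>n \<longlonglongrightarrow> W\<^sub>2\<close> without a convergence condition on the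
  argument. Therefore \<open>W\<^sub>2 X\<^sup>(\<^sup>1\<^sup>) - W\<^sub>1 X\<^sup>(\<^sup>2\<^sup>)\<close> tends to 0, and Pincherle's theorem applies since the
  coefficients tend summably to \<open>1 + q\<close> and \<open>q\<close>.\<close>

section \<open>Bounds and limits of q-shifted factorials\<close>

text \<open>Two obstacles shape the proof. A nonterminating 10W9 alone satisfies only an
  inhomogeneous relation, because its telescoped sum leaves a boundary term; the second series in
  \<open>Phi\<close> is there to cancel it. Both are therefore kept together as one linear
  functional of a polynomial in x, and (1 - a) times \<open>Phi\<close> is its value at x - a x^3.
  Secondly, with z = s/(aq) the arguments of the two 8W7 are z and q/z, so both series converge only
  in the annulus |q| < |z| < 1; elsewhere one of the two limits cannot be taken term by term.
  Moments against x^i with large i carry enough powers of q^k to be dominated, and telescoping with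
  the weight times x^i ties the low moments to the high ones. Only the moments 1 and 3 are needed in
  the end. Summability of the perturbations makes every solution of the recurrence converge, and
  some solution has a nonzero limit; this is what makes the limit 0 a test for minimality.\<close>

lemma qpoch_0 [simp]: "qpoch q x 0 = 1"
  by (simp add: qpoch_def)

lemma qpoch_Suc: "qpoch q x (Suc k) = qpoch q x k * (1 - x * q ^ k)"
  by (simp add: qpoch_def)

lemma qpoch_add: "qpoch q x (m + k) = qpoch q x m * qpoch q (x * q ^ m) k"
  by (induction k) (simp_all add: qpoch_Suc power_add algebra_simps)

lemma qpoch_Suc_left: "qpoch q x (Suc k) = (1 - x) * qpoch q (x * q) k"
  using qpoch_add[of q x 1 k] by (simp add: qpoch_Suc)

lemma qpoch_shift: "qpoch q (x * q) k * (1 - x) = qpoch q x k * (1 - x * q ^ k)"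
  by (metis qpoch_Suc qpoch_Suc_left mult.commute)

lemma qpoch_nonzero_iff: "qpoch q x k \<noteq> 0 \<longleftrightarrow> (\<forall>j<k. x * q ^ j \<noteq> 1)"
  by (auto simp: qpoch_def)

locale q_base =
  fixes q :: complex
  assumes q_pos: "0 < norm q" and q_less: "norm q < 1"
begin

lemma q_nz [simp]: "q \<noteq> 0"
  using q_pos by auto

lemma summable_q_norm: "summable (\<lambda>j. norm (x * q ^ j))"
  using q_less by (simp add: norm_mult norm_power summable_geometric summable_mult)

lemma convergent_qpoch: "convergent_prod (\<lambda>j. 1 - x * q ^ j)"
proof -
  have "abs_convergent_prod (\<lambda>j. 1 + (- x * q ^ j))"
    by (rule summable_imp_abs_convergent_prod) (use summable_q_norm[of "- x"] in simp)
  then show ?thesis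
    by (auto dest: abs_convergent_prod_imp_convergent_prod)
qed

lemma qpoch_tendsto: "(\<lambda>k. qpoch q x k) \<longlonglongrightarrow> qpoch_inf q x"
proof -
  have "(\<lambda>n. \<Prod>i\<le>n. 1 - x * q ^ i) \<longlonglongrightarrow> qpoch_inf q x"
    unfolding qpoch_inf_def by (rule convergent_prod_LIMSEQ[OF convergent_qpoch])
  then have "(\<lambda>n. qpoch q x (Suc n)) \<longlonglongrightarrow> qpoch_inf q x"
    by (simp add: qpoch_def lessThan_Suc_atMost)
  then show ?thesis
    by (rule LIMSEQ_imp_Suc)
qed

lemma qpoch_inf_split: "qpoch_inf q x = qpoch q x m * qpoch_inf q (x * q ^ m)"
proof -
  have "(\<lambda>k. qpoch q x (k + m)) \<longlonglongrightarrow> qpoch_inf q x"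
    by (rule LIMSEQ_ignore_initial_segment[OF qpoch_tendsto])
  moreover have "(\<lambda>k. qpoch q x (k + m)) \<longlonglongrightarrow> qpoch q x m * qpoch_inf q (x * q ^ m)"
    by (subst add.commute, subst qpoch_add) (intro tendsto_intros qpoch_tendsto)
  ultimately show ?thesis
    by (rule LIMSEQ_unique)
qed

lemma qpoch_inf_Suc: "qpoch_inf q x = (1 - x) * qpoch_inf q (x * q)"
  using qpoch_inf_split[of x 1] by (simp add: qpoch_Suc)

lemma qpoch_inf_nonzero_iff: "qpoch_inf q x \<noteq> 0 \<longleftrightarrow> (\<forall>j. x * q ^ j \<noteq> 1)"
proof
  assume *: "qpoch_inf q x \<noteq> 0"
  show "\<forall>j. x * q ^ j \<noteq> 1"
  proof
    fix j
    have "qpoch q x (Suc j) \<noteq> 0"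
      using * qpoch_inf_split[of x "Suc j"] by auto
    then show "x * q ^ j \<noteq> 1"
      by (auto simp: qpoch_Suc)
  qed
next
  assume "\<forall>j. x * q ^ j \<noteq> 1"
  then show "qpoch_inf q x \<noteq> 0"
    unfolding qpoch_inf_def by (intro prodinf_nonzero convergent_qpoch) auto
qed

lemma qpoch_inf_shift_nonzero: "qpoch_inf q x \<noteq> 0 \<Longrightarrow> qpoch_inf q (x * q ^ m) \<noteq> 0"
  using qpoch_inf_split[of x m] by auto

lemma qpoch_nonzero: "qpoch_inf q x \<noteq> 0 \<Longrightarrow> qpoch q x k \<noteq> 0"
  using qpoch_inf_split[of x k] by auto

lemma qpoch_inf_tendsto_1:
  assumes "qpoch_inf q x \<noteq> 0"
  shows "(\<lambda>n. qpoch_inf q (x * q ^ n)) \<longlonglongrightarrow> 1"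
proof -
  have "(\<lambda>n. qpoch_inf q x / qpoch q x n) \<longlonglongrightarrow> qpoch_inf q x / qpoch_inf q x"
    by (intro tendsto_intros qpoch_tendsto assms)
  moreover have "qpoch_inf q x / qpoch q x n = qpoch_inf q (x * q ^ n)" for n
    using qpoch_inf_split[of x n] qpoch_nonzero[OF assms, of n] by simp
  ultimately show ?thesis
    using assms by simp
qed

lemma qpoch_norm_le: "norm (qpoch q x k) \<le> exp (norm x / (1 - norm q))"
proof -
  have "norm (qpoch q x k) = (\<Prod>j<k. norm (1 - x * q ^ j))"
    by (simp add: qpoch_def prod_norm)
  also have "\<dots> \<le> (\<Prod>j<k. exp (norm x * norm q ^ j))"
  proof (intro prod_mono conjI)
    fix j
    have "norm (1 - x * q ^ j) \<le> 1 + norm x * norm q ^ j"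
      by (metis norm_mult norm_one norm_power norm_triangle_ineq4)
    also have "\<dots> \<le> exp (norm x * norm q ^ j)"
      by (rule exp_ge_add_one_self)
    finally show "norm (1 - x * q ^ j) \<le> exp (norm x * norm q ^ j)" .
  qed simp
  also have "\<dots> = exp (norm x * (\<Sum>j<k. norm q ^ j))"
    by (simp add: exp_sum sum_distrib_left)
  also have "\<dots> \<le> exp (norm x * (\<Sum>j. norm q ^ j))"
    using q_less by (intro exp_le_cancel_iff[THEN iffD2] mult_left_mono sum_le_suminf) (auto simp: summable_geometric)
  also have "\<dots> = exp (norm x / (1 - norm q))"
    using q_less by (simp add: suminf_geometric)
  finally show ?thesis .
qed

text \<open>With t = |x q^j| at most 1/2 one has 1/(1 - t) <= 1 + 2t <= exp (2t), and the exponents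
  add up to a geometric series.\<close>

lemma inverse_qpoch_norm_le:
  assumes "norm x \<le> 1 / 2"
  shows "qpoch q x k \<noteq> 0" "norm (1 / qpoch q x k) \<le> exp (2 * norm x / (1 - norm q))"
proof -
  have small: "norm (x * q ^ j) \<le> 1 / 2" for j
  proof -
    have "norm x * norm q ^ j \<le> (1 / 2) * 1"
      using q_less by (intro mult_mono assms power_le_one) auto
    then show ?thesis by (simp add: norm_mult norm_power)
  qed
  have nz: "1 - x * q ^ j \<noteq> 0" for j
    using small[of j] by (metis diff_self eq_iff_diff_eq_0 half_gt_zero_iff less_le_not_le norm_one one_less_numeral_iff semiring_norm(76) divide_less_eq_1_pos zero_less_numeral)
  then show "qpoch q x k \<noteq> 0"
    by (auto simp: qpoch_nonzero_iff)
  have "norm (1 / qpoch q x k) = (\<Prod>j<k. 1 / norm (1 - x * q ^ j))"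
    by (simp add: qpoch_def prod_norm norm_divide prod_dividef)
  also have "\<dots> \<le> (\<Prod>j<k. exp (2 * norm x * norm q ^ j))"
  proof (intro prod_mono conjI)
    fix j
    define t where "t = norm (x * q ^ j)"
    have t: "0 \<le> t" "t \<le> 1 / 2" using small[of j] by (auto simp: t_def)
    have "1 - t \<le> norm (1 - x * q ^ j)"
      unfolding t_def by (metis norm_one norm_triangle_ineq2)
    then have "1 / norm (1 - x * q ^ j) \<le> 1 / (1 - t)"
      using t by (intro divide_left_mono) (auto intro!: mult_pos_pos simp: nz)
    also have "\<dots> \<le> 1 + 2 * t"
    proof -
      have "0 \<le> t * (1 - 2 * t)" using t by (intro mult_nonneg_nonneg) auto
      then show ?thesis using t by (simp add: field_simps)
    qed
    also have "\<dots> \<le> exp (2 * t)" by (rule exp_ge_add_one_self)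
    finally show "1 / norm (1 - x * q ^ j) \<le> exp (2 * norm x * norm q ^ j)"
      by (simp add: t_def norm_mult norm_power mult.assoc)
  qed simp
  also have "\<dots> = exp (2 * norm x * (\<Sum>j<k. norm q ^ j))"
    by (simp add: exp_sum sum_distrib_left)
  also have "\<dots> \<le> exp (2 * norm x * (\<Sum>j. norm q ^ j))"
    using q_less by (intro exp_le_cancel_iff[THEN iffD2] mult_left_mono sum_le_suminf) (auto simp: summable_geometric)
  also have "\<dots> = exp (2 * norm x / (1 - norm q))"
    using q_less by (simp add: suminf_geometric)
  finally show "norm (1 / qpoch q x k) \<le> exp (2 * norm x / (1 - norm q))" .
qed

lemma q_power_small: "e > 0 \<Longrightarrow> \<exists>N. \<forall>n\<ge>N. C * norm q ^ n < (e::real)"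
proof -
  assume e: "e > 0"
  have "(\<lambda>n. C * norm q ^ n) \<longlonglongrightarrow> C * 0"
    by (intro tendsto_intros LIMSEQ_power_zero) (use q_less in auto)
  then have "\<forall>\<^sub>F n in sequentially. C * norm q ^ n < e"
    using e by (intro order_tendstoD) auto
  then show ?thesis by (auto simp: eventually_sequentially)
qed

text \<open>Continuity is needed for finitely many k only: past an index \<open>N\<close> with (|x0|
  + 1) |q|^N < 1/2 the remaining factors fall under \<open>inverse_qpoch_norm_le\<close>. The bound
  is uniform in k, as required to dominate series of functions of the parameters.\<close>

lemma inverse_qpoch_locally_bounded:
  assumes "qpoch_inf q x0 \<noteq> 0"
  shows "\<exists>B. \<forall>\<^sub>F x in nhds x0. \<forall>k. qpoch q x k \<noteq> 0 \<and> norm (1 / qpoch q x k) \<le> B"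
proof -
  obtain N where N: "(norm x0 + 1) * norm q ^ N < 1 / 2"
    using q_power_small[of "1/2" "norm x0 + 1"] by auto
  \<comment> \<open>The added 1 leaves room for a strict inequality in a whole
    neighbourhood.\<close>
  define B1 where "B1 = (\<lambda>k. norm (1 / qpoch q x0 k) + 1)"
  have "\<forall>\<^sub>F x in nhds x0. norm x < norm x0 + 1"
    by (rule order_tendstoD(2)[OF tendsto_norm[OF filterlim_ident]]) simp
  moreover have "\<forall>\<^sub>F x in nhds x0. qpoch q x k \<noteq> 0 \<and> norm (1 / qpoch q x k) < B1 k" for k
  proof -
    have t: "((\<lambda>x. qpoch q x k) \<longlongrightarrow> qpoch q x0 k) (nhds x0)"
      unfolding qpoch_def by (intro tendsto_intros filterlim_ident)
    have nz: "qpoch q x0 k \<noteq> 0" using assms by (rule qpoch_nonzero)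
    have "\<forall>\<^sub>F x in nhds x0. qpoch q x k \<noteq> 0"
      using tendsto_imp_eventually_ne[OF t nz] .
    moreover have "\<forall>\<^sub>F x in nhds x0. norm (1 / qpoch q x k) < B1 k"
      by (rule order_tendstoD(2)[where y = "norm (1 / qpoch q x0 k)"])
        (use nz t in \<open>auto intro!: tendsto_intros simp: B1_def\<close>)
    ultimately show ?thesis by eventually_elim auto
  qed
  then have "\<forall>\<^sub>F x in nhds x0. \<forall>k\<in>{..N}. qpoch q x k \<noteq> 0 \<and> norm (1 / qpoch q x k) < B1 k"
    by (intro eventually_ball_finite) auto
  ultimately have "\<forall>\<^sub>F x in nhds x0. \<forall>k. qpoch q x k \<noteq> 0 \<and>
      norm (1 / qpoch q x k) \<le> (\<Sum>k\<le>N. B1 k) * exp (1 / (1 - norm q))"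
  proof eventually_elim
    case (elim x)
    have B1_pos: "B1 k \<ge> 0" for k by (simp add: B1_def)
    have le: "norm (1 / qpoch q x k) \<le> (\<Sum>k\<le>N. B1 k)" if "k \<le> N" for k
    proof -
      have "norm (1 / qpoch q x k) \<le> B1 k" using elim(2) that by (auto simp: less_imp_le)
      also have "\<dots> \<le> (\<Sum>k\<le>N. B1 k)" using B1_pos that by (intro member_le_sum) auto
      finally show ?thesis .
    qed
    have small: "norm (x * q ^ N) \<le> 1 / 2"
    proof -
      have "norm (x * q ^ N) \<le> (norm x0 + 1) * norm q ^ N"
        using elim(1) by (simp add: norm_mult norm_power mult_right_mono)
      then show ?thesis using N by simp
    qed
    have ex: "2 * norm (x * q ^ N) / (1 - norm q) \<le> 1 / (1 - norm q)"
      using small q_less by (intro divide_right_mono) auto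
    show ?case
    proof
      fix k
      show "qpoch q x k \<noteq> 0 \<and> norm (1 / qpoch q x k) \<le> (\<Sum>k\<le>N. B1 k) * exp (1 / (1 - norm q))"
      proof (cases "k \<le> N")
        case True
        have "(\<Sum>k\<le>N. B1 k) * 1 \<le> (\<Sum>k\<le>N. B1 k) * exp (1 / (1 - norm q))"
          using q_less B1_pos by (intro mult_left_mono sum_nonneg) auto
        then show ?thesis using elim(2) le[OF True] True by auto
      next
        case False
        then obtain m where m: "k = N + m" by (metis le_iff_add nat_le_linear)
        have "norm (1 / qpoch q x k) = norm (1 / qpoch q x N) * norm (1 / qpoch q (x * q ^ N) m)"
          by (simp add: m qpoch_add norm_mult norm_divide)
        also have "\<dots> \<le> (\<Sum>k\<le>N. B1 k) * exp (1 / (1 - norm q))"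
          using inverse_qpoch_norm_le(2)[OF small, of m] ex
          by (intro mult_mono le sum_nonneg B1_pos) (auto intro: order_trans)
        finally show ?thesis
          using elim(2) inverse_qpoch_norm_le(1)[OF small, of m] by (auto simp: m qpoch_add)
      qed
    qed
  qed
  then show ?thesis by blast
qed

lemma inverse_qpoch_bounded:
  assumes "qpoch_inf q x \<noteq> 0"
  shows "\<exists>B. \<forall>k. norm (1 / qpoch q x k) \<le> B"
  using inverse_qpoch_locally_bounded[OF assms] by (auto dest: eventually_nhds_x_imp_x)

text \<open>The reciprocal equals (x)_m / (x)_(m+k), a bounded numerator over a denominator bounded
  away from 0.\<close>

lemma inverse_qpoch_shift_bounded:
  assumes "qpoch_inf q x \<noteq> 0"
  shows "\<exists>B. \<forall>m k. norm (1 / qpoch q (x * q ^ m) k) \<le> B"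
proof -
  obtain B where B: "\<And>k. norm (1 / qpoch q x k) \<le> B"
    using inverse_qpoch_bounded[OF assms] by auto
  have "norm (1 / qpoch q (x * q ^ m) k) \<le> exp (norm x / (1 - norm q)) * B" for m k
  proof -
    have "1 / qpoch q (x * q ^ m) k = qpoch q x m * (1 / qpoch q x (m + k))"
      using qpoch_nonzero[OF assms, of m] by (simp add: qpoch_add)
    then show ?thesis
      by (simp only: norm_mult) (intro mult_mono qpoch_norm_le B; simp)
  qed
  then show ?thesis by blast
qed

end

section \<open>Pincherle's theorem\<close>

text \<open>For the constant coefficients 1 + q and q the combination X (n+1) - q X n is invariant
  and determines the limit, since it annihilates the root q. Under perturbation it moves by at most
  \<gamma> n times the current size and so converges. The explicit error is what later excludes the
  limit 0.\<close>

lemma perturbed_recurrence_converges: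
  fixes X A B :: "nat \<Rightarrow> complex" and q :: complex
  defines "\<gamma> \<equiv> \<lambda>n. norm (A n - (1 + q)) + norm (B n - q)"
  defines "U \<equiv> max (norm (X 0)) (max (norm (X 1)) (norm (X 1 - q * X 0) / (1 - norm q)))"
  assumes q: "norm q < 1" and sm: "summable \<gamma>"
    and rec: "\<And>n. X (Suc (Suc n)) = A n * X (Suc n) - B n * X n"
  shows "\<exists>L. X \<longlonglongrightarrow> L \<and>
    norm ((1 - q) * L - (X 1 - q * X 0)) \<le> suminf \<gamma> * (U * exp (suminf \<gamma> / (1 - norm q)))"
proof -
  define \<rho> where "\<rho> = norm q"
  have \<rho>: "0 \<le> \<rho>" "\<rho> < 1" using q by (auto simp: \<rho>_def)
  define Z where "Z = (\<lambda>n. X (Suc n) - q * X n)"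
  \<comment> \<open>The weight 1/(1 - \<rho>) on \<open>Z\<close> is chosen so that an unperturbed
    step does not increase the maximum: \<rho> V + (1 - \<rho>) V = V.\<close>
  define V where "V = (\<lambda>n. max (norm (X n)) (max (norm (X (Suc n))) (norm (Z n) / (1 - \<rho>))))"
  have \<gamma>_nn: "0 \<le> \<gamma> n" for n by (simp add: \<gamma>_def)
  have V: "norm (X n) \<le> V n" "norm (X (Suc n)) \<le> V n" "norm (Z n) \<le> (1 - \<rho>) * V n" "0 \<le> V n" for n
  proof -
    have "norm (Z n) / (1 - \<rho>) \<le> V n" by (simp add: V_def)
    then show "norm (Z n) \<le> (1 - \<rho>) * V n" using \<rho> by (simp add: field_simps)
  qed (auto simp: V_def le_max_iff_disj)
  have Zdiff: "norm (Z (Suc n) - Z n) \<le> \<gamma> n * V n" for n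
  proof -
    have "Z (Suc n) - Z n = (A n - (1 + q)) * X (Suc n) - (B n - q) * X n"
      by (simp add: Z_def rec algebra_simps)
    also have "norm \<dots> \<le> norm (A n - (1 + q)) * V n + norm (B n - q) * V n"
      using V[of n] by (intro order_trans[OF norm_triangle_ineq4] add_mono) (auto simp: norm_mult intro: mult_left_mono)
    finally show ?thesis by (simp add: \<gamma>_def algebra_simps)
  qed
  have Vstep: "V (Suc n) \<le> V n * (1 + \<gamma> n / (1 - \<rho>))" for n
  proof -
    have ge: "V n \<le> V n * (1 + \<gamma> n / (1 - \<rho>))"
      using mult_left_mono[OF _ V(4)[of n], of 1 "1 + \<gamma> n / (1 - \<rho>)"] \<gamma>_nn[of n] \<rho> by simp
    have "norm (Z (Suc n)) \<le> norm (Z n) + norm (Z (Suc n) - Z n)"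
      by (metis add.commute diff_add_cancel norm_triangle_ineq)
    also have "\<dots> \<le> (1 - \<rho>) * V n + \<gamma> n * V n"
      using V(3)[of n] Zdiff[of n] by linarith
    finally have Z: "norm (Z (Suc n)) \<le> (1 - \<rho>) * V n + \<gamma> n * V n" .
    have "V n * (1 + \<gamma> n / (1 - \<rho>)) * (1 - \<rho>) = V n * ((1 - \<rho>) + \<gamma> n / (1 - \<rho>) * (1 - \<rho>))"
      by (simp only: mult.assoc distrib_right mult_1)
    also have "\<dots> = (1 - \<rho>) * V n + \<gamma> n * V n"
      using \<rho> by (simp add: distrib_left mult.commute)
    finally have Z': "norm (Z (Suc n)) / (1 - \<rho>) \<le> V n * (1 + \<gamma> n / (1 - \<rho>))"
      using \<rho> Z by (simp add: pos_divide_le_eq)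
    have "X (Suc (Suc n)) = q * X (Suc n) + Z (Suc n)" by (simp add: Z_def)
    then have "norm (X (Suc (Suc n))) \<le> \<rho> * norm (X (Suc n)) + norm (Z (Suc n))"
      by (metis \<rho>_def norm_mult norm_triangle_ineq)
    also have "\<dots> \<le> \<rho> * V n + ((1 - \<rho>) * V n + \<gamma> n * V n)"
      using Z \<rho> V(2)[of n] by (intro add_mono mult_left_mono) auto
    also have "\<dots> = V n * (1 + \<gamma> n)" by (simp add: algebra_simps)
    also have "\<dots> \<le> V n * (1 + \<gamma> n / (1 - \<rho>))"
    proof -
      have "\<gamma> n * (1 - \<rho>) \<le> \<gamma> n * 1" using \<gamma>_nn \<rho> by (intro mult_left_mono) auto
      then show ?thesis using V(4)[of n] \<rho> by (intro mult_left_mono add_left_mono) (auto simp: field_simps)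
    qed
    finally have X2: "norm (X (Suc (Suc n))) \<le> V n * (1 + \<gamma> n / (1 - \<rho>))" .
    have "V (Suc n) = max (norm (X (Suc n))) (max (norm (X (Suc (Suc n)))) (norm (Z (Suc n)) / (1 - \<rho>)))"
      by (simp add: V_def)
    also have "\<dots> \<le> V n * (1 + \<gamma> n / (1 - \<rho>))"
      by (intro max.boundedI X2 Z' order_trans[OF V(2) ge])
    finally show ?thesis .
  qed
  have Vb: "V n \<le> V 0 * exp (suminf \<gamma> / (1 - \<rho>))" for n
  proof -
    have "V n \<le> V 0 * exp ((\<Sum>k<n. \<gamma> k) / (1 - \<rho>))"
    proof (induction n)
      case (Suc n)
      have "V (Suc n) \<le> V n * (1 + \<gamma> n / (1 - \<rho>))" by (rule Vstep)
      also have "\<dots> \<le> (V 0 * exp ((\<Sum>k<n. \<gamma> k) / (1 - \<rho>))) * exp (\<gamma> n / (1 - \<rho>))"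
        using Suc V(4)[of 0] \<gamma>_nn[of n] \<rho> by (intro mult_mono exp_ge_add_one_self) auto
      finally show ?case by (simp add: add_divide_distrib exp_add mult.assoc)
    qed simp
    also have "\<dots> \<le> V 0 * exp (suminf \<gamma> / (1 - \<rho>))"
      using V(4)[of 0] \<rho> \<gamma>_nn sm
      by (intro mult_left_mono exp_le_cancel_iff[THEN iffD2] divide_right_mono sum_le_suminf) auto
    finally show ?thesis .
  qed
  define M where "M = V 0 * exp (suminf \<gamma> / (1 - \<rho>))"
  have Zd: "norm (Z (Suc n) - Z n) \<le> \<gamma> n * M" for n
    using Zdiff[of n] Vb[of n] \<gamma>_nn[of n] unfolding M_def by (meson mult_left_mono order_trans)
  have smM: "summable (\<lambda>n. \<gamma> n * M)" using sm by (rule summable_mult2)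
  have sumZn: "summable (\<lambda>n. norm (Z (Suc n) - Z n))"
    by (rule summable_comparison_test'[OF smM, of 0]) (simp only: real_norm_def abs_norm_cancel Zd)
  then have "(\<lambda>n. \<Sum>k<n. Z (Suc k) - Z k) \<longlonglongrightarrow> (\<Sum>k. Z (Suc k) - Z k)"
    by (rule summable_LIMSEQ[OF summable_norm_cancel])
  then have "(\<lambda>n. Z n - Z 0) \<longlonglongrightarrow> (\<Sum>k. Z (Suc k) - Z k)"
    by (simp only: sum_lessThan_telescope)
  from tendsto_add[OF this tendsto_const[of "Z 0"]]
  have Zlim: "Z \<longlonglongrightarrow> (\<Sum>k. Z (Suc k) - Z k) + Z 0" by (simp only: diff_add_cancel)
  define Zi where "Zi = (\<Sum>k. Z (Suc k) - Z k) + Z 0"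
  have "norm (Zi - Z 0) \<le> (\<Sum>n. \<gamma> n * M)"
    unfolding Zi_def using summable_norm[OF sumZn] suminf_le[OF Zd sumZn smM] by simp
  also have "\<dots> = suminf \<gamma> * M" by (rule suminf_mult2[OF sm, symmetric])
  finally have bd: "norm (Zi - Z 0) \<le> suminf \<gamma> * M" .
  have q1: "1 - q \<noteq> 0" using q by auto
  \<comment> \<open>The fixed point of X = q X + Zi; the errors \<open>D\<close> then obey a
    contraction with a forcing term tending to 0.\<close>
  define L where "L = Zi / (1 - q)"
  define D where "D = (\<lambda>n. norm (X n - L))"
  have Dstep: "D (Suc n) \<le> \<rho> * D n + norm (Z n - Zi)" for n
  proof -
    have "L = q * L + Zi" using q1 by (simp add: L_def field_simps)
    then have "X (Suc n) - L = q * (X n - L) + (Z n - Zi)" by (simp add: Z_def algebra_simps)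
    then show ?thesis unfolding D_def \<rho>_def by (metis norm_mult norm_triangle_ineq)
  qed
  have Dlim: "D \<longlonglongrightarrow> 0"
  proof (rule LIMSEQ_I)
    fix e :: real assume e: "e > 0"
    \<comment> \<open>Chosen so that e/2 is the fixed point of t = \<rho> t + d.\<close>
    define d where "d = e / 2 * (1 - \<rho>)"
    have d: "d > 0" using e \<rho> by (simp add: d_def)
    have "(\<lambda>n. norm (Z n - Zi)) \<longlonglongrightarrow> 0"
      using Zlim unfolding Zi_def by (intro tendsto_norm_zero LIM_zero)
    then obtain N where N: "\<And>n. n \<ge> N \<Longrightarrow> norm (Z n - Zi) < d"
      using d by (fastforce dest: LIMSEQ_D)
    have ind: "D (N + m) \<le> \<rho> ^ m * D N + e / 2" for m
    proof (induction m)
      case 0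
      then show ?case using e by simp
    next
      case (Suc m)
      have "D (N + Suc m) \<le> \<rho> * (\<rho> ^ m * D N + e / 2) + d"
        using Dstep[of "N + m"] N[of "N + m"] mult_left_mono[OF Suc \<rho>(1)] by simp
      also have "\<dots> = \<rho> ^ Suc m * D N + e / 2" by (simp add: d_def field_simps)
      finally show ?case .
    qed
    have "(\<lambda>m. \<rho> ^ m * D N) \<longlonglongrightarrow> 0 * D N"
      using \<rho> by (intro tendsto_intros LIMSEQ_power_zero) auto
    then have "\<forall>\<^sub>F m in sequentially. \<rho> ^ m * D N < e / 2"
      using e by (intro order_tendstoD) auto
    then obtain K where K: "\<And>m. m \<ge> K \<Longrightarrow> \<rho> ^ m * D N < e / 2"
      by (auto simp: eventually_sequentially)
    show "\<exists>no. \<forall>n\<ge>no. norm (D n - 0) < e"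
    proof (intro exI allI impI)
      fix n assume "n \<ge> N + K"
      then obtain m where "n = N + m" "m \<ge> K" by (metis le_iff_add add_leD1 nat_add_left_cancel_le)
      then show "norm (D n - 0) < e" using ind[of m] K[of m] by (simp add: D_def)
    qed
  qed
  have "X \<longlonglongrightarrow> L" using Dlim unfolding D_def by (simp add: LIM_zero_iff tendsto_norm_zero_iff)
  moreover have "norm ((1 - q) * L - (X 1 - q * X 0)) \<le> suminf \<gamma> * (U * exp (suminf \<gamma> / (1 - norm q)))"
    using bd q1 by (simp add: L_def Z_def M_def V_def U_def \<rho>_def)
  ultimately show ?thesis by blast
qed

text \<open>For the initial values 1, 1 the invariant of the constant recurrence starts at 1 - q.
  From a late enough start its total drift is smaller than |1 - q|, so the limit cannot be
  0.\<close>

lemma perturbed_recurrence_limit_nonzero: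
  fixes A B :: "nat \<Rightarrow> complex" and q :: complex
  defines "\<gamma> \<equiv> \<lambda>n. norm (A n - (1 + q)) + norm (B n - q)"
  assumes q: "norm q < 1" and sm: "summable \<gamma>"
  shows "\<exists>N. \<forall>X. (\<forall>n. X (Suc (Suc n)) = A (n + N) * X (Suc n) - B (n + N) * X n)
      \<and> X 0 = 1 \<and> X 1 = 1 \<longrightarrow> \<not> X \<longlonglongrightarrow> 0"
proof -
  define U where "U = max 1 (norm (1 - q) / (1 - norm q))"
  define f where "f = (\<lambda>s. s * (U * exp (s / (1 - norm q))))"
  have "(\<lambda>N. \<Sum>n. \<gamma> (n + N)) \<longlonglongrightarrow> 0"
    using suminf_exist_split2[OF sm] by simp
  then have "(\<lambda>N. f (\<Sum>n. \<gamma> (n + N))) \<longlonglongrightarrow> 0 * (U * exp (0 / (1 - norm q)))"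
    unfolding f_def using q by (intro tendsto_intros) auto
  moreover have "0 < norm (1 - q)" using q by auto
  ultimately have "\<forall>\<^sub>F N in sequentially. f (\<Sum>n. \<gamma> (n + N)) < norm (1 - q)"
    by (intro order_tendstoD) auto
  then obtain N where N: "f (\<Sum>n. \<gamma> (n + N)) < norm (1 - q)"
    by (auto simp: eventually_sequentially)
  have "\<not> X \<longlonglongrightarrow> 0" if rec: "\<And>n. X (Suc (Suc n)) = A (n + N) * X (Suc n) - B (n + N) * X n"
    and X: "X 0 = 1" "X 1 = 1" for X
  proof
    assume "X \<longlonglongrightarrow> 0"
    obtain L where L: "X \<longlonglongrightarrow> L" "norm ((1 - q) * L - (X 1 - q * X 0)) \<le> f (\<Sum>n. \<gamma> (n + N))"
      using perturbed_recurrence_converges[OF q, of "\<lambda>n. A (n + N)" "\<lambda>n. B (n + N)" X]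
        summable_ignore_initial_segment[OF sm, of N] rec X
      by (auto simp: f_def U_def \<gamma>_def)
    have "L = 0" using L(1) \<open>X \<longlonglongrightarrow> 0\<close> by (rule LIMSEQ_unique)
    then have "norm (1 - q) \<le> f (\<Sum>n. \<gamma> (n + N))"
      using X L(2) by (simp add: norm_minus_commute)
    then show False using N by simp
  qed
  then show ?thesis by blast
qed

text \<open>Pincherle's theorem for perturbations of the constant recurrence with characteristic roots
  \<open>1\<close> and \<open>q\<close>: a solution tending to 0 is minimal.\<close>

lemma cf_has_value_minimal_solution:
  fixes \<alpha> \<beta> Y :: "nat \<Rightarrow> complex" and q y :: complex
  assumes q: "norm q < 1"
    and sm: "summable (\<lambda>n. norm (\<alpha> n - (1 + q)))" "summable (\<lambda>n. norm (\<beta> n - q))"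
    and \<beta>: "\<And>n. \<beta> (Suc n) \<noteq> 0"
    and Y0: "Y (Suc 0) = \<alpha> 0 * Y 0 - y"
    and rec: "\<And>n. Y (Suc (Suc n)) = \<alpha> (Suc n) * Y (Suc n) - \<beta> (Suc n) * Y n"
    and lim: "Y \<longlonglongrightarrow> 0" and y: "y \<noteq> 0"
  shows "cf_has_value \<alpha> \<beta> (Y 0 / y)"
proof -
  define P Q where "P = cf_num \<alpha> \<beta>" and "Q = cf_den \<alpha> \<beta>"
  have PS: "P (Suc (Suc n)) = \<alpha> (Suc n) * P (Suc n) - \<beta> (Suc n) * P n"
    and QS: "Q (Suc (Suc n)) = \<alpha> (Suc n) * Q (Suc n) - \<beta> (Suc n) * Q n" for n
    by (simp_all add: P_def Q_def)
  \<comment> \<open>\<open>y\<close> plays the part of \<beta> 0 times the value at index -1, so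
    \<open>Y\<close> is the combination of denominators and numerators with these initial
    data.\<close>
  have Y: "Y n = Y 0 * Q n - y * P n \<and> Y (Suc n) = Y 0 * Q (Suc n) - y * P (Suc n)" for n
  proof (induction n)
    case 0
    then show ?case by (simp add: P_def Q_def Y0)
  next
    case (Suc n)
    then show ?case by (simp add: rec PS QS) (simp add: algebra_simps)
  qed
  have sm': "summable (\<lambda>n. norm (\<alpha> (Suc n) - (1 + q)) + norm (\<beta> (Suc n) - q))"
    using sm summable_Suc_iff[of "\<lambda>n. norm (\<alpha> n - (1 + q))"]
      summable_Suc_iff[of "\<lambda>n. norm (\<beta> n - q)"] by (intro summable_add) (simp_all only:)
  obtain LP where LP: "P \<longlonglongrightarrow> LP"
    using perturbed_recurrence_converges[OF q sm' PS] by blast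
  obtain LQ where LQ: "Q \<longlonglongrightarrow> LQ"
    using perturbed_recurrence_converges[OF q sm' QS] by blast
  have "Y \<longlonglongrightarrow> Y 0 * LQ - y * LP"
  proof -
    have "(\<lambda>n. Y 0 * Q n - y * P n) \<longlonglongrightarrow> Y 0 * LQ - y * LP" by (intro tendsto_intros LP LQ)
    moreover have "Y = (\<lambda>n. Y 0 * Q n - y * P n)" using Y by blast
    ultimately show ?thesis by metis
  qed
  from LIMSEQ_unique[OF lim this] have L0: "Y 0 * LQ = y * LP" by simp
  have cas: "P (Suc n) * Q n - P n * Q (Suc n) \<noteq> 0" for n
  proof (induction n)
    case 0
    then show ?case by (simp add: P_def Q_def)
  next
    case (Suc n)
    have "P (Suc (Suc n)) * Q (Suc n) - P (Suc n) * Q (Suc (Suc n))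
        = \<beta> (Suc n) * (P (Suc n) * Q n - P n * Q (Suc n))"
      by (simp add: PS QS algebra_simps)
    then show ?case using Suc \<beta>[of n] by simp
  qed
  \<comment> \<open>If \<open>LQ\<close> vanished, so would \<open>LP\<close>; then every solution,
    being a combination of \<open>P\<close> and \<open>Q\<close>, would tend to 0.\<close>
  have LQ_nz: "LQ \<noteq> 0"
  proof
    assume "LQ = 0"
    then have "LP = 0" using L0 y by simp
    obtain N where N: "\<And>X. (\<And>n. X (Suc (Suc n)) = \<alpha> (Suc (n + N)) * X (Suc n) - \<beta> (Suc (n + N)) * X n)
      \<Longrightarrow> X 0 = 1 \<Longrightarrow> X 1 = 1 \<Longrightarrow> \<not> X \<longlonglongrightarrow> 0"
      using perturbed_recurrence_limit_nonzero[OF q sm'] by blast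
    define w where "w = P (Suc N) * Q N - P N * Q (Suc N)"
    have w: "w \<noteq> 0" using cas by (simp add: w_def)
    \<comment> \<open>Cramer's rule for the initial values 1, 1 at index \<open>N\<close>; the
      determinant is the Casoratian \<open>w\<close>.\<close>
    define u v where "u = (Q N - Q (Suc N)) / w" and "v = (P (Suc N) - P N) / w"
    define X where "X = (\<lambda>n. u * P (n + N) + v * Q (n + N))"
    have "X (Suc (Suc n)) = \<alpha> (Suc (n + N)) * X (Suc n) - \<beta> (Suc (n + N)) * X n" for n
      by (simp add: X_def PS QS) (simp add: algebra_simps)
    moreover have "X 0 = 1" "X 1 = 1"
      using w by (simp_all add: X_def u_def v_def add_divide_distrib[symmetric])
        (simp_all add: w_def algebra_simps)
    moreover have "X \<longlonglongrightarrow> u * LP + v * LQ"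
      unfolding X_def by (intro tendsto_intros LIMSEQ_ignore_initial_segment LP LQ)
    ultimately show False using N[of X] \<open>LQ = 0\<close> \<open>LP = 0\<close> by simp
  qed
  have "\<forall>\<^sub>F n in sequentially. Q n \<noteq> 0"
    by (rule tendsto_imp_eventually_ne[OF LQ LQ_nz])
  moreover have "(\<lambda>n. P n / Q n) \<longlonglongrightarrow> LP / LQ"
    by (intro tendsto_intros LP LQ LQ_nz)
  moreover have "LP / LQ = Y 0 / y"
    using L0 LQ_nz y by (simp add: field_simps)
  ultimately show ?thesis
    by (simp add: cf_has_value_def P_def Q_def)
qed

section \<open>The telescoping certificate\<close>

lemma quadratic_three_zeros:
  fixes k2 k1 k0 y1 y2 y3 :: "'a::field"
  assumes "y1 \<noteq> y2" "y1 \<noteq> y3" "y2 \<noteq> y3"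
    and "k2 * y1\<^sup>2 + k1 * y1 + k0 = 0" "k2 * y2\<^sup>2 + k1 * y2 + k0 = 0" "k2 * y3\<^sup>2 + k1 * y3 + k0 = 0"
  shows "k2 = 0 \<and> k1 = 0 \<and> k0 = 0"
proof -
  have "(y1 - y2) * (k2 * (y1 + y2) + k1) = 0"
    using assms(4,5) by algebra
  then have 1: "k2 * (y1 + y2) + k1 = 0" using assms(1) by simp
  have "(y1 - y3) * (k2 * (y1 + y3) + k1) = 0"
    using assms(4,6) by algebra
  then have 2: "k2 * (y1 + y3) + k1 = 0" using assms(2) by simp
  have "k2 * (y2 - y3) = 0" using 1 2 by algebra
  then have "k2 = 0" using assms(3) by simp
  then show ?thesis using 1 assms(4) by simp
qed

text \<open>Used with w = 1 + a x^2, so that w / x is the variable 1/x + a x. In homogeneous form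
  only the nodes have to be nonzero, and the conclusion covers x = 0.\<close>

lemma quadratic_three_zeros_hom:
  fixes k2 k1 k0 :: "'a::field"
  assumes nz: "x1 \<noteq> 0" "x2 \<noteq> 0" "x3 \<noteq> 0"
    and ne: "w1 * x2 \<noteq> w2 * x1" "w1 * x3 \<noteq> w3 * x1" "w2 * x3 \<noteq> w3 * x2"
    and z: "k2 * w1\<^sup>2 + k1 * w1 * x1 + k0 * x1\<^sup>2 = 0" "k2 * w2\<^sup>2 + k1 * w2 * x2 + k0 * x2\<^sup>2 = 0"
      "k2 * w3\<^sup>2 + k1 * w3 * x3 + k0 * x3\<^sup>2 = 0"
  shows "k2 * w\<^sup>2 + k1 * w * x + k0 * x\<^sup>2 = 0"
proof -
  have *: "k2 * (w / x)\<^sup>2 + k1 * (w / x) + k0 = 0"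
    if "x \<noteq> 0" "k2 * w\<^sup>2 + k1 * w * x + k0 * x\<^sup>2 = 0" for w x
  proof -
    have "(k2 * (w / x)\<^sup>2 + k1 * (w / x) + k0) * x\<^sup>2 = k2 * w\<^sup>2 + k1 * w * x + k0 * x\<^sup>2"
      using that(1) by (simp add: power2_eq_square field_simps)
    then show ?thesis using that by simp
  qed
  have "k2 = 0 \<and> k1 = 0 \<and> k0 = 0"
    by (rule quadratic_three_zeros[of "w1 / x1" "w2 / x2" "w3 / x3"])
      (use ne nz *[OF nz(1) z(1)] *[OF nz(2) z(2)] *[OF nz(3) z(3)] in \<open>auto simp: frac_eq_eq\<close>)
  then show ?thesis by simp
qed

text \<open>The antisymmetry of the numerator difference under \<open>x \<mapsto> 1/(ax)\<close> makes it divisible by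
  \<open>x (1 - a x\<^sup>2)\<close> with a quotient that is, up to \<open>x\<^sup>2\<close>, a quadratic polynomial in \<open>1/x + a x\<close>.\<close>

lemma well_poised_difference:
  fixes a :: complex and P :: "nat \<Rightarrow> complex"
  assumes prod: "(\<Prod>i<8. P i) = a ^ 4" and a: "a \<noteq> 0" and nz: "\<And>i. i < 8 \<Longrightarrow> P i \<noteq> 0"
  obtains C2 C1 C0 where "\<And>x. (\<Prod>i<8. 1 - P i * x) - (\<Prod>i<8. 1 - a * x / P i)
    = x * (1 - a * x\<^sup>2) * (C2 * (1 + a * x\<^sup>2)\<^sup>2 + C1 * (1 + a * x\<^sup>2) * x + C0 * x\<^sup>2)"
proof -
  \<comment> \<open>Elementary symmetric polynomials of four of the eight parameters serve both
    products; the splitting 4 + 4 keeps the polynomial identities small.\<close>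
  have quad: "\<exists>u1 u2 u3. \<forall>x. (1 - P1 * x) * (1 - P2 * x) * (1 - P3 * x) * (1 - P4 * x)
        = 1 - u1 * x + u2 * x^2 - u3 * x^3 + (P1 * P2 * P3 * P4) * x^4 \<and>
      (P1 - a * x) * (P2 - a * x) * (P3 - a * x) * (P4 - a * x)
        = (P1 * P2 * P3 * P4) - a * u3 * x + a^2 * u2 * x^2 - a^3 * u1 * x^3 + a^4 * x^4"
    for P1 P2 P3 P4 :: complex
    by (rule exI[of _ "P1 + P2 + P3 + P4"], rule exI[of _ "P1*P2 + P1*P3 + P1*P4 + P2*P3 + P2*P4 + P3*P4"],
        rule exI[of _ "P1*P2*P3 + P1*P2*P4 + P1*P3*P4 + P2*P3*P4"]) algebra
  obtain u1 u2 u3 where u: "\<And>x. (1 - P 0 * x) * (1 - P 1 * x) * (1 - P 2 * x) * (1 - P 3 * x)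
        = 1 - u1 * x + u2 * x^2 - u3 * x^3 + (P 0 * P 1 * P 2 * P 3) * x^4"
      "\<And>x. (P 0 - a * x) * (P 1 - a * x) * (P 2 - a * x) * (P 3 - a * x)
        = (P 0 * P 1 * P 2 * P 3) - a * u3 * x + a^2 * u2 * x^2 - a^3 * u1 * x^3 + a^4 * x^4"
    using quad[of "P 0" "P 1" "P 2" "P 3"] by blast
  obtain v1 v2 v3 where v: "\<And>x. (1 - P 4 * x) * (1 - P 5 * x) * (1 - P 6 * x) * (1 - P 7 * x)
        = 1 - v1 * x + v2 * x^2 - v3 * x^3 + (P 4 * P 5 * P 6 * P 7) * x^4"
      "\<And>x. (P 4 - a * x) * (P 5 - a * x) * (P 6 - a * x) * (P 7 - a * x)
        = (P 4 * P 5 * P 6 * P 7) - a * v3 * x + a^2 * v2 * x^2 - a^3 * v1 * x^3 + a^4 * x^4"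
    using quad[of "P 4" "P 5" "P 6" "P 7"] by blast
  define u4 v4 where "u4 = P 0 * P 1 * P 2 * P 3" and "v4 = P 4 * P 5 * P 6 * P 7"
  have prod8: "(\<Prod>i<8. f i) = (f 0 * f 1 * f 2 * f 3) * (f 4 * f 5 * f 6 * f 7)" for f :: "nat \<Rightarrow> complex"
    by (simp add: eval_nat_numeral lessThan_Suc mult_ac)
  have uv: "u4 * v4 = a ^ 4" using prod by (simp add: prod8 u4_def v4_def)
  \<comment> \<open>Elementary symmetric polynomials of all eight parameters. The fourth is absent
    because its two contributions to x^4 cancel.\<close>
  define e1 e2 e3 e5 e6 e7 where "e1 = u1 + v1" and "e2 = u2 + u1 * v1 + v2"
    and "e3 = u3 + u2 * v1 + u1 * v2 + v3" and "e5 = u4 * v1 + u3 * v2 + u2 * v3 + u1 * v4"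
    and "e6 = u4 * v2 + u3 * v3 + u2 * v4" and "e7 = u4 * v3 + u3 * v4"
  define D1 D2 D3 where "D1 = a * e7 - a^4 * e1" and "D2 = a^4 * e2 - a^2 * e6"
    and "D3 = a^3 * e5 - a^4 * e3"
  have main: "(\<Prod>i<8. 1 - P i * x) * a ^ 4 - (\<Prod>i<8. P i - a * x)
      = x * (1 - a * x\<^sup>2) * (D1 * (1 + a * x\<^sup>2)\<^sup>2 + D2 * (1 + a * x\<^sup>2) * x + (D3 - a * D1) * x\<^sup>2)" for x
    unfolding prod8 u v u4_def[symmetric] v4_def[symmetric] D1_def D2_def D3_def
      e1_def e2_def e3_def e5_def e6_def e7_def
    using uv by algebra
  have "(\<Prod>i<8. 1 - P i * x) - (\<Prod>i<8. 1 - a * x / P i)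
    = x * (1 - a * x\<^sup>2) * (D1 / a^4 * (1 + a * x\<^sup>2)\<^sup>2 + D2 / a^4 * (1 + a * x\<^sup>2) * x + (D3 - a * D1) / a^4 * x\<^sup>2)" for x
  proof -
    have "(\<Prod>i<8. 1 - a * x / P i) = (\<Prod>i<8. (P i - a * x) / P i)"
      using nz by (intro prod.cong) (auto simp: field_simps)
    also have "\<dots> = (\<Prod>i<8. P i - a * x) / a ^ 4" by (simp add: prod_dividef prod)
    finally have "(\<Prod>i<8. 1 - P i * x) - (\<Prod>i<8. 1 - a * x / P i)
      = ((\<Prod>i<8. 1 - P i * x) * a ^ 4 - (\<Prod>i<8. P i - a * x)) / a ^ 4"
      using a by (simp add: diff_divide_distrib)
    also have "\<dots> = x * (1 - a * x\<^sup>2) * (D1 / a^4 * (1 + a * x\<^sup>2)\<^sup>2 + D2 / a^4 * (1 + a * x\<^sup>2) * x + (D3 - a * D1) / a^4 * x\<^sup>2)"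
      unfolding main by (simp add: add_divide_distrib[symmetric])
    finally show ?thesis .
  qed
  then show ?thesis by (rule that)
qed

text \<open>With p = s q^(n-1) / h and r = h q^(-n), \<open>shift_up\<close>,
  \<open>shift_down\<close> and \<open>shift_rest\<close> are A_n, B_n and the last summand of a_n.
  Passing to n + 1 replaces p by p q and r by r / q, with p r unchanged.\<close>

definition shift_up :: "complex \<Rightarrow> complex \<Rightarrow> complex list \<Rightarrow> complex \<Rightarrow> complex \<Rightarrow> complex" where
  "shift_up q a bs p r = (1 - p) * (1 - p / a) * prod_list (map (\<lambda>b. 1 - a * q / (b * r)) bs)
     / ((1 - p * q / r) * (1 - p / r) * (1 - a * q / r))"

definition shift_down :: "complex \<Rightarrow> complex \<Rightarrow> complex list \<Rightarrow> complex \<Rightarrow> complex \<Rightarrow> complex" where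
  "shift_down q a bs p r = q * (1 - 1 / r) * (1 - a / r) * prod_list (map (\<lambda>b. 1 - b * p / (a * q)) bs)
     / ((1 - p / r) * (1 - p / (q * r)) * (1 - p / (a * q)))"

definition shift_rest :: "complex \<Rightarrow> complex \<Rightarrow> complex list \<Rightarrow> complex \<Rightarrow> complex \<Rightarrow> complex" where
  "shift_rest q a bs p r = p / (a * r) * (1 - p * r / (a * q)) * prod_list (map (\<lambda>b. 1 - b) bs)
     / ((1 - a * q / r) * (1 - p / (a * q)))"

text \<open>Dictated by the certificate at x = 1: it is \<open>shift_rest\<close> with reversed
  sign, divided by (1 - p/q) (1 - r/q) and by the product of the 1 - b.\<close>

definition shift_factor :: "complex \<Rightarrow> complex \<Rightarrow> complex \<Rightarrow> complex \<Rightarrow> complex" where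
  "shift_factor q a p r = - (p / (a * r)) * (1 - p * r / (a * q))
     / ((1 - a * q / r) * (1 - p / (a * q)) * (1 - p / q) * (1 - r / q))"

text \<open>Replacing a parameter u by u q multiplies a well-poised weight by
  \<open>lin_factor a u x / lin_factor a u 1\<close>.\<close>

definition lin_factor :: "complex \<Rightarrow> complex \<Rightarrow> complex \<Rightarrow> complex" where
  "lin_factor a u x = (1 - u * x) * (1 - a * x / u)"

lemma lin_factor_eq: "u \<noteq> 0 \<Longrightarrow> lin_factor a u x = (1 + a * x\<^sup>2) - (u + a / u) * x"
  by (simp add: lin_factor_def power2_eq_square field_simps)

text \<open>\<open>base_num\<close> at x over \<open>base_den\<close> at q x is the ratio of
  consecutive weights for the parameters p/q and r/q; the three contiguous weights are multiples of
  this one.\<close>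

definition base_num :: "complex \<Rightarrow> complex \<Rightarrow> complex list \<Rightarrow> complex \<Rightarrow> complex \<Rightarrow> complex \<Rightarrow> complex" where
  "base_num q a bs p r x = (1 - a * x) * prod_list (map (\<lambda>b. 1 - b * x) bs) * (1 - p * x / q) * (1 - r * x / q)"

definition base_den :: "complex \<Rightarrow> complex \<Rightarrow> complex list \<Rightarrow> complex \<Rightarrow> complex \<Rightarrow> complex \<Rightarrow> complex" where
  "base_den q a bs p r x = (1 - x) * prod_list (map (\<lambda>b. 1 - a * x / b) bs) * (1 - a * q * x / p) * (1 - a * q * x / r)"

text \<open>After division by x (1 - a x^2) both sides are x^2 times a quadratic in 1/x + a x. At x
  = 1 \<open>base_den\<close> vanishes and the three quotients are 1; at x = q/p and x = q/r
  \<open>base_num\<close> vanishes and a single shifted weight survives. The right side is the form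
  that telescopes along a q-lattice.\<close>

lemma contiguous_certificate:
  fixes a b c d e f p q r x :: complex
  defines "bs \<equiv> [b, c, d, e, f]"
  defines "A \<equiv> shift_up q a bs p r" and "B \<equiv> shift_down q a bs p r" and "R \<equiv> shift_rest q a bs p r"
  assumes bal: "b * c * d * e * f * p * r = a ^ 3 * q\<^sup>2"
    and nz: "a \<noteq> 0" "q \<noteq> 0" "b \<noteq> 0" "c \<noteq> 0" "d \<noteq> 0" "e \<noteq> 0" "f \<noteq> 0" "p \<noteq> 0" "r \<noteq> 0"
    and a1: "a \<noteq> 1" and p: "p \<noteq> 1" "p \<noteq> q" "p \<noteq> a" "p \<noteq> a * q" "p\<^sup>2 \<noteq> a * q\<^sup>2"
    and r: "r \<noteq> 1" "r \<noteq> q" "r \<noteq> a" "r \<noteq> a * q" "r\<^sup>2 \<noteq> a * q\<^sup>2"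
    and pr: "p \<noteq> r" "p \<noteq> q * r" "p * q \<noteq> r" "p * r \<noteq> a * q\<^sup>2"
  shows "x * (1 - a * x\<^sup>2) * (A * (lin_factor a (p / q) x * lin_factor a p x) / (lin_factor a (p / q) 1 * lin_factor a p 1)
      - (A + B + R) * (lin_factor a (p / q) x * lin_factor a (r / q) x) / (lin_factor a (p / q) 1 * lin_factor a (r / q) 1)
      + B * (lin_factor a (r / q) x * lin_factor a r x) / (lin_factor a (r / q) 1 * lin_factor a r 1))
    = shift_factor q a p r * (base_num q a bs p r x - base_den q a bs p r x)"
proof -
  define lam where "lam = shift_factor q a p r"
  define kA k0 kB where "kA = A / (lin_factor a (p / q) 1 * lin_factor a p 1)"
    and "k0 = (A + B + R) / (lin_factor a (p / q) 1 * lin_factor a (r / q) 1)"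
    and "kB = B / (lin_factor a (r / q) 1 * lin_factor a r 1)"
  define L where "L = (\<lambda>x. kA * (lin_factor a (p / q) x * lin_factor a p x)
     - k0 * (lin_factor a (p / q) x * lin_factor a (r / q) x) + kB * (lin_factor a (r / q) x * lin_factor a r x))"
  define P where "P = (\<lambda>i::nat. [a, b, c, d, e, f, p / q, r / q] ! i)"
  have prod8: "(\<Prod>i<8. F i) = F 0 * F 1 * F 2 * F 3 * F 4 * F 5 * F 6 * F 7" for F :: "nat \<Rightarrow> complex"
    by (simp add: eval_nat_numeral lessThan_Suc mult_ac)
  have P: "P 0 = a" "P 1 = b" "P (Suc 0) = b" "P 2 = c" "P 3 = d" "P 4 = e" "P 5 = f" "P 6 = p / q" "P 7 = r / q"
    by (simp_all add: P_def)
  have num: "(\<Prod>i<8. 1 - P i * x) = base_num q a bs p r x" for x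
    by (simp add: prod8 P base_num_def bs_def mult_ac)
  have den: "(\<Prod>i<8. 1 - a * x / P i) = base_den q a bs p r x" for x
    using nz by (simp add: prod8 P base_den_def bs_def mult_ac)
  have prodP: "(\<Prod>i<8. P i) = a ^ 4"
  proof -
    have "(\<Prod>i<8. P i) = a * (b * c * d * e * f * p * r) / q\<^sup>2"
      by (simp add: prod8 P power2_eq_square)
    then show ?thesis using nz by (simp add: bal eval_nat_numeral)
  qed
  have Pnz: "P i \<noteq> 0" if "i < 8" for i
  proof -
    have "i \<in> {0, 1, 2, 3, 4, 5, 6, 7}" using that by auto
    then show ?thesis using nz P by auto
  qed
  obtain C2 C1 C0 where C: "\<And>x. base_num q a bs p r x - base_den q a bs p r x
    = x * (1 - a * x\<^sup>2) * (C2 * (1 + a * x\<^sup>2)\<^sup>2 + C1 * (1 + a * x\<^sup>2) * x + C0 * x\<^sup>2)"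
    using well_poised_difference[OF prodP nz(1) Pnz] unfolding num den by blast
  define K where "K = (\<lambda>x. C2 * (1 + a * x\<^sup>2)\<^sup>2 + C1 * (1 + a * x\<^sup>2) * x + C0 * x\<^sup>2)"
  have C': "base_num q a bs p r x - base_den q a bs p r x = x * (1 - a * x\<^sup>2) * K x" for x
    by (simp add: C K_def)
  have "\<exists>K2 K1 K0. \<forall>x. L x - lam * K x = K2 * (1 + a * x\<^sup>2)\<^sup>2 + K1 * (1 + a * x\<^sup>2) * x + K0 * x\<^sup>2"
  proof -
    define m1 m2 m3 m4 where "m1 = p / q + a / (p / q)" and "m2 = p + a / p"
      and "m3 = r / q + a / (r / q)" and "m4 = r + a / r"
    have lf: "lin_factor a (p / q) x = (1 + a * x\<^sup>2) - m1 * x" "lin_factor a p x = (1 + a * x\<^sup>2) - m2 * x"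
      "lin_factor a (r / q) x = (1 + a * x\<^sup>2) - m3 * x" "lin_factor a r x = (1 + a * x\<^sup>2) - m4 * x" for x
      unfolding m1_def m2_def m3_def m4_def using nz by (simp_all add: lin_factor_eq)
    show ?thesis
      by (rule exI[of _ "kA - k0 + kB - lam * C2"],
          rule exI[of _ "- kA * (m1 + m2) + k0 * (m1 + m3) - kB * (m3 + m4) - lam * C1"],
          rule exI[of _ "kA * m1 * m2 - k0 * m1 * m3 + kB * m3 * m4 - lam * C0"], rule allI)
        (unfold L_def K_def lf, algebra)
  qed
  then obtain K2 K1 K0 where K: "\<And>x. L x - lam * K x = K2 * (1 + a * x\<^sup>2)\<^sup>2 + K1 * (1 + a * x\<^sup>2) * x + K0 * x\<^sup>2"
    by blast
  have lf_nz: "lin_factor a (p / q) 1 \<noteq> 0" "lin_factor a p 1 \<noteq> 0" "lin_factor a (r / q) 1 \<noteq> 0" "lin_factor a r 1 \<noteq> 0"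
  proof -
    have *: "lin_factor a u 1 \<noteq> 0" if "u \<noteq> 0" "u \<noteq> 1" "u \<noteq> a" for u
      using that by (simp add: lin_factor_def)
    show "lin_factor a (p / q) 1 \<noteq> 0" "lin_factor a p 1 \<noteq> 0" "lin_factor a (r / q) 1 \<noteq> 0" "lin_factor a r 1 \<noteq> 0"
      by (rule *; use nz p r in \<open>auto simp: divide_eq_eq\<close>)+
  qed
  have at1: "L 1 - lam * K 1 = 0"
  proof -
    have "L 1 = - R" using lf_nz by (simp add: L_def kA_def k0_def kB_def)
    moreover have "lam * ((1 - a) * K 1) = - R * (1 - a)"
    proof -
      have nz1: "1 - p / q \<noteq> 0" "1 - r / q \<noteq> 0" using p r nz by auto
      have "(1 - a) * K 1 = base_num q a bs p r 1" using C'[of 1] by (simp add: base_den_def)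
      then have "lam * ((1 - a) * K 1) = lam * base_num q a bs p r 1" by simp
      also have "\<dots> = - R * (1 - a)"
      proof -
        have *: "- X * Y / (D1 * D2 * S2 * S3) * ((1 - a) * G * S2 * S3) = - (X * Y * G / (D1 * D2)) * (1 - a)"
          if "S2 \<noteq> 0" "S3 \<noteq> 0" for X Y D1 D2 S2 S3 G :: complex
          using that by simp
        show ?thesis
          unfolding lam_def shift_factor_def base_num_def R_def shift_rest_def mult_1_right by (rule *[OF nz1])
      qed
      finally show ?thesis .
    qed
    then have "(1 - a) * (lam * K 1) = (1 - a) * (- R)" by (simp add: mult_ac)
    then have "lam * K 1 = - R" by (subst (asm) mult_left_cancel) (use a1 in auto)
    ultimately show ?thesis by simp
  qed
  \<comment> \<open>Names for the linear factors of the coefficients, so that the evaluations at q/p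
    and q/r reduce to comparing monomials.\<close>
  define X1 X2 X3 X4 X5 X6 X7 X8 X9 X10 X11 where X: "X1 = r - p" "X2 = q * r - p" "X3 = a * q - p" "X4 = q - r" "X5 = 1 - r"
    "X6 = r - a" "X7 = r - a * q" "X8 = a * q - p * r" "X9 = q - p" "X10 = r - p * q" "X11 = p - a"
  have Xnz: "X1 \<noteq> 0" "X2 \<noteq> 0" "X3 \<noteq> 0" "X4 \<noteq> 0" "X5 \<noteq> 0" "X6 \<noteq> 0" "X7 \<noteq> 0" "X9 \<noteq> 0" "X10 \<noteq> 0" "X11 \<noteq> 0"
    using X p r pr by auto
  have lam': "lam = - (p / (a * r)) * (X8 / (a * q)) / ((X7 / r) * (X3 / (a * q)) * (X9 / q) * (X4 / q))"
    unfolding lam_def shift_factor_def X using nz by (simp add: diff_divide_distrib)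
  \<comment> \<open>The balancing condition turns the parameter product in \<open>shift_down\<close>
    into the one in \<open>base_den\<close> at x = q/p.\<close>
  have G: "(1 - b * p / (a * q)) * (1 - c * p / (a * q)) * (1 - d * p / (a * q)) * (1 - e * p / (a * q)) * (1 - f * p / (a * q))
     = - (p ^ 4 / (a\<^sup>2 * q ^ 3 * r)) * prod_list (map (\<lambda>b. 1 - a * (q / p) / b) bs)"
    if nz: "p \<noteq> 0" "r \<noteq> 0" and bal: "b * c * d * e * f * p * r = a ^ 3 * q\<^sup>2" for p r
  proof -
    have *: "1 - b * p / (a * q) = - (b * p / (a * q)) * (1 - a * (q / p) / b)" if "b \<noteq> 0" for b
      using that nz \<open>a \<noteq> 0\<close> \<open>q \<noteq> 0\<close> by (simp add: field_simps)
    have "(- (b * p / (a * q))) * (- (c * p / (a * q))) * (- (d * p / (a * q))) * (- (e * p / (a * q))) * (- (f * p / (a * q)))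
       = - (b * c * d * e * f * p * r) * p ^ 4 / (a ^ 5 * q ^ 5 * r)"
      using nz \<open>a \<noteq> 0\<close> \<open>q \<noteq> 0\<close> by (simp add: field_simps eval_nat_numeral)
    also have "\<dots> = - (p ^ 4 / (a\<^sup>2 * q ^ 3 * r))"
      unfolding bal using nz \<open>a \<noteq> 0\<close> \<open>q \<noteq> 0\<close> by (simp add: field_simps eval_nat_numeral)
    finally have "- (p ^ 4 / (a\<^sup>2 * q ^ 3 * r)) * prod_list (map (\<lambda>b. 1 - a * (q / p) / b) bs) =
        (- (b * p / (a * q))) * (- (c * p / (a * q))) * (- (d * p / (a * q))) * (- (e * p / (a * q))) * (- (f * p / (a * q)))
         * prod_list (map (\<lambda>b. 1 - a * (q / p) / b) bs)" by simp
    also have "\<dots> = (1 - b * p / (a * q)) * (1 - c * p / (a * q)) * (1 - d * p / (a * q)) * (1 - e * p / (a * q)) * (1 - f * p / (a * q))"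
      unfolding bs_def list.map prod_list.Cons prod_list.Nil *[OF \<open>b \<noteq> 0\<close>] *[OF \<open>c \<noteq> 0\<close>] *[OF \<open>d \<noteq> 0\<close>] *[OF \<open>e \<noteq> 0\<close>] *[OF \<open>f \<noteq> 0\<close>]
      by (simp only: mult_ac mult_1_right mult_1_left mult_minus_left mult_minus_right)
    finally show ?thesis by simp
  qed
  have atp: "L (q / p) - lam * K (q / p) = 0"
  proof -
    define x where "x = q / p"
    define g where "g = prod_list (map (\<lambda>b. 1 - a * x / b) bs)"
    define Y where "Y = 1 - a * x\<^sup>2"
    have Y: "Y \<noteq> 0" using p nz by (simp add: Y_def x_def power_divide field_simps)
    have x: "x \<noteq> 0" using nz by (simp add: x_def)
    have "lin_factor a (p / q) x = 0" using nz by (simp add: lin_factor_def x_def)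
    then have L: "L x = kB * (lin_factor a (r / q) x * lin_factor a r x)" by (simp add: L_def)
    have N0: "base_num q a bs p r x = 0" using nz by (simp add: base_num_def x_def)
    have D0: "base_den q a bs p r x = - (X9 / p) * g * Y * (1 - a * q * x / r)"
      using nz by (simp add: base_den_def g_def Y_def X x_def field_simps power2_eq_square)
    have B': "B = q * (- X5 / r) * (X6 / r) * (- (p ^ 4 / (a\<^sup>2 * q ^ 3 * r)) * g) / ((X1 / r) * (X2 / (q * r)) * (X3 / (a * q)))"
    proof -
      have "B = q * (1 - 1 / r) * (1 - a / r) * (- (p ^ 4 / (a\<^sup>2 * q ^ 3 * r)) * g)
          / ((1 - p / r) * (1 - p / (q * r)) * (1 - p / (a * q)))"
        unfolding B_def shift_down_def g_def x_def G[OF nz(8) nz(9) bal, symmetric] by (simp add: bs_def mult_ac)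
      then show ?thesis unfolding X using nz by (simp add: diff_divide_distrib)
    qed
    have l1: "lin_factor a (r / q) x = - (X1 / p) * (1 - a * q * x / r)"
      using nz by (simp add: lin_factor_def X x_def field_simps)
    have l2: "lin_factor a r x = - (X2 / p) * (- X8 / (p * r))"
      using nz by (simp add: lin_factor_def X x_def field_simps)
    have l3: "lin_factor a (r / q) 1 = X4 / q * (X7 / r)" "lin_factor a r 1 = X5 * (X6 / r)"
      using nz by (simp_all add: lin_factor_def X field_simps)
    have "x * Y * (L x - lam * K x) = x * Y * L x - lam * (base_num q a bs p r x - base_den q a bs p r x)"
      unfolding C' Y_def by (simp add: algebra_simps)
    also have "\<dots> = x * Y * L x + lam * (- (X9 / p) * g * Y * (1 - a * q * x / r))" by (simp add: N0 D0)
    also have "x * Y * L x = (q / p) * Y * (B / (X4 / q * (X7 / r) * (X5 * (X6 / r)))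
         * ((- (X1 / p) * (1 - a * q * x / r)) * (- (X2 / p) * (- X8 / (p * r)))))"
      unfolding L kB_def l1 l2 l3 by (simp add: x_def)
    also have "\<dots> + lam * (- (X9 / p) * g * Y * (1 - a * q * x / r)) = 0"
      unfolding B' lam' using Xnz nz by (simp add: divide_simps eval_nat_numeral) (simp only: mult_ac)?
    finally show ?thesis using x Y by (simp add: x_def)
  qed
  have atr: "L (q / r) - lam * K (q / r) = 0"
  proof -
    define x where "x = q / r"
    define g where "g = prod_list (map (\<lambda>b. 1 - a * x / b) bs)"
    define Y where "Y = 1 - a * x\<^sup>2"
    define X12 where "X12 = 1 - p"
    have X12: "X12 \<noteq> 0" using p by (simp add: X12_def)
    have Y: "Y \<noteq> 0" using r nz by (simp add: Y_def x_def power_divide field_simps)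
    have x: "x \<noteq> 0" using nz by (simp add: x_def)
    have "lin_factor a (r / q) x = 0" using nz by (simp add: lin_factor_def x_def)
    then have L: "L x = kA * (lin_factor a (p / q) x * lin_factor a p x)" by (simp add: L_def)
    have N0: "base_num q a bs p r x = 0" using nz by (simp add: base_num_def x_def)
    have D0: "base_den q a bs p r x = - (X4 / r) * g * Y * (1 - a * q * x / p)"
      using nz by (simp add: base_den_def g_def Y_def X x_def field_simps power2_eq_square)
    have A': "A = X12 * (- X11 / a) * g / ((X10 / r) * (X1 / r) * (X7 / r))"
    proof -
      have g': "g = prod_list (map (\<lambda>b. 1 - a * q / (b * r)) bs)"
        by (simp add: g_def x_def bs_def mult.commute)
      show ?thesis unfolding A_def shift_up_def g' X X12_def using nz by (simp add: diff_divide_distrib)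
    qed
    have l1: "lin_factor a (p / q) x = X1 / r * (1 - a * q * x / p)"
      using nz by (simp add: lin_factor_def X x_def field_simps)
    have l2: "lin_factor a p x = X10 / r * (- X8 / (p * r))"
      using nz by (simp add: lin_factor_def X x_def field_simps)
    have l3: "lin_factor a (p / q) 1 = X9 / q * (- X3 / p)" "lin_factor a p 1 = X12 * (X11 / p)"
      using nz by (simp_all add: lin_factor_def X X12_def field_simps)
    have "x * Y * (L x - lam * K x) = x * Y * L x - lam * (base_num q a bs p r x - base_den q a bs p r x)"
      unfolding C' Y_def by (simp add: algebra_simps)
    also have "\<dots> = x * Y * L x + lam * (- (X4 / r) * g * Y * (1 - a * q * x / p))" by (simp add: N0 D0)
    also have "x * Y * L x = (q / r) * Y * (A / (X9 / q * (- X3 / p) * (X12 * (X11 / p)))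
         * (X1 / r * (1 - a * q * x / p) * (X10 / r * (- X8 / (p * r)))))"
      unfolding L kA_def l1 l2 l3 by (simp add: x_def)
    also have "\<dots> + lam * (- (X4 / r) * g * Y * (1 - a * q * x / p)) = 0"
      unfolding A' lam' using Xnz X12 nz by (simp add: divide_simps eval_nat_numeral) (simp only: mult_ac)?
    finally show ?thesis using x Y by (simp add: x_def)
  qed
  \<comment> \<open>Distinctness of the three values of 1/x + a x, cross-multiplied.\<close>
  have ne: "(1 + a * 1\<^sup>2) * (q / p) \<noteq> (1 + a * (q / p)\<^sup>2) * 1" "(1 + a * 1\<^sup>2) * (q / r) \<noteq> (1 + a * (q / r)\<^sup>2) * 1"
    "(1 + a * (q / p)\<^sup>2) * (q / r) \<noteq> (1 + a * (q / r)\<^sup>2) * (q / p)"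
  proof -
    have "(1 + a * 1\<^sup>2) * (q / u) - (1 + a * (q / u)\<^sup>2) * 1 = (q - u) * (u - a * q) / u\<^sup>2" if "u \<noteq> 0" for u
      using that by (simp add: power2_eq_square field_simps)
    from this[OF nz(8)] this[OF nz(9)]
    show "(1 + a * 1\<^sup>2) * (q / p) \<noteq> (1 + a * (q / p)\<^sup>2) * 1" "(1 + a * 1\<^sup>2) * (q / r) \<noteq> (1 + a * (q / r)\<^sup>2) * 1"
      using p r nz by auto
    have "(1 + a * (q / p)\<^sup>2) * (q / r) - (1 + a * (q / r)\<^sup>2) * (q / p) = q * (p - r) * (p * r - a * q\<^sup>2) / (p\<^sup>2 * r\<^sup>2)"
      using nz by (simp add: power2_eq_square field_simps)
    then show "(1 + a * (q / p)\<^sup>2) * (q / r) \<noteq> (1 + a * (q / r)\<^sup>2) * (q / p)"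
      using nz pr by auto
  qed
  have "L x - lam * K x = 0"
    unfolding K
    by (rule quadratic_three_zeros_hom[OF _ _ _ ne]) (use nz at1 atp atr in \<open>simp_all add: K\<close>)
  then have "x * (1 - a * x\<^sup>2) * L x = lam * (base_num q a bs p r x - base_den q a bs p r x)"
    unfolding C' by (simp add: mult_ac)
  then show ?thesis
    by (simp add: L_def kA_def k0_def kB_def lam_def)
qed

section \<open>Inversion of the parameters\<close>

text \<open>The Lagrange interpolant at the nodes of \<open>A\<close> equals \<open>g\<close>
  because the degree is below their number; the left side is its top coefficient.\<close>

lemma divided_difference_top_coeff:
  fixes g :: "'a::field poly"
  assumes fin: "finite A" and deg: "degree g < card A"
  shows "(\<Sum>t\<in>A. poly g t / (\<Prod>u\<in>A - {t}. t - u)) = coeff g (card A - 1)"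
proof -
  define N where "N = (\<lambda>t. \<Prod>u\<in>A - {t}. [:- u, 1:])"
  define w where "w = (\<lambda>t. poly g t / (\<Prod>u\<in>A - {t}. t - u))"
  define L where "L = (\<Sum>t\<in>A. smult (w t) (N t))"
  have degN: "degree (N t) = card A - 1" if "t \<in> A" for t
    unfolding N_def using that fin by (subst degree_prod_sum_eq) auto
  have N: "poly (N t) s = (\<Prod>u\<in>A - {t}. s - u)" for s t
    by (simp add: N_def poly_prod)
  have lcN: "coeff (N t) (card A - 1) = 1" if "t \<in> A" for t
    using degN[OF that] lead_coeff_prod[of "\<lambda>u. [:- u, 1:]" "A - {t}"] by (simp add: N_def)
  have L: "poly L s = poly g s" if s: "s \<in> A" for s
  proof -
    have z: "w t * poly (N t) s = 0" if "t \<in> A - {s}" for t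
      unfolding N using fin s that by (auto intro!: prod_zero)
    have nz: "(\<Prod>u\<in>A - {s}. s - u) \<noteq> 0"
      using fin by (simp add: prod_zero_iff)
    have "poly L s = (\<Sum>t\<in>A. w t * poly (N t) s)" by (simp add: L_def poly_sum)
    also have "\<dots> = (\<Sum>t\<in>{s}. w t * poly (N t) s)"
      using fin s z by (intro sum.mono_neutral_right) auto
    also have "\<dots> = poly g s" using nz by (simp add: w_def N)
    finally show ?thesis .
  qed
  have card: "card A > 0" using deg by simp
  have "degree L \<le> card A - 1"
    unfolding L_def using fin degN by (intro degree_sum_le) (auto intro: order_trans[OF degree_smult_le])
  then have "degree L < card A" using card by simp
  then have "L = g" by (intro poly_eqI_degree[of A] L deg)
  then have "coeff g (card A - 1) = coeff L (card A - 1)" by simp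
  also have "\<dots> = (\<Sum>t\<in>A. w t)" using lcN by (simp add: L_def coeff_sum)
  finally show ?thesis by (simp add: w_def)
qed

lemma divided_difference_seven:
  fixes g :: "'a::field poly"
  assumes dist: "distinct [t0, t1, t2, t3, t4, t5, t6]" and deg: "degree g \<le> 6"
  shows "poly g t0 / ((t0-t1)*(t0-t2)*(t0-t3)*(t0-t4)*(t0-t5)*(t0-t6))
    + poly g t1 / ((t1-t0)*(t1-t2)*(t1-t3)*(t1-t4)*(t1-t5)*(t1-t6))
    + poly g t2 / ((t2-t0)*(t2-t1)*(t2-t3)*(t2-t4)*(t2-t5)*(t2-t6))
    + poly g t3 / ((t3-t0)*(t3-t1)*(t3-t2)*(t3-t4)*(t3-t5)*(t3-t6))
    + poly g t4 / ((t4-t0)*(t4-t1)*(t4-t2)*(t4-t3)*(t4-t5)*(t4-t6))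
    + poly g t5 / ((t5-t0)*(t5-t1)*(t5-t2)*(t5-t3)*(t5-t4)*(t5-t6))
    + poly g t6 / ((t6-t0)*(t6-t1)*(t6-t2)*(t6-t3)*(t6-t4)*(t6-t5)) = coeff g 6"
proof -
  have D: "{t0,t1,t2,t3,t4,t5,t6} - {t0} = {t1,t2,t3,t4,t5,t6}"
    "{t0,t1,t2,t3,t4,t5,t6} - {t1} = {t0,t2,t3,t4,t5,t6}"
    "{t0,t1,t2,t3,t4,t5,t6} - {t2} = {t0,t1,t3,t4,t5,t6}"
    "{t0,t1,t2,t3,t4,t5,t6} - {t3} = {t0,t1,t2,t4,t5,t6}"
    "{t0,t1,t2,t3,t4,t5,t6} - {t4} = {t0,t1,t2,t3,t5,t6}"
    "{t0,t1,t2,t3,t4,t5,t6} - {t5} = {t0,t1,t2,t3,t4,t6}"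
    "{t0,t1,t2,t3,t4,t5,t6} - {t6} = {t0,t1,t2,t3,t4,t5}"
    using dist by (auto)
  have card: "card {t0, t1, t2, t3, t4, t5, t6} = 7" using dist by simp
  have "degree g < card {t0, t1, t2, t3, t4, t5, t6}" using deg card by simp
  from divided_difference_top_coeff[OF _ this] show ?thesis
    unfolding card using dist by (simp add: D mult.assoc add.assoc)
qed

text \<open>The six summands and a constant are the terms of the divided difference of
  \<open>(1 - b t) (1 - c t) (1 - d t) (1 - e t) (1 - f t) (t - p r / (a q))\<close> at the nodes
  \<open>0, r/(a q), p/(a q), 1, p/a, r/a, 1/q\<close>.\<close>

lemma shift_sum_inversion:
  fixes a b c d e f p q r :: complex
  defines "bs \<equiv> [b, c, d, e, f]"
  defines "S \<equiv> \<lambda>a bs p r. shift_up q a bs p r + shift_down q a bs p r + shift_rest q a bs p r"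
  assumes bal: "b * c * d * e * f * p * r = a ^ 3 * q\<^sup>2"
    and nz: "a \<noteq> 0" "q \<noteq> 0" "b \<noteq> 0" "c \<noteq> 0" "d \<noteq> 0" "e \<noteq> 0" "f \<noteq> 0" "p \<noteq> 0" "r \<noteq> 0"
    and q: "q \<noteq> 1" and p: "p \<noteq> a" "p \<noteq> a * q" "p * q \<noteq> a"
    and r: "r \<noteq> a" "r \<noteq> a * q" "r * q \<noteq> a"
    and pr: "p \<noteq> r" "p \<noteq> q * r" "p * q \<noteq> r"
  shows "S (q / a) (map (\<lambda>b. q / b) bs) (q / r) (q / p) = S a bs p r"
proof -
  define m where "m = p * r"
  define e5 where "e5 = b * c * d * e * f"
  have e5: "e5 = a ^ 3 * q\<^sup>2 / m" using bal nz by (simp add: e5_def m_def field_simps)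
  have m: "m \<noteq> 0" using nz by (simp add: m_def)
  have e5nz: "e5 \<noteq> 0" using nz by (simp add: e5_def)
  define P :: "complex poly" where "P = [:1, - b:] * [:1, - c:] * [:1, - d:] * [:1, - e:] * [:1, - f:]"
  define g where "g = P * [:- m / (a * q), 1:]"
  define F where "F = (\<lambda>t. prod_list (map (\<lambda>b. 1 - b * t) bs))"
  have g: "poly g t = F t * (t - m / (a * q))" for t
  proof -
    have "poly [:1, - b:] t = 1 - b * t" for b by simp
    then show ?thesis
      by (simp only: g_def P_def poly_mult F_def bs_def list.map prod_list.Cons prod_list.Nil) (simp add: mult.assoc)
  qed
  have rev: "prod_list (map (\<lambda>b. 1 - 1 / (b * t)) bs) = - F t / (e5 * t ^ 5)" if "t \<noteq> 0" for t
  proof -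
    have *: "1 - 1 / (b * t) = - (1 - b * t) / (b * t)" if "b \<noteq> 0" for b
      using that \<open>t \<noteq> 0\<close> by (simp add: field_simps)
    have "(- x1 / y1) * ((- x2 / y2) * ((- x3 / y3) * ((- x4 / y4) * (- x5 / y5))))
        = - (x1 * (x2 * (x3 * (x4 * x5)))) / (y1 * y2 * y3 * y4 * y5)" for x1 x2 x3 x4 x5 y1 y2 y3 y4 y5 :: complex
      by (simp add: mult.assoc)
    then have "prod_list (map (\<lambda>b. 1 - 1 / (b * t)) bs) = - F t / ((b * t) * (c * t) * (d * t) * (e * t) * (f * t))"
      unfolding bs_def F_def list.map prod_list.Cons prod_list.Nil mult_1_right
        *[OF nz(3)] *[OF nz(4)] *[OF nz(5)] *[OF nz(6)] *[OF nz(7)] .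
    also have "(b * t) * (c * t) * (d * t) * (e * t) * (f * t) = e5 * t ^ 5"
      by (simp add: e5_def eval_nat_numeral mult_ac)
    finally show ?thesis .
  qed
  have deg: "degree g \<le> 6"
  proof -
    have l: "degree [:x, y:] \<le> 1" for x y :: complex by simp
    show ?thesis unfolding g_def P_def
      by (rule order_trans[OF degree_mult_le], rule order_trans[OF add_mono[OF order_trans[OF degree_mult_le add_mono[OF order_trans[OF degree_mult_le add_mono[OF order_trans[OF degree_mult_le add_mono[OF order_trans[OF degree_mult_le add_mono[OF l l]] l]] l]] l]] l]]) simp
  qed
  have cg: "coeff g 6 = - e5"
    by (simp add: g_def P_def e5_def eval_nat_numeral coeff_pCons)
  have dist: "distinct [0, r / (a * q), p / (a * q), 1, p / a, r / a, 1 / q]"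
    using nz q p r pr by (auto simp: field_simps)
  define X1 X2 X3 X4 X5 X6 X7 X8 X9 X10 X11 X12 X13 X14 X15 X16 where X: "X1 = r - p" "X2 = q * r - p" "X3 = a * q - p" "X4 = q - r" "X5 = 1 - r"
    "X6 = r - a" "X7 = r - a * q" "X8 = a * q - m" "X9 = q - p" "X10 = r - p * q" "X11 = p - a" "X12 = 1 - p"
    "X13 = 1 - q" "X14 = a - p * q" "X15 = r * q - a" "X16 = m - a"
  have Xnz: "X1 \<noteq> 0" "X2 \<noteq> 0" "X3 \<noteq> 0" "X6 \<noteq> 0" "X7 \<noteq> 0" "X10 \<noteq> 0" "X11 \<noteq> 0" "X13 \<noteq> 0" "X14 \<noteq> 0" "X15 \<noteq> 0"
    using X p r pr q by auto
  \<comment> \<open>The common scale of the six terms, namely the summand at the node 1 divided by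
    \<open>shift_rest\<close>.\<close>
  define k where "k = - e5 / (X13 * (X6 / r) * (- X11 / a))"
  note d = diff_divide_distrib
  have T0: "poly g 0 / ((0 - r/(a*q)) * (0 - p/(a*q)) * (0 - 1) * (0 - p/a) * (0 - r/a) * (0 - 1/q)) = - e5"
    using nz m by (simp add: g F_def bs_def e5 m_def field_simps eval_nat_numeral)
  have T1: "poly g t / ((t - 0) * (t - p/(a*q)) * (t - 1) * (t - p/a) * (t - r/a) * (t - 1/q)) = k * shift_up q a bs p r"
    if t: "t = r / (a * q)" for t
  proof -
    have "prod_list (map (\<lambda>b. 1 - a * q / (b * r)) bs) = - F t / (e5 * t ^ 5)"
      using rev[of t] nz by (simp add: t)
    then have 1: "shift_up q a bs p r = X12 * (- X11 / a) * (- F t / (e5 * (r / (a * q)) ^ 5)) / ((X10 / r) * (X1 / r) * (X7 / r))"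
      unfolding shift_up_def X t using nz by (simp add: d)
    have 2: "t - m / (a * q) = r * X12 / (a * q)" "t - 0 = r / (a * q)" "t - p/(a*q) = X1 / (a * q)" "t - 1 = X7 / (a * q)"
      "t - p/a = X10 / (a * q)" "t - r/a = r * X13 / (a * q)" "t - 1/q = X6 / (a * q)"
      unfolding t X m_def using nz by (simp_all add: field_simps)
    show ?thesis unfolding g 1 2 k_def using nz Xnz e5nz by (simp add: divide_simps eval_nat_numeral) (simp only: mult_ac)?
  qed
  have T2: "poly g t / ((t - 0) * (t - r/(a*q)) * (t - 1) * (t - p/a) * (t - r/a) * (t - 1/q)) = k * shift_down q a bs p r"
    if t: "t = p / (a * q)" for t
  proof -
    have 1: "shift_down q a bs p r = q * (- X5 / r) * (X6 / r) * F t / ((X1 / r) * (X2 / (q * r)) * (X3 / (a * q)))"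
      unfolding shift_down_def X t F_def using nz by (simp add: d)
    have 2: "t - m / (a * q) = p * X5 / (a * q)" "t - 0 = p / (a * q)" "t - r/(a*q) = - X1 / (a * q)" "t - 1 = - X3 / (a * q)"
      "t - p/a = p * X13 / (a * q)" "t - r/a = - X2 / (a * q)" "t - 1/q = X11 / (a * q)"
      unfolding t X m_def using nz by (simp_all add: field_simps)
    show ?thesis unfolding g 1 2 k_def e5 unfolding m_def using nz Xnz m by (simp add: divide_simps eval_nat_numeral) (simp only: mult_ac)?
  qed
  have T3: "poly g t / ((t - 0) * (t - r/(a*q)) * (t - p/(a*q)) * (t - p/a) * (t - r/a) * (t - 1/q)) = k * shift_rest q a bs p r"
    if t: "t = 1" for t
  proof -
    have 1: "shift_rest q a bs p r = p / (a * r) * (X8 / (a * q)) * F t / ((X7 / r) * (X3 / (a * q)))"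
      unfolding shift_rest_def X t F_def m_def using nz by (simp add: d)
    have 2: "t - m / (a * q) = X8 / (a * q)" "t - 0 = 1" "t - r/(a*q) = - X7 / (a * q)" "t - p/(a*q) = X3 / (a * q)"
      "t - p/a = - X11 / a" "t - r/a = - X6 / a" "t - 1/q = - X13 / q"
      unfolding t X m_def using nz by (simp_all add: field_simps)
    show ?thesis unfolding g 1 2 k_def e5 unfolding m_def using nz Xnz m by (simp add: divide_simps eval_nat_numeral) (simp only: mult_ac)?
  qed
  let ?bs = "map (\<lambda>b. q / b) bs"
  have T4: "poly g t / ((t - 0) * (t - r/(a*q)) * (t - p/(a*q)) * (t - 1) * (t - r/a) * (t - 1/q)) = - k * shift_up q (q / a) ?bs (q / r) (q / p)"
    if t: "t = p / a" for t
  proof -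
    have *: "(1 - (q / a) * q / ((q / b) * (q / p))) = 1 - b * t" if "b \<noteq> 0" for b
      using that nz by (simp add: t field_simps)
    have "prod_list (map (\<lambda>b. 1 - (q / a) * q / (b * (q / p))) ?bs) = F t"
      by (simp only: F_def bs_def list.map *[OF nz(3)] *[OF nz(4)] *[OF nz(5)] *[OF nz(6)] *[OF nz(7)])
    then have 1: "shift_up q (q / a) ?bs (q / r) (q / p) = (- X4 / r) * (X6 / r) * F t / ((X10 / r) * (X1 / r) * (X14 / a))"
      unfolding shift_up_def X using nz by (simp add: d mult_ac)
    have 2: "t - m / (a * q) = p * X4 / (a * q)" "t - 0 = p / a" "t - r/(a*q) = - X10 / (a * q)" "t - p/(a*q) = - p * X13 / (a * q)"
      "t - 1 = X11 / a" "t - r/a = - X1 / a" "t - 1/q = - X14 / (a * q)"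
      unfolding t X m_def using nz by (simp_all add: field_simps)
    show ?thesis unfolding g 1 2 k_def e5 unfolding m_def using nz Xnz m by (simp add: divide_simps eval_nat_numeral) (simp only: mult_ac)?
  qed
  have T5: "poly g t / ((t - 0) * (t - r/(a*q)) * (t - p/(a*q)) * (t - 1) * (t - p/a) * (t - 1/q)) = - k * shift_down q (q / a) ?bs (q / r) (q / p)"
    if t: "t = r / a" for t
  proof -
    have "(1 - (q / b) * (q / r) / ((q / a) * q)) = 1 - 1 / (b * t)" if "b \<noteq> 0" for b
      using that nz by (simp add: t field_simps)
    then have "prod_list (map (\<lambda>b. 1 - b * (q / r) / ((q / a) * q)) ?bs) = prod_list (map (\<lambda>b. 1 - 1 / (b * t)) bs)"
      using nz by (simp add: bs_def)
    also have "\<dots> = - F t / (e5 * t ^ 5)" using rev[of t] nz by (simp add: t)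
    finally have 1: "shift_down q (q / a) ?bs (q / r) (q / p) = q * (X9 / q) * (- X11 / a) * (- F t / (e5 * (r / a) ^ 5)) / ((X1 / r) * (X2 / (q * r)) * (X15 / (r * q)))"
      unfolding shift_down_def X t using nz by (simp add: d mult_ac)
    have 2: "t - m / (a * q) = r * X9 / (a * q)" "t - 0 = r / a" "t - r/(a*q) = - r * X13 / (a * q)" "t - p/(a*q) = X2 / (a * q)"
      "t - 1 = X6 / a" "t - p/a = X1 / a" "t - 1/q = X15 / (a * q)"
      unfolding t X m_def using nz by (simp_all add: field_simps)
    show ?thesis unfolding g 1 2 k_def using nz Xnz e5nz by (simp add: divide_simps eval_nat_numeral) (simp only: mult_ac)?
  qed
  have T6: "poly g t / ((t - 0) * (t - r/(a*q)) * (t - p/(a*q)) * (t - 1) * (t - p/a) * (t - r/a)) = - k * shift_rest q (q / a) ?bs (q / r) (q / p)"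
    if t: "t = 1 / q" for t
  proof -
    have "prod_list (map (\<lambda>b. 1 - b) ?bs) = prod_list (map (\<lambda>b. 1 - 1 / (b * t)) bs)"
      using nz by (simp add: bs_def t)
    also have "\<dots> = - F t / (e5 * t ^ 5)" using rev[of t] nz by (simp add: t)
    finally have 1: "shift_rest q (q / a) ?bs (q / r) (q / p) = a * p / (q * r) * (X16 / m) * (- F t / (e5 * (1 / q) ^ 5)) / ((X14 / a) * (X15 / (r * q)))"
      unfolding shift_rest_def X t m_def using nz by (simp add: d mult_ac)
    have 2: "t - m / (a * q) = - X16 / (a * q)" "t - 0 = 1 / q" "t - r/(a*q) = - X6 / (a * q)" "t - p/(a*q) = - X11 / (a * q)"
      "t - 1 = X13 / q" "t - p/a = X14 / (a * q)" "t - r/a = - X15 / (a * q)"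
      unfolding t X m_def using nz by (simp_all add: field_simps)
    show ?thesis unfolding g 1 2 k_def unfolding m_def using nz Xnz e5nz by (simp add: divide_simps eval_nat_numeral) (simp only: mult_ac)?
  qed
  \<comment> \<open>The node 0 contributes exactly the leading coefficient - e5 of \<open>g\<close>,
    so the other six summands cancel among themselves.\<close>
  have "k * (S a bs p r - S (q / a) ?bs (q / r) (q / p)) = 0"
    using divided_difference_seven[OF dist deg] unfolding T0 T1[OF refl] T2[OF refl] T3[OF refl] T4[OF refl] T5[OF refl] T6[OF refl] cg
    by (simp add: S_def algebra_simps)
  moreover have "k \<noteq> 0" using e5nz Xnz nz by (simp add: k_def)
  ultimately show ?thesis by simp
qed

section \<open>The very-well-poised weight on two lattices\<close>

lemma qpochs_Cons: "qpochs q (x # xs) k = qpoch q x k * qpochs q xs k"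
  by (simp add: qpochs_def)

lemma qpochs_inf_Cons: "qpochs_inf q (x # xs) = qpoch_inf q x * qpochs_inf q xs"
  by (simp add: qpochs_inf_def)

lemma qpochs_Nil [simp]: "qpochs q [] k = 1" "qpochs_inf q [] = 1"
  by (simp_all add: qpochs_def qpochs_inf_def)

definition wp_pair :: "complex \<Rightarrow> complex \<Rightarrow> complex \<Rightarrow> nat \<Rightarrow> complex" where
  "wp_pair q a u k = qpoch q u k / qpoch q (a * q / u) k"

definition wp_term :: "complex \<Rightarrow> complex \<Rightarrow> complex list \<Rightarrow> nat \<Rightarrow> complex" where
  "wp_term q a us k = qpoch q a k / qpoch q q k * prod_list (map (\<lambda>u. wp_pair q a u k) us)"

lemma wp_term_eq: "qpochs q (a # us) k / qpochs q (q # map (\<lambda>p. a * q / p) us) k = wp_term q a us k"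
proof -
  have "qpochs q us k / qpochs q (map (\<lambda>p. a * q / p) us) k = prod_list (map (\<lambda>u. wp_pair q a u k) us)"
  proof (induction us)
    case (Cons u us)
    show ?case
      by (simp only: list.map qpochs_Cons prod_list.Cons Cons.IH[symmetric] wp_pair_def[of q a u] times_divide_times_eq)
  qed simp
  then show ?thesis
    by (simp only: qpochs_Cons wp_term_def times_divide_times_eq[symmetric])
qed

text \<open>At x = q^k this is \<open>wp_pair q a u k\<close>, by (y)_k = (y)_inf / (y
  q^k)_inf.\<close>

definition wp_pair_inf :: "complex \<Rightarrow> complex \<Rightarrow> complex \<Rightarrow> complex \<Rightarrow> complex" where
  "wp_pair_inf q a u x = (qpoch_inf q u / qpoch_inf q (a * q / u)) * (qpoch_inf q (a * q * x / u) / qpoch_inf q (u * x))"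

text \<open>The interpolation of \<^term>\<open>wp_term q a us k\<close> in the variable \<open>x = q\<^sup>k\<close>.\<close>

definition wp_weight :: "complex \<Rightarrow> complex \<Rightarrow> complex list \<Rightarrow> complex \<Rightarrow> complex" where
  "wp_weight q a us x = (qpoch_inf q a / qpoch_inf q q) * (qpoch_inf q (q * x) / qpoch_inf q (a * x))
     * prod_list (map (\<lambda>u. wp_pair_inf q a u x) us)"

text \<open>The limit of the weight along every lattice x q^k, hence one and the same boundary term
  for the lattices from 1 and from p/a.\<close>

definition wp_limit :: "complex \<Rightarrow> complex \<Rightarrow> complex list \<Rightarrow> complex" where
  "wp_limit q a us = qpoch_inf q a / qpoch_inf q q * prod_list (map (\<lambda>u. qpoch_inf q u / qpoch_inf q (a * q / u)) us)"

text \<open>Along a lattice the weight W satisfies W(q x) den(q x) = W(x) num(x) with these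
  polynomials, which extend \<open>base_num\<close> and \<open>base_den\<close> to any list of
  parameters.\<close>

definition num_poly :: "complex \<Rightarrow> complex list \<Rightarrow> complex poly" where
  "num_poly a us = [:1, - a:] * prod_list (map (\<lambda>u. [:1, - u:]) us)"

definition den_poly :: "complex \<Rightarrow> complex list \<Rightarrow> complex poly" where
  "den_poly a us = [:1, - 1:] * prod_list (map (\<lambda>u. [:1, - (a / u):]) us)"

lemma poly_prod_list: "poly (prod_list ps) x = prod_list (map (\<lambda>p. poly p x) ps)"
  for x :: "'a::comm_ring_1"
  by (induction ps) simp_all

lemma poly_num_poly: "poly (num_poly a us) x = (1 - a * x) * prod_list (map (\<lambda>u. 1 - u * x) us)"
  by (simp add: num_poly_def poly_prod_list o_def mult.commute[of x]) (simp add: algebra_simps)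

lemma poly_den_poly: "poly (den_poly a us) x = (1 - x) * prod_list (map (\<lambda>u. 1 - a * x / u) us)"
  by (simp add: den_poly_def poly_prod_list o_def mult.commute[of x]) (simp add: algebra_simps)

lemma tendsto_prod_list:
  fixes f :: "'a \<Rightarrow> 'b \<Rightarrow> 'c::{real_normed_algebra_1}"
  assumes "\<And>u. u \<in> set us \<Longrightarrow> (f u \<longlongrightarrow> l u) F"
  shows "((\<lambda>x. prod_list (map (\<lambda>u. f u x) us)) \<longlongrightarrow> prod_list (map l us)) F"
  using assms by (induction us) (auto intro!: tendsto_intros)

lemma prod_list_map_mult: "prod_list (map (\<lambda>u. f u * g u) us) = prod_list (map f us) * (prod_list (map g us) :: 'a::comm_monoid_mult)"
  by (induction us) (simp_all add: mult_ac)

context q_base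
begin

lemma qpoch_inf_nonzero_of_small: "norm x < 1 \<Longrightarrow> qpoch_inf q x \<noteq> 0"
proof (subst qpoch_inf_nonzero_iff, intro allI notI)
  fix j assume x: "norm x < 1" and eq: "x * q ^ j = 1"
  have "norm x * norm q ^ j \<le> norm x * 1"
    using q_less by (intro mult_left_mono power_le_one) auto
  moreover have "norm x * norm q ^ j = 1"
    using eq by (metis norm_mult norm_one norm_power)
  ultimately show False using x by simp
qed

lemma qpoch_inf_q_nonzero [simp]: "qpoch_inf q q \<noteq> 0"
  by (rule qpoch_inf_nonzero_of_small[OF q_less])

lemma qpoch_inf_geometric_tendsto_1: "(\<lambda>n. qpoch_inf q (x * q ^ n)) \<longlonglongrightarrow> 1"
proof -
  obtain m where "norm x * norm q ^ m < 1"
    using q_power_small[of 1 "norm x"] by auto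
  then have "qpoch_inf q (x * q ^ m) \<noteq> 0"
    by (intro qpoch_inf_nonzero_of_small) (simp add: norm_mult norm_power)
  from qpoch_inf_tendsto_1[OF this] have "(\<lambda>n. qpoch_inf q (x * q ^ (n + m))) \<longlonglongrightarrow> 1"
    by (simp add: power_add mult_ac)
  then show ?thesis by (rule LIMSEQ_offset)
qed

lemma q_power_tendsto_0: "(\<lambda>n. q ^ n) \<longlonglongrightarrow> 0"
  using q_less by (rule LIMSEQ_power_zero)

lemma wp_term_tendsto:
  assumes "\<And>u. u \<in> set us \<Longrightarrow> qpoch_inf q (a * q / u) \<noteq> 0"
  shows "wp_term q a us \<longlonglongrightarrow> wp_limit q a us"
  unfolding wp_term_def wp_limit_def wp_pair_def
  using assms by (intro tendsto_intros tendsto_prod_list qpoch_tendsto) auto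

lemma wp_weight_tendsto:
  shows "(\<lambda>k. wp_weight q a us (x * q ^ k)) \<longlonglongrightarrow> wp_limit q a us"
proof -
  have *: "(\<lambda>k. qpoch_inf q (y * (x * q ^ k)) / qpoch_inf q (z * (x * q ^ k))) \<longlonglongrightarrow> 1 / 1" for y z
    using qpoch_inf_geometric_tendsto_1[of "y * x"] qpoch_inf_geometric_tendsto_1[of "z * x"]
    by (intro tendsto_divide) (simp_all add: mult.assoc)
  have "(\<lambda>k. wp_weight q a us (x * q ^ k)) \<longlonglongrightarrow> (qpoch_inf q a / qpoch_inf q q) * (1 / 1)
     * prod_list (map (\<lambda>u. (qpoch_inf q u / qpoch_inf q (a * q / u)) * (1 / 1)) us)"
    unfolding wp_weight_def wp_pair_inf_def
    by (intro tendsto_mult tendsto_const tendsto_prod_list)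
      (use * *[of "a * q / u" u for u] in simp_all)
  then show ?thesis by (simp add: wp_limit_def)
qed

lemma wp_pair_Suc:
  assumes "qpoch_inf q (a * q / u) \<noteq> 0"
  shows "wp_pair q a u (Suc k) * (1 - a * q * q ^ k / u) = wp_pair q a u k * (1 - u * q ^ k)"
proof -
  have "qpoch q (a * q / u) (Suc k) \<noteq> 0" using assms by (rule qpoch_nonzero)
  then show ?thesis by (simp add: wp_pair_def qpoch_Suc)
qed

lemma wp_pair_inf_step:
  assumes "qpoch_inf q (u * x) \<noteq> 0"
  shows "wp_pair_inf q a u (x * q) * (1 - a * q * x / u) = wp_pair_inf q a u x * (1 - u * x)"
proof -
  have 1: "qpoch_inf q (u * x) = (1 - u * x) * qpoch_inf q (u * (x * q))"
    "qpoch_inf q (a * q * x / u) = (1 - a * q * x / u) * qpoch_inf q (a * q * (x * q) / u)"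
    using qpoch_inf_Suc[of "u * x"] qpoch_inf_Suc[of "a * q * x / u"] by (simp_all only: times_divide_eq_left mult.assoc)
  have "1 - u * x \<noteq> 0" using assms unfolding 1 by auto
  then show ?thesis
    unfolding wp_pair_inf_def 1 by (simp only: divide_simps mult_ac) simp
qed

lemma wp_term_ratio:
  assumes "\<And>u. u \<in> set us \<Longrightarrow> qpoch_inf q (a * q / u) \<noteq> 0"
  shows "wp_term q a us (Suc k) * poly (den_poly a us) (q ^ Suc k) = wp_term q a us k * poly (num_poly a us) (q ^ k)"
proof -
  have s: "wp_pair q a u (Suc k) * (1 - a * q ^ Suc k / u) = wp_pair q a u k * (1 - u * q ^ k)"
    if "u \<in> set us" for u
    using wp_pair_Suc[OF assms[OF that], of k] by (simp add: mult.assoc)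
  have sq: "qpoch q a (Suc k) / qpoch q q (Suc k) * (1 - q ^ Suc k) = qpoch q a k / qpoch q q k * (1 - a * q ^ k)"
    using qpoch_nonzero[OF qpoch_inf_q_nonzero, of "Suc k"] by (simp add: qpoch_Suc)
  have "wp_term q a us (Suc k) * poly (den_poly a us) (q ^ Suc k)
      = (qpoch q a (Suc k) / qpoch q q (Suc k) * (1 - q ^ Suc k))
        * prod_list (map (\<lambda>u. wp_pair q a u (Suc k) * (1 - a * q ^ Suc k / u)) us)"
    by (simp only: wp_term_def poly_den_poly prod_list_map_mult mult_ac)
  also have "\<dots> = (qpoch q a k / qpoch q q k * (1 - a * q ^ k))
        * prod_list (map (\<lambda>u. wp_pair q a u k * (1 - u * q ^ k)) us)"
    unfolding sq by (simp only: s cong: map_cong)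
  also have "\<dots> = wp_term q a us k * poly (num_poly a us) (q ^ k)"
    by (simp only: wp_term_def poly_num_poly prod_list_map_mult mult_ac)
  finally show ?thesis .
qed

lemma wp_weight_ratio:
  assumes "\<And>u. u \<in> set (a # us) \<Longrightarrow> qpoch_inf q (u * x) \<noteq> 0"
  shows "wp_weight q a us (x * q) * poly (den_poly a us) (x * q) = wp_weight q a us x * poly (num_poly a us) x"
proof -
  have s: "wp_pair_inf q a u (x * q) * (1 - a * (x * q) / u) = wp_pair_inf q a u x * (1 - u * x)"
    if "u \<in> set us" for u
    using wp_pair_inf_step[of u x a] assms[of u] that by (simp add: mult_ac)
  have sq: "(qpoch_inf q (q * (x * q)) / qpoch_inf q (a * (x * q))) * (1 - x * q)
      = (qpoch_inf q (q * x) / qpoch_inf q (a * x)) * (1 - a * x)"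
  proof -
    have 1: "qpoch_inf q (q * x) = (1 - x * q) * qpoch_inf q (q * (x * q))"
      "qpoch_inf q (a * x) = (1 - a * x) * qpoch_inf q (a * (x * q))"
      using qpoch_inf_Suc[of "q * x"] qpoch_inf_Suc[of "a * x"] by (simp_all add: mult_ac)
    have "1 - a * x \<noteq> 0" using assms[of a] unfolding 1 by auto
    then show ?thesis unfolding 1 by simp
  qed
  have "wp_weight q a us (x * q) * poly (den_poly a us) (x * q)
      = (qpoch_inf q a / qpoch_inf q q) * ((qpoch_inf q (q * (x * q)) / qpoch_inf q (a * (x * q))) * (1 - x * q))
        * prod_list (map (\<lambda>u. wp_pair_inf q a u (x * q) * (1 - a * (x * q) / u)) us)"
    by (simp only: wp_weight_def poly_den_poly prod_list_map_mult mult_ac)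
  also have "\<dots> = (qpoch_inf q a / qpoch_inf q q) * ((qpoch_inf q (q * x) / qpoch_inf q (a * x)) * (1 - a * x))
        * prod_list (map (\<lambda>u. wp_pair_inf q a u x * (1 - u * x)) us)"
    unfolding sq by (simp only: s cong: map_cong)
  also have "\<dots> = wp_weight q a us x * poly (num_poly a us) x"
    by (simp only: wp_weight_def poly_num_poly prod_list_map_mult mult_ac)
  finally show ?thesis .
qed

lemma wp_pair_shift:
  assumes "qpoch_inf q (a / u) \<noteq> 0" "u \<noteq> 1" "u \<noteq> 0"
  shows "wp_pair q a (u * q) k = wp_pair q a u k * ((1 - u * q ^ k) * (1 - a * q ^ k / u)) / ((1 - u) * (1 - a / u))"
proof -
  have *: "qpoch q (a / u) (Suc k) \<noteq> 0" using assms(1) by (rule qpoch_nonzero)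
  have **: "(1 - a / u) * qpoch q (a * q / u) k \<noteq> 0"
    using * qpoch_Suc_left[of q "a / u" k] by simp
  have 1: "qpoch q (a / u) k \<noteq> 0" "1 - a / u \<noteq> 0" "qpoch q (a * q / u) k \<noteq> 0" "1 - a * q ^ k / u \<noteq> 0"
    using * ** by (auto simp: qpoch_Suc)
  have 2: "qpoch q (a * q / u) k * (1 - a / u) = qpoch q (a / u) k * (1 - a * q ^ k / u)"
    using qpoch_shift[of q "a / u" k] by simp
  have 3: "qpoch q (u * q) k * (1 - u) = qpoch q u k * (1 - u * q ^ k)"
    by (rule qpoch_shift)
  have 4: "a * q / (u * q) = a / u" by simp
  have u1: "1 - u \<noteq> 0" using assms by simp
  have "wp_pair q a (u * q) k = (qpoch q (u * q) k * (1 - u)) / (1 - u) * (1 / qpoch q (a / u) k)"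
    using u1 by (simp add: wp_pair_def)
  also have "1 / qpoch q (a / u) k = (1 - a * q ^ k / u) / (qpoch q (a * q / u) k * (1 - a / u))"
    unfolding 2 using 1(4) by simp
  finally show ?thesis
    unfolding 3 by (simp add: wp_pair_def mult_ac)
qed

lemma wp_pair_inf_shift:
  assumes "u \<noteq> 1" "u \<noteq> 0" "a \<noteq> u" "u * x \<noteq> 1"
  shows "wp_pair_inf q a (u * q) x = wp_pair_inf q a u x * ((1 - u * x) * (1 - a * x / u)) / ((1 - u) * (1 - a / u))"
proof -
  have nz: "1 - u \<noteq> 0" "1 - a / u \<noteq> 0" "1 - u * x \<noteq> 0" using assms by auto
  have eqs: "a / u * q = a * q / u" "a * x / u * q = a * q * x / u" "u * x * q = u * q * x" by simp_all
  have 1: "qpoch_inf q u = (1 - u) * qpoch_inf q (u * q)"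
    "qpoch_inf q (a / u) = (1 - a / u) * qpoch_inf q (a * q / u)"
    "qpoch_inf q (a * x / u) = (1 - a * x / u) * qpoch_inf q (a * q * x / u)"
    "qpoch_inf q (u * x) = (1 - u * x) * qpoch_inf q (u * q * x)"
    using qpoch_inf_Suc[of u] qpoch_inf_Suc[of "a / u"] qpoch_inf_Suc[of "a * x / u"] qpoch_inf_Suc[of "u * x"]
    unfolding eqs by this+
  have 2: "a * q / (u * q) = a / u" "a * q * x / (u * q) = a * x / u" by simp_all
  have alg: "(Q1 / (s2 * R1)) * ((s4 * R2) / Q2) = (s1 * Q1 / R1) * (R2 / (s3 * Q2)) * (s3 * s4) / (s1 * s2)"
    if "s1 \<noteq> 0" "s3 \<noteq> 0" for Q1 Q2 R1 R2 s1 s2 s3 s4 :: complex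
    using that by (simp add: mult_ac)
  have "wp_pair_inf q a (u * q) x = (qpoch_inf q (u * q) / qpoch_inf q (a / u)) * (qpoch_inf q (a * x / u) / qpoch_inf q (u * q * x))"
    by (simp only: wp_pair_inf_def 2)
  also have "\<dots> = (qpoch_inf q (u * q) / ((1 - a / u) * qpoch_inf q (a * q / u))) *
      (((1 - a * x / u) * qpoch_inf q (a * q * x / u)) / qpoch_inf q (u * q * x))"
    by (subst 1(2), subst 1(3), rule refl)
  also have "\<dots> = ((1 - u) * qpoch_inf q (u * q) / qpoch_inf q (a * q / u)) *
      (qpoch_inf q (a * q * x / u) / ((1 - u * x) * qpoch_inf q (u * q * x))) *
      ((1 - u * x) * (1 - a * x / u)) / ((1 - u) * (1 - a / u))"
    by (rule alg[OF nz(1,3)])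
  also have "\<dots> = wp_pair_inf q a u x * ((1 - u * x) * (1 - a * x / u)) / ((1 - u) * (1 - a / u))"
    by (subst 1(1)[symmetric], subst 1(4)[symmetric], simp only: wp_pair_inf_def)
  finally show ?thesis .
qed

end

text \<open>The first assumption makes each summand a difference of consecutive V k D k; the zero of
  D at the start of the lattice removes the lower end.\<close>

lemma lattice_telescope:
  fixes V N D :: "nat \<Rightarrow> 'a::comm_ring"
  assumes "\<And>k. V (Suc k) * D (Suc k) = V k * N k" "V 0 * D 0 = 0"
  shows "(\<Sum>k<K. V k * (N k - D k)) = V K * D K"
  by (induction K) (simp_all add: assms right_diff_distrib)

text \<open>A q-integral of \<open>G\<close> against the weight between the lattices through 1 and
  p/a. With \<open>G\<close> left free, the same functional yields \<open>Phi\<close> and the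
  moments.\<close>

definition wp_pairing :: "complex \<Rightarrow> complex \<Rightarrow> complex \<Rightarrow> complex list \<Rightarrow> complex poly \<Rightarrow> complex" where
  "wp_pairing q a p rs G = (\<Sum>k. wp_term q a (p # rs) k * poly G (q ^ k))
     - (\<Sum>k. wp_weight q a (p # rs) (p / a * q ^ k) * poly G (p / a * q ^ k))"

lemma lin_factor_1: "lin_factor a u 1 = (1 - u) * (1 - a / u)"
  by (simp add: lin_factor_def)

context q_base
begin

text \<open>A factor x is split off \<open>G\<close>; on the lattice it decays like q^k while the
  rest stays bounded.\<close>

lemma summable_poly_weight:
  fixes V :: "nat \<Rightarrow> complex"
  assumes V: "V \<longlonglongrightarrow> L" and G: "poly G 0 = 0"
  shows "summable (\<lambda>k. V k * poly G (y * q ^ k))"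
proof -
  obtain H where H: "G = pCons 0 H"
    using G by (cases G) auto
  have "(\<lambda>k. y * q ^ k) \<longlonglongrightarrow> y * 0" by (intro tendsto_intros q_power_tendsto_0)
  then have "(\<lambda>k. V k * (poly H (y * q ^ k) * y)) \<longlonglongrightarrow> L * (poly H 0 * y)"
    by (intro tendsto_intros V) simp
  then have "Bseq (\<lambda>k. V k * (poly H (y * q ^ k) * y))"
    by (intro convergent_imp_Bseq) (auto simp: convergent_def)
  then obtain B where B: "\<And>k. norm (V k * (poly H (y * q ^ k) * y)) \<le> B"
    by (auto simp: Bseq_def)
  show ?thesis
  proof (rule summable_comparison_test')
    show "summable (\<lambda>k. B * norm q ^ k)"
      using q_less by (intro summable_mult summable_geometric) simp
    fix k :: nat
    have "V k * poly G (y * q ^ k) = V k * (poly H (y * q ^ k) * y) * q ^ k" by (simp add: H)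
    also have "norm \<dots> \<le> B * norm q ^ k"
      unfolding norm_mult[of _ "q ^ k"] norm_power by (intro mult_right_mono B) simp
    finally show "norm (V k * poly G (y * q ^ k)) \<le> B * norm q ^ k" .
  qed
qed

lemma summable_wp_term:
  assumes "\<And>u. u \<in> set us \<Longrightarrow> qpoch_inf q (a * q / u) \<noteq> 0" and "poly G 0 = 0"
  shows "summable (\<lambda>k. wp_term q a us k * poly G (q ^ k))"
  using summable_poly_weight[OF wp_term_tendsto[OF assms(1)] assms(2), where y = 1] by simp

lemma summable_wp_weight:
  assumes "poly G 0 = 0"
  shows "summable (\<lambda>k. wp_weight q a us (y * q ^ k) * poly G (y * q ^ k))"
  using summable_poly_weight[OF wp_weight_tendsto assms] .

lemma W10_9_eq:
  assumes "\<And>u. u \<in> set us \<Longrightarrow> qpoch_inf q (a * q / u) \<noteq> 0" and a: "a \<noteq> 1"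
  shows "(1 - a) * W10_9 q a us = (\<Sum>k. wp_term q a us k * poly [:0, 1, 0, - a:] (q ^ k))"
proof -
  have sm: "summable (\<lambda>k. wp_term q a us k * poly [:0, 1, 0, - a:] (q ^ k))"
    by (rule summable_wp_term[OF assms(1)]) auto
  have q2: "q ^ (2 * k) = q ^ k * q ^ k" for k
    by (simp add: mult_2 power_add)
  have "W10_9 q a us = (\<Sum>k. wp_term q a us k * poly [:0, 1, 0, - a:] (q ^ k) / (1 - a))"
    unfolding W10_9_def vwp_series_def wp_term_eq q2
    by (intro arg_cong[where f = suminf] ext) (simp add: field_simps)
  also have "\<dots> = (\<Sum>k. wp_term q a us k * poly [:0, 1, 0, - a:] (q ^ k)) / (1 - a)"
    by (rule suminf_divide[OF sm])
  finally show ?thesis using a by simp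
qed

text \<open>At x = p q^k / a all arguments of the infinite products are constants times q^k, with
  p^2/a in the role of a and p r / a in that of r. The constant left over is, up to elementary
  factors, the coefficient of the second series in \<open>Phi\<close>.\<close>

lemma wp_weight_second_lattice:
  assumes nz: "a \<noteq> 0" "p \<noteq> 0" "0 \<notin> set rs"
    and Q: "qpoch_inf q p \<noteq> 0" "qpoch_inf q (p * q / a) \<noteq> 0" "qpoch_inf q (p\<^sup>2 / a) \<noteq> 0"
      "\<And>r. r \<in> set rs \<Longrightarrow> qpoch_inf q (p * r / a) \<noteq> 0" "\<And>r. r \<in> set rs \<Longrightarrow> qpoch_inf q (p * q / r) \<noteq> 0"
  shows "wp_weight q a (p # rs) (p / a * q ^ k) =
    qpoch_inf q a * qpoch_inf q (p * q / a) / (qpoch_inf q (a * q / p) * qpoch_inf q (p\<^sup>2 / a))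
    * prod_list (map (\<lambda>r. qpoch_inf q r * qpoch_inf q (p * q / r) / (qpoch_inf q (a * q / r) * qpoch_inf q (p * r / a))) rs)
    * wp_term q (p\<^sup>2 / a) (p # map (\<lambda>r. p * r / a) rs) k"
proof -
  have Qk: "qpoch_inf q (x * q ^ k) = qpoch_inf q x / qpoch q x k" if "qpoch_inf q x \<noteq> 0" for x
    using qpoch_inf_split[of x k] qpoch_nonzero[OF that, of k] by simp
  have "prod_list (map (\<lambda>u. wp_pair_inf q a u (p / a * q ^ k)) rs)
     = prod_list (map (\<lambda>r. qpoch_inf q r * qpoch_inf q (p * q / r) / (qpoch_inf q (a * q / r) * qpoch_inf q (p * r / a))
          * wp_pair q (p\<^sup>2 / a) (p * r / a) k) rs)"
  proof (intro arg_cong[where f = prod_list] map_cong refl)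
    fix r assume r: "r \<in> set rs"
    then have r0: "r \<noteq> 0" using nz by auto
    have e: "a * q * (p / a * q ^ k) / r = p * q / r * q ^ k" "r * (p / a * q ^ k) = p * r / a * q ^ k"
      "p\<^sup>2 / a * q / (p * r / a) = p * q / r"
      using nz r0 by (simp_all add: power2_eq_square)
    show "wp_pair_inf q a r (p / a * q ^ k) = qpoch_inf q r * qpoch_inf q (p * q / r) / (qpoch_inf q (a * q / r) * qpoch_inf q (p * r / a))
          * wp_pair q (p\<^sup>2 / a) (p * r / a) k"
      unfolding wp_pair_inf_def wp_pair_def e Qk[OF Q(4)[OF r]] Qk[OF Q(5)[OF r]] by (simp add: mult_ac)
  qed
  also have "\<dots> = prod_list (map (\<lambda>r. qpoch_inf q r * qpoch_inf q (p * q / r) / (qpoch_inf q (a * q / r) * qpoch_inf q (p * r / a))) rs)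
     * prod_list (map (\<lambda>u. wp_pair q (p\<^sup>2 / a) u k) (map (\<lambda>r. p * r / a) rs))"
    by (simp only: prod_list_map_mult list.map_comp o_def)
  finally have rs: "prod_list (map (\<lambda>u. wp_pair_inf q a u (p / a * q ^ k)) rs) = \<dots>" .
  have e: "a * q * (p / a * q ^ k) / p = q * q ^ k" "p * (p / a * q ^ k) = p\<^sup>2 / a * q ^ k"
    "q * (p / a * q ^ k) = p * q / a * q ^ k" "a * (p / a * q ^ k) = p * q ^ k" "p\<^sup>2 / a * q / p = p * q / a"
    using nz by (simp_all add: power2_eq_square)
  have qk: "qpoch q q k \<noteq> 0" "qpoch q p k \<noteq> 0"
    using qpoch_nonzero[OF qpoch_inf_q_nonzero] qpoch_nonzero[OF Q(1)] by auto
  have "(A / q1) * ((B / B') / (Pq / Pk)) * ((Pq / R) * ((q1 / qk) / (S / S')) * (X * Y))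
     = A * B / (R * S) * X * (S' / qk * (Pk / B' * Y))"
    if "q1 \<noteq> 0" "Pq \<noteq> 0" for A B B' q1 Pq Pk R qk S S' X Y :: complex
    using that by (simp add: mult_ac)
  from this[OF qpoch_inf_q_nonzero Q(1)]
  show ?thesis
    unfolding wp_weight_def wp_term_def list.map prod_list.Cons rs wp_pair_inf_def[of q a p] wp_pair_def[of q "p\<^sup>2 / a" p] e
      Qk[OF Q(1)] Qk[OF Q(2)] Qk[OF Q(3)] Qk[OF qpoch_inf_q_nonzero] .
qed

lemma Phi_eq_pairing:
  assumes nz: "a \<noteq> 0" "p \<noteq> 0" "0 \<notin> set rs" and a: "a \<noteq> 1"
    and Q: "qpoch_inf q p \<noteq> 0" "qpoch_inf q (p / a) \<noteq> 0" "qpoch_inf q (a / p) \<noteq> 0" "qpoch_inf q (p\<^sup>2 / a) \<noteq> 0"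
      "\<And>r. r \<in> set rs \<Longrightarrow> qpoch_inf q (a * q / r) \<noteq> 0"
      "\<And>r. r \<in> set rs \<Longrightarrow> qpoch_inf q (p * r / a) \<noteq> 0" "\<And>r. r \<in> set rs \<Longrightarrow> qpoch_inf q (p * q / r) \<noteq> 0"
  shows "(1 - a) * Phi q a p rs = wp_pairing q a p rs [:0, 1, 0, - a:]"
proof -
  define P where "P = p\<^sup>2 / a"
  have sp: "qpoch_inf q (p / a) = (1 - p / a) * qpoch_inf q (p * q / a)"
    "qpoch_inf q (a / p) = (1 - a / p) * qpoch_inf q (a * q / p)"
    "qpoch_inf q a = (1 - a) * qpoch_inf q (a * q)"
    "qpoch_inf q P = (1 - P) * qpoch_inf q (p\<^sup>2 * q / a)"
    using qpoch_inf_Suc[of "p / a"] qpoch_inf_Suc[of "a / p"] qpoch_inf_Suc[of a] qpoch_inf_Suc[of P] by (simp_all add: P_def)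
  have Q': "qpoch_inf q (p * q / a) \<noteq> 0" "qpoch_inf q (a * q / p) \<noteq> 0" "1 - p / a \<noteq> 0" "1 - a / p \<noteq> 0"
    "1 - P \<noteq> 0" "qpoch_inf q (p\<^sup>2 * q / a) \<noteq> 0"
    using Q(2,3,4) unfolding sp P_def[symmetric] by auto
  define X where "X = prod_list (map (\<lambda>r. qpoch_inf q r * qpoch_inf q (p * q / r) / (qpoch_inf q (a * q / r) * qpoch_inf q (p * r / a))) rs)"
  define K where "K = qpoch_inf q a * qpoch_inf q (p * q / a) / (qpoch_inf q (a * q / p) * qpoch_inf q P) * X"
  define rs' where "rs' = map (\<lambda>r. p * r / a) rs"
  have U: "wp_weight q a (p # rs) (p / a * q ^ k) = K * wp_term q P (p # rs') k" for k
    unfolding K_def X_def P_def rs'_def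
    by (rule wp_weight_second_lattice[OF nz Q(1) Q'(1) Q(4) Q(6) Q(7)])
  have S1: "(1 - a) * W10_9 q a (p # rs) = (\<Sum>k. wp_term q a (p # rs) k * poly [:0, 1, 0, - a:] (q ^ k))"
    by (rule W10_9_eq) (use Q Q' a in auto)
  have den2: "qpoch_inf q (P * q / u) \<noteq> 0" if "u \<in> set (p # rs')" for u
    using that nz Q' Q(7) by (auto simp: rs'_def P_def power2_eq_square field_simps)
  have P1: "P \<noteq> 1" using Q'(5) by auto
  have S2: "(1 - P) * W10_9 q P (p # rs') = (\<Sum>k. wp_term q P (p # rs') k * poly [:0, 1, 0, - P:] (q ^ k))"
    by (rule W10_9_eq[OF den2 P1])
  have sm2: "summable (\<lambda>k. wp_term q P (p # rs') k * poly [:0, 1, 0, - P:] (q ^ k))"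
    by (rule summable_wp_term[OF den2]) auto
  have "(\<Sum>k. wp_weight q a (p # rs) (p / a * q ^ k) * poly [:0, 1, 0, - a:] (p / a * q ^ k))
      = (\<Sum>k. K * (p / a) * (wp_term q P (p # rs') k * poly [:0, 1, 0, - P:] (q ^ k)))"
    unfolding U by (intro arg_cong[where f = suminf] ext) (use nz in \<open>simp add: P_def power2_eq_square field_simps\<close>)
  also have "\<dots> = K * (p / a) * ((1 - P) * W10_9 q P (p # rs'))"
    unfolding S2 by (rule suminf_mult[OF sm2])
  finally have E2: "(\<Sum>k. wp_weight q a (p # rs) (p / a * q ^ k) * poly [:0, 1, 0, - a:] (p / a * q ^ k))
     = K * (p / a) * ((1 - P) * W10_9 q P (p # rs'))" .
  define C where "C = qpochs_inf q [a * q, p / a] / qpochs_inf q [p\<^sup>2 * q / a, a / p]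
       * prod_list (map (\<lambda>r. qpochs_inf q [r, p * q / r] / qpochs_inf q [a * q / r, p * r / a]) rs)"
  have "(1 - a) * C = - (K * (p / a) * (1 - P))"
  proof -
    have X': "prod_list (map (\<lambda>r. qpochs_inf q [r, p * q / r] / qpochs_inf q [a * q / r, p * r / a]) rs) = X"
      by (simp add: X_def qpochs_inf_Cons)
    \<comment> \<open>Shifting (p/a)_inf and (a/p)_inf by one factor leaves the quotient - p/a,
      whose sign turns the sum in \<open>Phi\<close> into a difference of lattice sums.\<close>
    define t where "t = 1 - a / p"
    have t: "t \<noteq> 0" "1 - p / a = - (p / a) * t" using Q' nz by (simp_all add: t_def field_simps)
    have "(1 - a) * (Aq * (- (p / a) * t * Pq) / (PP * (t * Ap)) * X)
      = - ((1 - a) * Aq * Pq / (Ap * ((1 - P) * PP)) * X * (p / a) * (1 - P))" for Aq Pq PP Ap :: complex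
      using t(1) Q'(5) by (simp add: mult_ac)
    then show ?thesis
      unfolding C_def X' unfolding K_def sp t(2) qpochs_inf_Cons qpochs_Nil mult_1_right t_def[symmetric] .
  qed
  then have CW: "((1 - a) * C) * w = - (K * (p / a) * ((1 - P) * w))" for w
    by (simp only: mult.assoc mult_minus_left)
  have "Phi q a p rs = W10_9 q a (p # rs) + C * W10_9 q P (p # rs')"
    unfolding Phi_def C_def P_def rs'_def ..
  then have "(1 - a) * Phi q a p rs = (1 - a) * W10_9 q a (p # rs) + ((1 - a) * C) * W10_9 q P (p # rs')"
    by (simp only: distrib_left mult.assoc)
  also have "\<dots> = (1 - a) * W10_9 q a (p # rs) - K * (p / a) * ((1 - P) * W10_9 q P (p # rs'))"
    unfolding CW by simp
  finally have "(1 - a) * Phi q a p rs = (1 - a) * W10_9 q a (p # rs) - K * (p / a) * ((1 - P) * W10_9 q P (p # rs'))" .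
  then show ?thesis
    unfolding wp_pairing_def S1 E2 .
qed

end

section \<open>The contiguous relation\<close>

text \<open>One computation for both lattices: \<phi> is \<open>wp_pair\<close> at a fixed k or
  \<open>wp_pair_inf\<close> at a fixed x, and \<open>M\<close> collects what is independent of p
  and r.\<close>

lemma contiguous_pointwise:
  fixes a b c d e f p q r x M :: complex and \<phi> :: "complex \<Rightarrow> complex"
  defines "bs \<equiv> [b, c, d, e, f]"
  defines "A \<equiv> shift_up q a bs p r" and "B \<equiv> shift_down q a bs p r" and "R \<equiv> shift_rest q a bs p r"
  defines "T \<equiv> \<lambda>p r. M * prod_list (map \<phi> (p # bs @ [r]))"
  assumes bal: "b * c * d * e * f * p * r = a ^ 3 * q\<^sup>2"
    and nz: "a \<noteq> 0" "q \<noteq> 0" "b \<noteq> 0" "c \<noteq> 0" "d \<noteq> 0" "e \<noteq> 0" "f \<noteq> 0" "p \<noteq> 0" "r \<noteq> 0"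
    and a1: "a \<noteq> 1" and p: "p \<noteq> 1" "p \<noteq> q" "p \<noteq> a" "p \<noteq> a * q" "p\<^sup>2 \<noteq> a * q\<^sup>2"
    and r: "r \<noteq> 1" "r \<noteq> q" "r \<noteq> a" "r \<noteq> a * q" "r\<^sup>2 \<noteq> a * q\<^sup>2"
    and pr: "p \<noteq> r" "p \<noteq> q * r" "p * q \<noteq> r" "p * r \<noteq> a * q\<^sup>2"
    and \<phi>: "\<And>u. u \<in> {p / q, p, r / q, r} \<Longrightarrow> \<phi> (u * q) = \<phi> u * lin_factor a u x / lin_factor a u 1"
  shows "A * (T (p * q) (r / q) * poly [:0, 1, 0, - a:] x) - (A + B + R) * (T p r * poly [:0, 1, 0, - a:] x)
      + B * (T (p / q) (r * q) * poly [:0, 1, 0, - a:] x)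
    = shift_factor q a p r * (T (p / q) (r / q) * (base_num q a bs p r x - base_den q a bs p r x))"
proof -
  define W where "W = M * prod_list (map \<phi> bs) * \<phi> (p / q) * \<phi> (r / q)"
  have e: "\<phi> p = \<phi> (p / q) * lin_factor a (p / q) x / lin_factor a (p / q) 1"
    "\<phi> r = \<phi> (r / q) * lin_factor a (r / q) x / lin_factor a (r / q) 1"
    "\<phi> (p * q) = \<phi> p * lin_factor a p x / lin_factor a p 1"
    "\<phi> (r * q) = \<phi> r * lin_factor a r x / lin_factor a r 1"
    using \<phi>[of "p / q"] \<phi>[of "r / q"] \<phi>[of p] \<phi>[of r] nz by simp_all
  have T: "T p r = M * prod_list (map \<phi> bs) * \<phi> p * \<phi> r" for p r
    by (simp add: T_def mult_ac)
  have T1: "T (p * q) (r / q) = W * ((lin_factor a (p / q) x * lin_factor a p x) / (lin_factor a (p / q) 1 * lin_factor a p 1))"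
    unfolding T W_def e(3) e(1) by simp
  have T2: "T p r = W * ((lin_factor a (p / q) x * lin_factor a (r / q) x) / (lin_factor a (p / q) 1 * lin_factor a (r / q) 1))"
    unfolding T W_def e(1,2) by simp
  have T3: "T (p / q) (r * q) = W * ((lin_factor a (r / q) x * lin_factor a r x) / (lin_factor a (r / q) 1 * lin_factor a r 1))"
    unfolding T W_def e(4) e(2) by simp
  have T0: "T (p / q) (r / q) = W" by (simp add: T W_def)
  have G: "poly [:0, 1, 0, - a:] x = x * (1 - a * x\<^sup>2)" by (simp add: power2_eq_square algebra_simps)
  have "A * (T (p * q) (r / q) * poly [:0, 1, 0, - a:] x) - (A + B + R) * (T p r * poly [:0, 1, 0, - a:] x)
      + B * (T (p / q) (r * q) * poly [:0, 1, 0, - a:] x)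
    = W * (x * (1 - a * x\<^sup>2) * (A * (lin_factor a (p / q) x * lin_factor a p x) / (lin_factor a (p / q) 1 * lin_factor a p 1)
      - (A + B + R) * (lin_factor a (p / q) x * lin_factor a (r / q) x) / (lin_factor a (p / q) 1 * lin_factor a (r / q) 1)
      + B * (lin_factor a (r / q) x * lin_factor a r x) / (lin_factor a (r / q) 1 * lin_factor a r 1)))"
    unfolding T1 T2 T3 G by (simp add: algebra_simps)
  also have "\<dots> = W * (shift_factor q a p r * (base_num q a bs p r x - base_den q a bs p r x))"
    unfolding A_def B_def R_def bs_def
    by (subst contiguous_certificate[OF bal nz a1 p r pr]) (rule refl)
  finally show ?thesis unfolding T0 by simp
qed

context q_base
begin

lemma suminf_drop_zeros:
  fixes g :: "nat \<Rightarrow> complex"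
  assumes "summable (\<lambda>k. g (k + m))" "\<And>k. k < m \<Longrightarrow> g k = 0"
  shows "(\<Sum>k. g (k + m)) = (\<Sum>k. g k)" "summable g"
proof -
  show "summable g" using assms(1) by (simp add: summable_iff_shift)
  from suminf_split_initial_segment[OF this, of m] assms(2)
  show "(\<Sum>k. g (k + m)) = (\<Sum>k. g k)" by simp
qed

text \<open>The second lattices of the three pairings start at p q / a, p / a and p / (a q). All are
  read on the longest one, where the first two weights vanish at the added points. On either lattice
  the combination sums to \<open>shift_factor\<close> times the same limit, which drops out of the
  difference.\<close>

lemma wp_pairing_contiguous:
  fixes a b c d e f p r :: complex
  defines "bs \<equiv> [b, c, d, e, f]" and "G \<equiv> [:0, 1, 0, - a:]"
  defines "A \<equiv> shift_up q a bs p r" and "B \<equiv> shift_down q a bs p r" and "R \<equiv> shift_rest q a bs p r"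
  assumes bal: "b * c * d * e * f * p * r = a ^ 3 * q\<^sup>2"
    and nz: "a \<noteq> 0" "b \<noteq> 0" "c \<noteq> 0" "d \<noteq> 0" "e \<noteq> 0" "f \<noteq> 0" "p \<noteq> 0" "r \<noteq> 0"
    and a1: "a \<noteq> 1"
    and r: "r \<noteq> 1" "r \<noteq> q" "r\<^sup>2 \<noteq> a * q\<^sup>2"
    and pr: "p \<noteq> r" "p \<noteq> q * r" "p * q \<noteq> r"
    and Q: "qpoch_inf q (p / q) \<noteq> 0" "qpoch_inf q (a / p) \<noteq> 0" "qpoch_inf q (a / r) \<noteq> 0"
      "qpoch_inf q (p\<^sup>2 / (a * q\<^sup>2)) \<noteq> 0" "qpoch_inf q (p * r / (a * q\<^sup>2)) \<noteq> 0"
      "\<And>u. u \<in> set bs \<Longrightarrow> qpoch_inf q (a * q / u) \<noteq> 0"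
      "\<And>u. u \<in> set bs \<Longrightarrow> qpoch_inf q (u * p / (a * q)) \<noteq> 0"
  shows "A * wp_pairing q a (p * q) (bs @ [r / q]) G - (A + B + R) * wp_pairing q a p (bs @ [r]) G
      + B * wp_pairing q a (p / q) (bs @ [r * q]) G = 0"
proof -
  have ne1: "x * q ^ j \<noteq> 1" if "qpoch_inf q x \<noteq> 0" for x j
    using that qpoch_inf_nonzero_iff by blast
  have p: "p \<noteq> 1" "p \<noteq> q" "p \<noteq> a" "p \<noteq> a * q" "p\<^sup>2 \<noteq> a * q\<^sup>2"
    using ne1[OF Q(1), of 1] ne1[OF Q(1), of 0] ne1[OF Q(2), of 0] ne1[OF Q(2), of 1] ne1[OF Q(4), of 0] nz
    by auto
  have r': "r \<noteq> a" "r \<noteq> a * q"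
    using ne1[OF Q(3), of 0] ne1[OF Q(3), of 1] nz by auto
  have pr': "p * r \<noteq> a * q\<^sup>2" using ne1[OF Q(5), of 0] nz by auto
  define us0 where "us0 = p / q # bs @ [r / q]"
  define N D where "N = poly (num_poly a us0)" and "D = poly (den_poly a us0)"
  have base: "base_num q a bs p r = N" "base_den q a bs p r = D"
    by (auto simp: base_num_def base_den_def N_def D_def us0_def poly_num_poly poly_den_poly mult_ac)
  note pointwise = contiguous_pointwise[OF bal nz(1) q_nz nz(2-) a1 p r(1,2) r' r(3) pr pr', folded bs_def,
      folded A_def B_def R_def G_def, unfolded base]
  have Qap: "qpoch_inf q (a * q / (p / q)) \<noteq> 0" "qpoch_inf q (a * q / (r / q)) \<noteq> 0"
    "qpoch_inf q (a * q / p) \<noteq> 0" "qpoch_inf q (a * q / r) \<noteq> 0"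
    "qpoch_inf q (a * q / (p * q)) \<noteq> 0" "qpoch_inf q (a * q / (r * q)) \<noteq> 0"
    "qpoch_inf q (a / (p / q)) \<noteq> 0" "qpoch_inf q (a / (r / q)) \<noteq> 0"
    using qpoch_inf_shift_nonzero[OF Q(2), of 1] qpoch_inf_shift_nonzero[OF Q(3), of 1] Q(2,3)
      qpoch_inf_shift_nonzero[OF Q(2), of 2] qpoch_inf_shift_nonzero[OF Q(3), of 2] nz
    by (simp_all add: power2_eq_square mult_ac)
  have G0: "poly G 0 = 0" by (simp add: G_def)
  define L where "L = wp_limit q a us0"
  have D_lim: "(\<lambda>k. D (x * q ^ k)) \<longlonglongrightarrow> 1" for x
  proof -
    have "(\<lambda>k. D (x * q ^ k)) \<longlonglongrightarrow> poly (den_poly a us0) (x * 0)"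
      unfolding D_def by (intro tendsto_intros q_power_tendsto_0)
    then show ?thesis by (simp add: poly_den_poly us0_def bs_def)
  qed
  have lattice: "A * (\<Sum>k. T (p * q) (r / q) k * poly G (x k)) - (A + B + R) * (\<Sum>k. T p r k * poly G (x k))
      + B * (\<Sum>k. T (p / q) (r * q) k * poly G (x k)) = shift_factor q a p r * L"
    if pw: "\<And>k. A * (T (p * q) (r / q) k * poly G (x k)) - (A + B + R) * (T p r k * poly G (x k))
        + B * (T (p / q) (r * q) k * poly G (x k)) = shift_factor q a p r * (T (p / q) (r / q) k * (N (x k) - D (x k)))"
      and sm: "summable (\<lambda>k. T (p * q) (r / q) k * poly G (x k))" "summable (\<lambda>k. T p r k * poly G (x k))"
        "summable (\<lambda>k. T (p / q) (r * q) k * poly G (x k))"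
      and lim: "T (p / q) (r / q) \<longlonglongrightarrow> L"
      and rat: "\<And>k. T (p / q) (r / q) (Suc k) * D (x (Suc k)) = T (p / q) (r / q) k * N (x k)"
      and D0: "D (x 0) = 0" and x: "\<And>k. x k = y * q ^ k"
    for T :: "complex \<Rightarrow> complex \<Rightarrow> nat \<Rightarrow> complex" and x :: "nat \<Rightarrow> complex" and y
  proof -
    have "(\<lambda>K. T (p / q) (r / q) K * D (x K)) \<longlonglongrightarrow> L * 1"
      unfolding x by (intro tendsto_intros lim D_lim)
    then have "(\<lambda>k. T (p / q) (r / q) k * (N (x k) - D (x k))) sums L"
      unfolding sums_def
      using lattice_telescope[of "T (p / q) (r / q)" "\<lambda>k. D (x k)" "\<lambda>k. N (x k)", OF rat] D0 by simp
    from sums_mult[OF this, of "shift_factor q a p r"]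
    have "(\<lambda>k. A * (T (p * q) (r / q) k * poly G (x k)) - (A + B + R) * (T p r k * poly G (x k))
        + B * (T (p / q) (r * q) k * poly G (x k))) sums (shift_factor q a p r * L)"
      unfolding pw .
    moreover have "(\<lambda>k. A * (T (p * q) (r / q) k * poly G (x k)) - (A + B + R) * (T p r k * poly G (x k))
        + B * (T (p / q) (r * q) k * poly G (x k))) sums
      (A * (\<Sum>k. T (p * q) (r / q) k * poly G (x k)) - (A + B + R) * (\<Sum>k. T p r k * poly G (x k))
      + B * (\<Sum>k. T (p / q) (r * q) k * poly G (x k)))"
      by (intro sums_add sums_diff sums_mult summable_sums sm)
    ultimately show ?thesis using sums_unique2 by blast
  qed
  define T1 where "T1 = (\<lambda>p r k. wp_term q a (p # bs @ [r]) k)"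
  have "A * (\<Sum>k. T1 (p * q) (r / q) k * poly G (q ^ k)) - (A + B + R) * (\<Sum>k. T1 p r k * poly G (q ^ k))
      + B * (\<Sum>k. T1 (p / q) (r * q) k * poly G (q ^ k)) = shift_factor q a p r * L"
  proof (rule lattice[where y = 1])
    fix k
    have ph: "wp_pair q a (u * q) k = wp_pair q a u k * lin_factor a u (q ^ k) / lin_factor a u 1"
      if "u \<in> {p / q, p, r / q, r}" for u
      unfolding lin_factor_1 unfolding lin_factor_def
      by (rule wp_pair_shift) (use that Qap Q p r nz in auto)
    show "A * (T1 (p * q) (r / q) k * poly G (q ^ k)) - (A + B + R) * (T1 p r k * poly G (q ^ k))
        + B * (T1 (p / q) (r * q) k * poly G (q ^ k)) = shift_factor q a p r * (T1 (p / q) (r / q) k * (N (q ^ k) - D (q ^ k)))"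
      unfolding T1_def wp_term_def by (rule pointwise[OF ph])
    show "T1 (p / q) (r / q) (Suc k) * D (q ^ Suc k) = T1 (p / q) (r / q) k * N (q ^ k)"
      unfolding T1_def N_def D_def us0_def by (rule wp_term_ratio) (use Qap Q in auto)
  next
    show "T1 (p / q) (r / q) \<longlonglongrightarrow> L"
      unfolding T1_def L_def us0_def by (rule wp_term_tendsto) (use Qap Q in auto)
  qed (use Qap Q in \<open>auto simp: T1_def D_def poly_den_poly intro!: summable_wp_term G0\<close>)
  moreover
  define x where "x = (\<lambda>k. p / (a * q) * q ^ k)"
  define T2 where "T2 = (\<lambda>p r k. wp_weight q a (p # bs @ [r]) (x k))"
  have Qx: "qpoch_inf q (u * x k) \<noteq> 0" if "u \<in> set (a # p / q # bs @ [r / q])" for u k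
  proof -
    have "qpoch_inf q (p * u / (a * q)) \<noteq> 0" if "u \<in> set bs"
      using Q(7)[OF that] by (simp add: mult.commute[of p])
    then have "qpoch_inf q (u * (p / (a * q))) \<noteq> 0"
      using that Q nz by (auto simp: power2_eq_square mult_ac)
    from qpoch_inf_shift_nonzero[OF this, of k] show ?thesis by (simp add: x_def mult_ac)
  qed
  have ph: "wp_pair_inf q a (u * q) (x k) = wp_pair_inf q a u (x k) * lin_factor a u (x k) / lin_factor a u 1"
      if "u \<in> {p / q, p, r / q, r}" for u k
  proof -
    have 1: "p / q * x k \<noteq> 1" "r / q * x k \<noteq> 1" "p * x k \<noteq> 1" "r * x k \<noteq> 1"
      using ne1[OF Qx[of "p / q" k], of 0] ne1[OF Qx[of "r / q" k], of 0]
        ne1[OF Qx[of "p / q" k], of 1] ne1[OF Qx[of "r / q" k], of 1] by auto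
    show ?thesis
      unfolding lin_factor_1 unfolding lin_factor_def
      by (rule wp_pair_inf_shift) (use that 1 p r r' nz in auto)
  qed
  have smT2: "summable (\<lambda>k. T2 p r k * poly G (x k))" for p r
    unfolding T2_def x_def by (rule summable_wp_weight[OF G0])
  have "A * (\<Sum>k. T2 (p * q) (r / q) k * poly G (x k)) - (A + B + R) * (\<Sum>k. T2 p r k * poly G (x k))
      + B * (\<Sum>k. T2 (p / q) (r * q) k * poly G (x k)) = shift_factor q a p r * L"
  proof (rule lattice[where y = "p / (a * q)"])
    fix k
    show "A * (T2 (p * q) (r / q) k * poly G (x k)) - (A + B + R) * (T2 p r k * poly G (x k))
        + B * (T2 (p / q) (r * q) k * poly G (x k)) = shift_factor q a p r * (T2 (p / q) (r / q) k * (N (x k) - D (x k)))"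
      unfolding T2_def wp_weight_def by (rule pointwise[OF ph])
    have xS: "x (Suc k) = x k * q" by (simp add: x_def)
    show "T2 (p / q) (r / q) (Suc k) * D (x (Suc k)) = T2 (p / q) (r / q) k * N (x k)"
      unfolding T2_def xS N_def D_def us0_def by (rule wp_weight_ratio) (rule Qx)
  next
    show "T2 (p / q) (r / q) \<longlonglongrightarrow> L"
      unfolding T2_def L_def us0_def x_def by (rule wp_weight_tendsto)
    show "D (x 0) = 0" using nz by (simp add: D_def us0_def poly_den_poly x_def)
  qed (use smT2 in \<open>auto simp: x_def\<close>)
  moreover have "(\<Sum>k. T2 p r k * poly G (x k)) = (\<Sum>k. wp_weight q a (p # bs @ [r]) (p / a * q ^ k) * poly G (p / a * q ^ k))"
  proof -
    have "lin_factor a (p / q) (x 0) = 0" using nz by (simp add: lin_factor_def x_def)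
    then have "T2 p r 0 = 0" using ph[of "p / q" 0] nz by (simp add: T2_def wp_weight_def)
    moreover have "x (k + 1) = p / a * q ^ k" for k by (simp add: x_def)
    ultimately show ?thesis
      using suminf_drop_zeros(1)[of "\<lambda>k. T2 p r k * poly G (x k)" 1] smT2[of p r, THEN summable_ignore_initial_segment, of 1]
      by (simp add: T2_def)
  qed
  moreover have "(\<Sum>k. T2 (p * q) (r / q) k * poly G (x k))
     = (\<Sum>k. wp_weight q a (p * q # bs @ [r / q]) (p * q / a * q ^ k) * poly G (p * q / a * q ^ k))"
  proof -
    have "lin_factor a (p / q) (x 0) = 0" "lin_factor a p (x 1) = 0" using nz by (simp_all add: lin_factor_def x_def)
    then have "T2 (p * q) (r / q) 0 = 0" "T2 (p * q) (r / q) 1 = 0"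
      using ph[of "p / q" 0] ph[of p 0] ph[of p 1] nz by (simp_all add: T2_def wp_weight_def)
    then have z: "T2 (p * q) (r / q) k * poly G (x k) = 0" if "k < 2" for k
      using that by (auto simp: less_2_cases_iff)
    have "x (k + 2) = p * q / a * q ^ k" for k by (simp add: x_def power2_eq_square)
    then show ?thesis
      using suminf_drop_zeros(1)[of "\<lambda>k. T2 (p * q) (r / q) k * poly G (x k)" 2, OF _ z]
        smT2[of "p * q" "r / q", THEN summable_ignore_initial_segment, of 2]
      by (simp add: T2_def)
  qed
  moreover have "(\<Sum>k. T2 (p / q) (r * q) k * poly G (x k))
     = (\<Sum>k. wp_weight q a (p / q # bs @ [r * q]) (p / q / a * q ^ k) * poly G (p / q / a * q ^ k))"
    by (simp add: T2_def x_def mult.commute)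
  ultimately show ?thesis
    unfolding wp_pairing_def T1_def by (simp add: algebra_simps)
qed

end

section \<open>Continuation of the series in its argument\<close>

lemma degree_prod_list_linear: "degree (prod_list (map (\<lambda>u. [:1, g u:]) us)) \<le> length us"
  for g :: "'a \<Rightarrow> complex"
proof (induction us)
  case (Cons u us)
  have "degree [:1, g u:] \<le> 1" by simp
  then show ?case
    using Cons by (auto intro!: order_trans[OF degree_mult_le] add_mono simp del: mult_pCons_left)
qed simp

lemma degree_num_poly: "degree (num_poly a us) \<le> Suc (length us)"
  using degree_prod_list_linear[of "\<lambda>u. - u" "a # us"] by (simp add: num_poly_def del: mult_pCons_left)

lemma degree_den_poly: "degree (den_poly a us) \<le> Suc (length us)"
  \<comment> \<open>\<open>None\<close> stands for the factor 1 - x, which belongs to no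
    parameter.\<close>
  using degree_prod_list_linear[of "\<lambda>u. if u = None then - 1 else - (a / the u)" "None # map Some us"]
  by (simp add: den_poly_def o_def del: mult_pCons_left)

lemma prod_list_coeff_0: "coeff (prod_list (map (\<lambda>u. [:1, g u:]) us)) 0 = (1::complex)"
  by (induction us) (simp_all add: coeff_mult_0)

lemma coeff_num_poly_0 [simp]: "coeff (num_poly a us) 0 = 1"
  by (simp add: num_poly_def coeff_mult_0 prod_list_coeff_0 del: mult_pCons_left)

lemma coeff_den_poly_0 [simp]: "coeff (den_poly a us) 0 = 1"
  by (simp add: den_poly_def coeff_mult_0 prod_list_coeff_0 del: mult_pCons_left)

text \<open>The constant coefficient is w - 1, the quantity to divide by when the relation is solved
  for its lowest term.\<close>

definition ladder_poly :: "complex \<Rightarrow> complex list \<Rightarrow> complex \<Rightarrow> complex poly" where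
  "ladder_poly a us w = smult w (num_poly a us) - den_poly a us"

lemma degree_ladder_poly: "degree (ladder_poly a us w) \<le> Suc (length us)"
  unfolding ladder_poly_def
  by (intro degree_diff_le order_trans[OF degree_smult_le] degree_num_poly degree_den_poly)

lemma poly_sum_atMost:
  fixes x :: "'a::comm_ring_1"
  assumes "degree p \<le> n" shows "poly p x = (\<Sum>m\<le>n. coeff p m * x ^ m)"
  unfolding poly_altdef using assms
  by (intro sum.mono_neutral_left) (auto simp: coeff_eq_0)

definition wp_series :: "complex \<Rightarrow> complex \<Rightarrow> complex list \<Rightarrow> complex \<Rightarrow> nat \<Rightarrow> complex" where
  "wp_series q a us z j = (\<Sum>k. wp_term q a us k * (z * q ^ j) ^ k)"

text \<open>The series at \<open>z q\<^sup>j\<close> satisfies a linear relation along \<open>j\<close>; solving it downwards from an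
  index \<open>J\<close> where the series converge gives the continuation, with poles only at \<open>z q\<^sup>j = 1\<close>.\<close>

function wp_cont :: "complex \<Rightarrow> complex \<Rightarrow> complex list \<Rightarrow> complex \<Rightarrow> nat \<Rightarrow> nat \<Rightarrow> complex" where
  "wp_cont q a us z J j = (if J \<le> j then wp_series q a us z j
     else (\<Sum>m\<in>{1..Suc (length us)}. coeff (ladder_poly a us (z * q ^ j)) m * wp_cont q a us z J (j + m)) / (1 - z * q ^ j))"
  by auto
termination
  by (relation "Wellfounded.measure (\<lambda>(q, a, us, z, J, j). J - j)") auto

declare wp_cont.simps [simp del]

context q_base
begin

lemma wp_term_bounded:
  assumes "\<And>u. u \<in> set us \<Longrightarrow> qpoch_inf q (a * q / u) \<noteq> 0"
  obtains B where "\<And>k. norm (wp_term q a us k) \<le> B"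
proof -
  have "Bseq (wp_term q a us)"
    using wp_term_tendsto[OF assms] by (intro convergent_imp_Bseq) (auto simp: convergent_def)
  then show ?thesis using that by (auto simp: Bseq_def)
qed

lemma summable_wp_series:
  assumes "\<And>u. u \<in> set us \<Longrightarrow> qpoch_inf q (a * q / u) \<noteq> 0" and w: "norm w < 1"
  shows "summable (\<lambda>k. wp_term q a us k * w ^ k)"
proof -
  obtain B where B: "\<And>k. norm (wp_term q a us k) \<le> B" using wp_term_bounded[OF assms(1)] by blast
  show ?thesis
    by (rule summable_comparison_test'[where g = "\<lambda>k. B * norm w ^ k" and N = 0])
      (use w B in \<open>auto simp: norm_mult norm_power intro!: summable_mult summable_geometric mult_right_mono\<close>)
qed

lemma norm_z_q_power_less:
  assumes "norm (z * q ^ J) < 1" "J \<le> j"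
  shows "norm (z * q ^ j) < 1"
proof -
  have "norm (z * q ^ j) = norm (z * q ^ J) * norm q ^ (j - J)"
    using assms(2) by (simp add: norm_mult norm_power mult.assoc flip: power_add)
  also have "\<dots> \<le> norm (z * q ^ J) * 1"
    using q_less by (intro mult_left_mono power_le_one) auto
  finally show ?thesis using assms(1) by simp
qed

text \<open>Telescoping with \<open>wp_term\<close> times (z q^j)^k, whose boundary term at infinity
  vanishes. A monomial (q^k)^m in the ratio polynomials is absorbed by replacing j with j +
  m.\<close>

lemma wp_series_ladder:
  assumes Q: "\<And>u. u \<in> set us \<Longrightarrow> qpoch_inf q (a * q / u) \<noteq> 0" and w: "norm (z * q ^ j) < 1"
  shows "(\<Sum>m\<le>Suc (length us). coeff (ladder_poly a us (z * q ^ j)) m * wp_series q a us z (j + m)) = 0"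
proof -
  define w where "w = z * q ^ j"
  define V where "V = (\<lambda>k. wp_term q a us k * w ^ k)"
  define n where "n = Suc (length us)"
  have rat: "V (Suc k) * poly (den_poly a us) (q ^ Suc k) = V k * (w * poly (num_poly a us) (q ^ k))" for k
  proof -
    have "V (Suc k) * poly (den_poly a us) (q ^ Suc k)
       = w ^ Suc k * (wp_term q a us (Suc k) * poly (den_poly a us) (q ^ Suc k))"
      by (simp only: V_def mult_ac)
    also have "\<dots> = w ^ Suc k * (wp_term q a us k * poly (num_poly a us) (q ^ k))"
      by (simp only: wp_term_ratio[OF Q])
    finally show ?thesis by (simp only: V_def power_Suc mult_ac)
  qed
  have "V \<longlonglongrightarrow> wp_limit q a us * 0"
    unfolding V_def by (intro tendsto_mult wp_term_tendsto Q LIMSEQ_power_zero) (use w in \<open>auto simp: w_def\<close>)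
  then have "(\<lambda>K. V K * poly (den_poly a us) (q ^ K)) \<longlonglongrightarrow> 0 * poly (den_poly a us) 0"
    by (intro tendsto_intros q_power_tendsto_0) simp
  moreover have "(\<Sum>k<K. V k * (w * poly (num_poly a us) (q ^ k) - poly (den_poly a us) (q ^ k))) = V K * poly (den_poly a us) (q ^ K)" for K
    by (rule lattice_telescope[where V = V and D = "\<lambda>k. poly (den_poly a us) (q ^ k)"
          and N = "\<lambda>k. w * poly (num_poly a us) (q ^ k)", OF rat]) (simp add: poly_den_poly)
  ultimately have "(\<lambda>k. V k * (w * poly (num_poly a us) (q ^ k) - poly (den_poly a us) (q ^ k))) sums 0"
    unfolding sums_def by simp
  moreover have "V k * (w * poly (num_poly a us) (q ^ k) - poly (den_poly a us) (q ^ k))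
     = (\<Sum>m\<le>n. coeff (ladder_poly a us w) m * (wp_term q a us k * (z * q ^ (j + m)) ^ k))" for k
  proof -
    have "w * poly (num_poly a us) (q ^ k) - poly (den_poly a us) (q ^ k) = poly (ladder_poly a us w) (q ^ k)"
      by (simp add: ladder_poly_def)
    also have "\<dots> = (\<Sum>m\<le>n. coeff (ladder_poly a us w) m * (q ^ k) ^ m)"
      unfolding n_def by (rule poly_sum_atMost[OF degree_ladder_poly])
    finally have "V k * (w * poly (num_poly a us) (q ^ k) - poly (den_poly a us) (q ^ k))
      = V k * (\<Sum>m\<le>n. coeff (ladder_poly a us w) m * (q ^ k) ^ m)" by simp
    also have "\<dots> = (\<Sum>m\<le>n. coeff (ladder_poly a us w) m * (wp_term q a us k * (z * q ^ (j + m)) ^ k))"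
      unfolding sum_distrib_left
      by (intro sum.cong refl) (simp add: V_def w_def power_mult_distrib power_add mult_ac flip: power_mult)
    finally show ?thesis .
  qed
  ultimately have "(\<lambda>k. \<Sum>m\<le>n. coeff (ladder_poly a us w) m * (wp_term q a us k * (z * q ^ (j + m)) ^ k)) sums 0"
    by simp
  moreover have "(\<lambda>k. \<Sum>m\<le>n. coeff (ladder_poly a us w) m * (wp_term q a us k * (z * q ^ (j + m)) ^ k)) sums
     (\<Sum>m\<le>n. coeff (ladder_poly a us w) m * wp_series q a us z (j + m))"
    unfolding wp_series_def
    by (intro sums_sum sums_mult summable_sums summable_wp_series Q norm_z_q_power_less[OF w]) auto
  ultimately show ?thesis
    unfolding n_def w_def using sums_unique2 by blast
qed

lemma ladder_solve:
  fixes S :: "nat \<Rightarrow> complex"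
  assumes "1 - z * q ^ j \<noteq> 0"
  shows "(\<Sum>m\<le>Suc (length us). coeff (ladder_poly a us (z * q ^ j)) m * S (j + m)) = 0 \<longleftrightarrow>
    S j = (\<Sum>m\<in>{1..Suc (length us)}. coeff (ladder_poly a us (z * q ^ j)) m * S (j + m)) / (1 - z * q ^ j)"
proof -
  have *: "(w - 1) * s + X = 0 \<longleftrightarrow> s = X / (1 - w)" if "1 - w \<noteq> 0" for w s X :: complex
    using that by (simp add: eq_divide_eq) (auto simp: algebra_simps)
  have "(\<Sum>m\<le>Suc (length us). coeff (ladder_poly a us (z * q ^ j)) m * S (j + m))
    = (z * q ^ j - 1) * S j + (\<Sum>m\<in>{1..Suc (length us)}. coeff (ladder_poly a us (z * q ^ j)) m * S (j + m))"
    unfolding atMost_atLeast0 by (subst sum.atLeast_Suc_atMost) (simp_all add: ladder_poly_def)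
  then show ?thesis by (simp only: *[OF assms])
qed

lemma wp_cont_ladder:
  assumes Q: "\<And>u. u \<in> set us \<Longrightarrow> qpoch_inf q (a * q / u) \<noteq> 0" and J: "norm (z * q ^ J) < 1"
    and z: "1 - z * q ^ j \<noteq> 0"
  shows "(\<Sum>m\<le>Suc (length us). coeff (ladder_poly a us (z * q ^ j)) m * wp_cont q a us z J (j + m)) = 0"
proof (cases "J \<le> j")
  case True
  then have "wp_cont q a us z J (j + m) = wp_series q a us z (j + m)" for m
    by (simp add: wp_cont.simps)
  then show ?thesis using wp_series_ladder[OF Q norm_z_q_power_less[OF J True]] by simp
next
  case False
  then show ?thesis
    unfolding ladder_solve[OF z, where S = "wp_cont q a us z J"] by (subst wp_cont.simps) simp
qed

text \<open>Each relation determines its lowest term from the higher ones, so agreement from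
  \<open>J\<close> on descends to every index.\<close>

lemma ladder_unique:
  fixes S S' :: "nat \<Rightarrow> complex"
  assumes "\<And>j. 1 - z * q ^ j \<noteq> 0"
    and "\<And>j. (\<Sum>m\<le>Suc (length us). coeff (ladder_poly a us (z * q ^ j)) m * S (j + m)) = 0"
    and "\<And>j. (\<Sum>m\<le>Suc (length us). coeff (ladder_poly a us (z * q ^ j)) m * S' (j + m)) = 0"
    and "\<And>j. J \<le> j \<Longrightarrow> S j = S' j"
  shows "S j = S' j"
proof (induction "J - j" arbitrary: j rule: less_induct)
  case less
  show ?case
  proof (cases "J \<le> j")
    case False
    then have "S (j + m) = S' (j + m)" if "m \<in> {1..Suc (length us)}" for m
      using that by (intro less) auto
    then show ?thesis
      using assms(2)[of j] assms(3)[of j] unfolding ladder_solve[OF assms(1)] by simp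
  qed (use assms in auto)
qed

text \<open>From \<open>max J J'\<close> on both sides are the convergent series, and below it they
  solve the same relations; the cutoff is thus immaterial.\<close>

lemma wp_cont_cong:
  assumes Q: "\<And>u. u \<in> set us \<Longrightarrow> qpoch_inf q (a * q / u) \<noteq> 0"
    and J: "norm (z * q ^ J) < 1" "norm (z * q ^ J') < 1" and z: "\<And>j. 1 - z * q ^ j \<noteq> 0"
  shows "wp_cont q a us z J j = wp_cont q a us z J' j"
  by (rule ladder_unique[OF z wp_cont_ladder[OF Q J(1) z] wp_cont_ladder[OF Q J(2) z], where J = "max J J'"])
    (auto simp: wp_cont.simps)

end

section \<open>Holomorphy in six variables\<close>

fun cscale :: "complex \<Rightarrow> complex6 \<Rightarrow> complex6" where
  "cscale t (u1, u2, u3, u4, u5, u6) = (t * u1, t * u2, t * u3, t * u4, t * u5, t * u6)"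

lemma norm_cscale: "norm (cscale t v) = norm t * norm v"
proof -
  have *: "norm (t * x, y') = norm t * norm (x, y)" if "norm y' = norm t * norm y"
    for x :: complex and y y' :: "'a::real_normed_vector"
    using that by (simp add: norm_Pair norm_mult power_mult_distrib real_sqrt_mult flip: distrib_left)
  show ?thesis
    by (cases v) (auto intro!: * simp: norm_mult)
qed

text \<open>Complex linearity of the derivative without coordinates: additivity is part of
  \<open>has_derivative\<close>, homogeneity under \<open>cscale\<close> is added. The usual rules
  preserve this form, and \<open>holomorphic6_onI\<close> returns to six partial
  derivatives.\<close>

definition complex_diff :: "(complex6 \<Rightarrow> complex) \<Rightarrow> complex6 \<Rightarrow> bool" where
  "complex_diff F x \<longleftrightarrow> (\<exists>L. (F has_derivative L) (at x) \<and> (\<forall>t v. L (cscale t v) = t * L v))"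

lemma complex_diffI: "(F has_derivative L) (at x) \<Longrightarrow> (\<And>t v. L (cscale t v) = t * L v) \<Longrightarrow> complex_diff F x"
  by (auto simp: complex_diff_def)

lemma complex_diffE:
  assumes "complex_diff F x"
  obtains L where "(F has_derivative L) (at x)" "\<And>t v. L (cscale t v) = t * L v"
  using assms by (auto simp: complex_diff_def)

lemma holomorphic6_onI:
  assumes "\<And>x. x \<in> U \<Longrightarrow> complex_diff F x"
  shows "holomorphic6_on F U"
  unfolding holomorphic6_on_def
proof
  fix x assume "x \<in> U"
  then obtain L where L: "(F has_derivative L) (at x)" "\<And>t v. L (cscale t v) = t * L v"
    using assms complex_diffE by blast
  interpret L: bounded_linear L using L(1) by (rule has_derivative_bounded_linear)
  have "L = (\<lambda>(u1, u2, u3, u4, u5, u6). L (1,0,0,0,0,0) * u1 + L (0,1,0,0,0,0) * u2 + L (0,0,1,0,0,0) * u3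
      + L (0,0,0,1,0,0) * u4 + L (0,0,0,0,1,0) * u5 + L (0,0,0,0,0,1) * u6)"
  proof (rule ext, clarify)
    fix u1 u2 u3 u4 u5 u6 :: complex
    have "(u1, u2, u3, u4, u5, u6) = cscale u1 (1,0,0,0,0,0) + cscale u2 (0,1,0,0,0,0) + cscale u3 (0,0,1,0,0,0)
      + cscale u4 (0,0,0,1,0,0) + cscale u5 (0,0,0,0,1,0) + cscale u6 (0,0,0,0,0,1)" by simp
    then have "L (u1, u2, u3, u4, u5, u6) = L (cscale u1 (1,0,0,0,0,0)) + L (cscale u2 (0,1,0,0,0,0)) + L (cscale u3 (0,0,1,0,0,0))
      + L (cscale u4 (0,0,0,1,0,0)) + L (cscale u5 (0,0,0,0,1,0)) + L (cscale u6 (0,0,0,0,0,1))"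
      by (simp only: L.add)
    then show "L (u1, u2, u3, u4, u5, u6) = L (1,0,0,0,0,0) * u1 + L (0,1,0,0,0,0) * u2 + L (0,0,1,0,0,0) * u3
      + L (0,0,0,1,0,0) * u4 + L (0,0,0,0,1,0) * u5 + L (0,0,0,0,0,1) * u6"
      by (simp only: L(2) mult.commute)
  qed
  then show "\<exists>A1 A2 A3 A4 A5 A6. (F has_derivative
      (\<lambda>(u1, u2, u3, u4, u5, u6). A1*u1 + A2*u2 + A3*u3 + A4*u4 + A5*u5 + A6*u6)) (at x)"
    using L(1) by metis
qed

named_theorems complex_diff_intros

lemma complex_diff_const [complex_diff_intros]: "complex_diff (\<lambda>x. c) x"
  by (rule complex_diffI[of _ "\<lambda>_. 0"]) auto

lemma complex_diff_coords [complex_diff_intros]: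
  "complex_diff fst x" "complex_diff (\<lambda>x. fst (snd x)) x" "complex_diff (\<lambda>x. fst (snd (snd x))) x"
  "complex_diff (\<lambda>x. fst (snd (snd (snd x)))) x" "complex_diff (\<lambda>x. fst (snd (snd (snd (snd x))))) x"
  "complex_diff (\<lambda>x. snd (snd (snd (snd (snd x))))) x"
proof -
  show "complex_diff fst x"
    by (rule complex_diffI[of _ fst]) (auto intro!: derivative_eq_intros)
  show "complex_diff (\<lambda>x. fst (snd x)) x"
    by (rule complex_diffI[of _ "\<lambda>x. fst (snd x)"]) (auto intro!: derivative_eq_intros)
  show "complex_diff (\<lambda>x. fst (snd (snd x))) x"
    by (rule complex_diffI[of _ "\<lambda>x. fst (snd (snd x))"]) (auto intro!: derivative_eq_intros)
  show "complex_diff (\<lambda>x. fst (snd (snd (snd x)))) x"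
    by (rule complex_diffI[of _ "\<lambda>x. fst (snd (snd (snd x)))"]) (auto intro!: derivative_eq_intros)
  show "complex_diff (\<lambda>x. fst (snd (snd (snd (snd x))))) x"
    by (rule complex_diffI[of _ "\<lambda>x. fst (snd (snd (snd (snd x))))"]) (auto intro!: derivative_eq_intros)
  show "complex_diff (\<lambda>x. snd (snd (snd (snd (snd x))))) x"
    by (rule complex_diffI[of _ "\<lambda>x. snd (snd (snd (snd (snd x))))"]) (auto intro!: derivative_eq_intros)
qed

lemma complex_diff_add [complex_diff_intros]:
  assumes "complex_diff F x" "complex_diff G x"
  shows "complex_diff (\<lambda>x. F x + G x) x"
proof -
  from assms obtain K L where "(F has_derivative K) (at x)" "\<And>t v. K (cscale t v) = t * K v"
    "(G has_derivative L) (at x)" "\<And>t v. L (cscale t v) = t * L v" by (metis complex_diffE)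
  then show ?thesis
    by (intro complex_diffI[of _ "\<lambda>v. K v + L v"]) (auto intro!: derivative_intros simp: distrib_left)
qed

lemma complex_diff_mult [complex_diff_intros]:
  assumes "complex_diff F x" "complex_diff G x"
  shows "complex_diff (\<lambda>x. F x * G x) x"
proof -
  from assms obtain K L where "(F has_derivative K) (at x)" "\<And>t v. K (cscale t v) = t * K v"
    "(G has_derivative L) (at x)" "\<And>t v. L (cscale t v) = t * L v" by (metis complex_diffE)
  then show ?thesis
    by (intro complex_diffI[OF has_derivative_mult]) (auto simp: algebra_simps)
qed

lemma complex_diff_minus [complex_diff_intros]:
  "complex_diff F x \<Longrightarrow> complex_diff (\<lambda>x. - F x) x"
  using complex_diff_mult[OF complex_diff_const[of "- 1" x], of F] by simp

lemma complex_diff_diff [complex_diff_intros]: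
  "complex_diff F x \<Longrightarrow> complex_diff G x \<Longrightarrow> complex_diff (\<lambda>x. F x - G x) x"
  using complex_diff_add[OF _ complex_diff_minus, of F x G] by simp

lemma complex_diff_inverse [complex_diff_intros]:
  assumes "complex_diff F x" "F x \<noteq> 0"
  shows "complex_diff (\<lambda>x. inverse (F x)) x"
proof -
  from assms obtain K where "(F has_derivative K) (at x)" "\<And>t v. K (cscale t v) = t * K v" by (metis complex_diffE)
  then show ?thesis
    using assms(2) by (intro complex_diffI[of _ "\<lambda>v. - (inverse (F x) * K v * inverse (F x))"]) (auto intro!: has_derivative_inverse)
qed

lemma complex_diff_divide [complex_diff_intros]:
  "complex_diff F x \<Longrightarrow> complex_diff G x \<Longrightarrow> G x \<noteq> 0 \<Longrightarrow> complex_diff (\<lambda>x. F x / G x) x"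
  unfolding divide_inverse by (intro complex_diff_intros)

lemma complex_diff_power [complex_diff_intros]:
  "complex_diff F x \<Longrightarrow> complex_diff (\<lambda>x. F x ^ n) x"
  by (induction n) (auto intro!: complex_diff_intros)

lemma complex_diff_prod [complex_diff_intros]:
  "(\<And>i. i \<in> I \<Longrightarrow> complex_diff (F i) x) \<Longrightarrow> complex_diff (\<lambda>x. \<Prod>i\<in>I. F i x) x"
  by (induction I rule: infinite_finite_induct) (auto intro!: complex_diff_intros)

lemma complex_diff_sum [complex_diff_intros]:
  "(\<And>i. i \<in> I \<Longrightarrow> complex_diff (F i) x) \<Longrightarrow> complex_diff (\<lambda>x. \<Sum>i\<in>I. F i x) x"
  by (induction I rule: infinite_finite_induct) (auto intro!: complex_diff_intros)

lemma complex_diff_prod_list [complex_diff_intros]: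
  "(\<And>g. g \<in> set gs \<Longrightarrow> complex_diff (F g) x) \<Longrightarrow> complex_diff (\<lambda>x. prod_list (map (\<lambda>g. F g x) gs)) x"
  by (induction gs) (auto intro!: complex_diff_intros)

lemma complex_diff_qpoch [complex_diff_intros]:
  "complex_diff F x \<Longrightarrow> complex_diff (\<lambda>x. qpoch q (F x) k) x"
  unfolding qpoch_def by (intro complex_diff_intros)

lemma complex_diff_cong:
  assumes "complex_diff F x" "\<forall>\<^sub>F y in nhds x. G y = F y"
  shows "complex_diff G x"
proof -
  from assms obtain K where K: "(F has_derivative K) (at x)" "\<And>t v. K (cscale t v) = t * K v" by (metis complex_diffE)
  have "(G has_derivative K) (at x)"
    by (rule has_derivative_transform_eventually[OF K(1)])
      (use assms(2) eventually_nhds_x_imp_x[OF assms(2)] in \<open>auto simp: eventually_at_filter elim: eventually_mono\<close>)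
  then show ?thesis using K(2) by (rule complex_diffI)
qed

lemma complex_diff_continuous: "complex_diff F x \<Longrightarrow> (F \<longlongrightarrow> F x) (nhds x)"
  by (metis complex_diffE has_derivative_continuous continuous_at tendsto_at_iff_tendsto_nhds)

text \<open>Cauchy's estimate along the complex line through \<open>x\<close> in the direction \<open>v\<close>.\<close>

lemma complex_diff_derivative_bound:
  assumes diff: "\<And>y. y \<in> ball x0 (2 * r) \<Longrightarrow> complex_diff F y"
    and bd: "\<And>y. y \<in> ball x0 (2 * r) \<Longrightarrow> norm (F y) \<le> M"
    and r: "r > 0" and x: "x \<in> ball x0 r"
    and L: "(F has_derivative L) (at x)" "\<And>t v. L (cscale t v) = t * L v"
  shows "norm (L v) \<le> 2 * M / r * norm v"
proof (cases "v = 0")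
  case True
  interpret bounded_linear L using L(1) by (rule has_derivative_bounded_linear)
  show ?thesis using True zero by simp
next
  case False
  \<comment> \<open>Half the radius at which the complex line leaves the ball of radius r about
    \<open>x\<close>, a ball contained in the one of radius 2r about \<open>x0\<close>.\<close>
  define \<rho> where "\<rho> = r / (2 * norm v)"
  have \<rho>: "\<rho> > 0" using r False by (simp add: \<rho>_def)
  define \<phi> where "\<phi> = (\<lambda>t. F (x + cscale t v))"
  have inb: "x + cscale t v \<in> ball x0 (2 * r)" if "norm t \<le> \<rho>" for t
  proof -
    have "norm (cscale t v) \<le> \<rho> * norm v" unfolding norm_cscale using that by (intro mult_right_mono) auto
    also have "\<dots> < r" using False r by (simp add: \<rho>_def)
    finally have "norm (cscale t v) < r" .
    then have "dist x (x + cscale t v) < r" by (simp add: dist_norm)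
    moreover have "dist x0 x < r" using x by simp
    ultimately have "dist x0 (x + cscale t v) < 2 * r"
      using dist_triangle[of x0 "x + cscale t v" x] by linarith
    then show ?thesis by simp
  qed
  have lin: "bounded_linear (\<lambda>t. cscale t v)"
  proof (rule bounded_linear_intro[where K = "norm v"])
    show "cscale (s + t) v = cscale s v + cscale t v" for s t by (cases v) (simp add: distrib_right)
    show "cscale (r *\<^sub>R t) v = r *\<^sub>R cscale t v" for r t by (cases v) simp
  qed (simp add: norm_cscale)
  have der: "(\<phi> has_derivative (\<lambda>h. K (cscale h v))) (at t)"
    if "(F has_derivative K) (at (x + cscale t v))" for K t
  proof -
    have "((\<lambda>t. x + cscale t v) has_derivative (\<lambda>h. cscale h v)) (at t)"
      using bounded_linear_imp_has_derivative[OF lin] by (auto intro!: derivative_eq_intros)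
    from has_derivative_compose[OF this that] show ?thesis by (simp add: \<phi>_def)
  qed
  have field_der: "(\<phi> has_field_derivative K v) (at t)"
    if "(F has_derivative K) (at (x + cscale t v))" "\<And>t v. K (cscale t v) = t * K v" for K t
    using der[OF that(1)] that(2) by (simp add: has_field_derivative_def mult_commute_abs)
  have diff\<phi>: "\<phi> field_differentiable (at t)" if "norm t \<le> \<rho>" for t
    using diff[OF inb[OF that]] field_der by (metis complex_diffE field_differentiable_def)
  have hol: "\<phi> holomorphic_on cball 0 \<rho>"
    unfolding holomorphic_on_def using diff\<phi> by (auto intro: field_differentiable_at_within)
  have "norm ((deriv ^^ 1) \<phi> 0) \<le> fact 1 * M / \<rho> ^ 1"
  proof (rule Cauchy_inequality)
    show "\<phi> holomorphic_on ball 0 \<rho>" using hol by (rule holomorphic_on_subset) auto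
    show "continuous_on (cball 0 \<rho>) \<phi>" using hol by (rule holomorphic_on_imp_continuous_on)
    show "norm (\<phi> t) \<le> M" if "norm (0 - t) = \<rho>" for t
      unfolding \<phi>_def using that by (intro bd inb) simp
  qed (rule \<rho>)
  moreover have "x + cscale 0 v = x" by (cases v) (simp flip: zero_prod_def)
  then have "deriv \<phi> 0 = L v"
    using field_der[of L 0] L by (intro DERIV_imp_deriv) simp
  ultimately show ?thesis by (simp add: \<rho>_def mult_ac)
qed

text \<open>The theorem of Weierstrass: Cauchy's estimate turns summable bounds on the terms into
  summable bounds on their derivatives, which permits termwise differentiation.\<close>

lemma complex_diff_series:
  fixes f :: "nat \<Rightarrow> complex6 \<Rightarrow> complex"
  assumes ev: "\<forall>\<^sub>F y in nhds x0. \<forall>k. complex_diff (f k) y \<and> norm (f k y) \<le> M k"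
    and M: "summable M"
  shows "complex_diff (\<lambda>y. \<Sum>k. f k y) x0"
proof -
  obtain r0 where r0: "r0 > 0" "\<And>y. dist y x0 < r0 \<Longrightarrow> \<forall>k. complex_diff (f k) y \<and> norm (f k y) \<le> M k"
    using ev by (auto simp: eventually_nhds_metric)
  \<comment> \<open>Halved because the derivative estimate on the ball of radius r uses values on
    the ball of radius 2r.\<close>
  define r where "r = r0 / 2"
  have r: "r > 0" using r0 by (simp add: r_def)
  have diff: "complex_diff (f k) y" and bd: "norm (f k y) \<le> M k" if "y \<in> ball x0 (2 * r)" for k y
    using r0(2)[of y] that by (auto simp: r_def dist_commute)
  have sub: "ball x0 r \<subseteq> ball x0 (2 * r)" using r by (intro subset_ball) simp
  have "\<exists>L. \<forall>k. \<forall>y\<in>ball x0 r. (f k has_derivative L k y) (at y) \<and> (\<forall>t v. L k y (cscale t v) = t * L k y v)"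
    using diff sub unfolding complex_diff_def by (intro choice allI bchoice) blast
  then obtain L where L: "\<And>k y. y \<in> ball x0 r \<Longrightarrow> (f k has_derivative L k y) (at y)"
    "\<And>k y t v. y \<in> ball x0 r \<Longrightarrow> L k y (cscale t v) = t * L k y v" by blast
  have Lb: "norm (L k y v) \<le> 2 * M k / r * norm v" if "y \<in> ball x0 r" for k y v
    by (rule complex_diff_derivative_bound[OF diff bd r that L(1)[OF that] L(2)[OF that]])
  have smM: "summable (\<lambda>k. 2 * M k / r * c)" for c
    using M by (intro summable_mult2 summable_divide summable_mult)
  have smL: "summable (\<lambda>k. L k y v)" if "y \<in> ball x0 r" for y v
    by (rule summable_comparison_test'[OF smM[of "norm v"], where N = 0]) (rule Lb[OF that])
  define g where "g = (\<lambda>y v. \<Sum>k. L k y v)"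
  have "\<exists>F. \<forall>y\<in>ball x0 r. (\<lambda>k. f k y) sums F y \<and> (F has_derivative g y) (at y within ball x0 r)"
  proof (rule has_derivative_series)
    show "convex (ball x0 r)" by simp
    show "(f k has_derivative L k y) (at y within ball x0 r)" if "y \<in> ball x0 r" for k y
      using L(1)[OF that] by (rule has_derivative_at_withinI)
    show "x0 \<in> ball x0 r" using r by simp
    then show "(\<lambda>k. f k x0) sums (\<Sum>k. f k x0)"
      using bd sub by (intro summable_sums summable_comparison_test'[OF M, where N = 0]) auto
    fix e :: real assume e: "e > 0"
    have "(\<lambda>n. \<Sum>k. 2 * M (k + n) / r) \<longlonglongrightarrow> 0"
      using suminf_exist_split2[OF smM[of 1]] by simp
    then have "\<forall>\<^sub>F n in sequentially. (\<Sum>k. 2 * M (k + n) / r) < e"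
      using e by (intro order_tendstoD) auto
    then show "\<forall>\<^sub>F n in sequentially. \<forall>y\<in>ball x0 r. \<forall>h. norm ((\<Sum>i<n. L i y h) - g y h) \<le> e * norm h"
    proof eventually_elim
      case (elim n)
      show ?case
      proof (intro ballI allI)
        fix y h assume y: "y \<in> ball x0 r"
        have "(\<Sum>i<n. L i y h) - g y h = - (\<Sum>k. L (k + n) y h)"
          unfolding g_def using suminf_minus_initial_segment[OF smL[OF y, of h], of n] by simp
        also have "norm \<dots> \<le> (\<Sum>k. 2 * M (k + n) / r * norm h)"
        proof -
          have sm: "summable (\<lambda>k. 2 * M (k + n) / r * norm h)"
            using summable_ignore_initial_segment[OF smM[of "norm h"], of n] .
          have sm2: "summable (\<lambda>k. norm (L (k + n) y h))"
            by (rule summable_comparison_test'[OF sm, where N = 0]) (simp only: real_norm_def abs_norm_cancel Lb[OF y])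
          show ?thesis
            using order_trans[OF summable_norm[OF sm2] suminf_le[OF Lb[OF y] sm2 sm]] by simp
        qed
        also have "\<dots> = (\<Sum>k. 2 * M (k + n) / r) * norm h"
          using summable_ignore_initial_segment[OF smM[of 1], of n] by (subst suminf_mult2) simp_all
        also have "\<dots> \<le> e * norm h" using elim by (intro mult_right_mono) auto
        finally show "norm ((\<Sum>i<n. L i y h) - g y h) \<le> e * norm h" .
      qed
    qed
  qed
  then obtain F where F: "\<And>y. y \<in> ball x0 r \<Longrightarrow> (\<lambda>k. f k y) sums F y"
    "\<And>y. y \<in> ball x0 r \<Longrightarrow> (F has_derivative g y) (at y within ball x0 r)" by blast
  have x0: "x0 \<in> ball x0 r" using r by simp
  have "(F has_derivative g x0) (at x0)"
    using F(2)[OF x0] at_within_open[OF x0 open_ball] by simp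
  moreover have "g x0 (cscale t v) = t * g x0 v" for t v
    unfolding g_def L(2)[OF x0] by (rule suminf_mult[OF smL[OF x0]])
  ultimately have "complex_diff F x0" by (rule complex_diffI)
  moreover have "\<forall>\<^sub>F y in nhds x0. (\<Sum>k. f k y) = F y"
    using eventually_nhds_in_open[OF open_ball x0]
    by eventually_elim (use F(1) sums_unique in metis)
  ultimately show ?thesis by (rule complex_diff_cong)
qed

section \<open>The continuation of 8W7\<close>

text \<open>The factor 1 - a q^(2k) splits the very-well-poised series into the members 0 and 2 of
  the ladder, each of which is continued by \<open>wp_cont\<close>.\<close>

definition wp_W :: "complex \<Rightarrow> complex \<Rightarrow> complex list \<Rightarrow> complex \<Rightarrow> complex" where
  "wp_W q a us z = (let J = LEAST J. norm (z * q ^ J) < 1 in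
     (wp_cont q a us z J 0 - a * wp_cont q a us z J 2) / (1 - a))"

text \<open>A fixed list of coordinate functions turns products over the parameters into products
  over functions of the point, which can be differentiated factor by factor.\<close>

definition coords :: "(complex6 \<Rightarrow> complex) list" where
  "coords = [\<lambda>x. fst (snd x), \<lambda>x. fst (snd (snd x)), \<lambda>x. fst (snd (snd (snd x))),
     \<lambda>x. fst (snd (snd (snd (snd x)))), \<lambda>x. snd (snd (snd (snd (snd x))))]"

definition params :: "complex6 \<Rightarrow> complex list" where
  "params x = map (\<lambda>g. g x) coords"

lemma params_tuple: "params (a, b, c, d, e, f) = [b, c, d, e, f]"
  by (simp add: params_def coords_def)

lemma complex_diff_coord: "g \<in> set coords \<Longrightarrow> complex_diff g x"
  by (auto simp: coords_def intro: complex_diff_coords)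

lemma W8_7_arg_eq: "W8_7_arg q x = (fst x)\<^sup>2 * q\<^sup>2 / prod_list (params x)"
  by (cases x) (simp add: W8_7_arg_def params_tuple mult.assoc)

lemma complex_diff_W8_7_arg: "0 \<notin> set (params x) \<Longrightarrow> complex_diff (W8_7_arg q) x"
  unfolding W8_7_arg_eq[abs_def] params_def
  by (intro complex_diff_intros complex_diff_coord) (auto simp: prod_list_zero_iff)

lemma complex_diff_coeff_prod_list:
  assumes "\<And>g. g \<in> set gs \<Longrightarrow> complex_diff g x"
  shows "complex_diff (\<lambda>y. coeff (prod_list (map (\<lambda>g. [:1, g y:]) gs)) m) x"
  using assms
proof (induction gs arbitrary: m)
  case (Cons g gs)
  have eq: "coeff (prod_list (map (\<lambda>g. [:1, g y:]) (g # gs))) m = coeff (prod_list (map (\<lambda>g. [:1, g y:]) gs)) m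
     + (if m = 0 then 0 else g y * coeff (prod_list (map (\<lambda>g. [:1, g y:]) gs)) (m - 1))" for y
    by (simp add: coeff_pCons split: nat.split)
  have IH: "complex_diff (\<lambda>y. coeff (prod_list (map (\<lambda>g. [:1, g y:]) gs)) m) x" for m
    using Cons by simp
  have g: "complex_diff (\<lambda>y. g y) x" using Cons.prems by simp
  show ?case
    unfolding eq using IH complex_diff_add[OF IH complex_diff_mult[OF g IH]] by (cases "m = 0") simp_all
qed (auto intro: complex_diff_const)

lemma complex_diff_ladder_poly:
  assumes nz: "0 \<notin> set (params x)" and w: "complex_diff w x"
  shows "complex_diff (\<lambda>y. coeff (ladder_poly (fst y) (params y) (w y)) m) x"
proof -
  have 1: "num_poly (fst y) (params y) = prod_list (map (\<lambda>g. [:1, g y:]) ((\<lambda>y. - fst y) # map (\<lambda>g y. - g y) coords))"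
    and 2: "den_poly (fst y) (params y) = prod_list (map (\<lambda>g. [:1, g y:]) ((\<lambda>y. - 1) # map (\<lambda>g y. - (fst y / g y)) coords))" for y
    by (simp_all only: num_poly_def den_poly_def params_def list.map prod_list.Cons list.map_comp o_def)
  have c1: "complex_diff g x" if "g \<in> set ((\<lambda>y. - fst y) # map (\<lambda>g y. - g y) coords)" for g
    using that by (auto intro!: complex_diff_intros intro: complex_diff_coord)
  have c2: "complex_diff g x" if "g \<in> set ((\<lambda>y. - 1) # map (\<lambda>g y. - (fst y / g y)) coords)" for g
    using that nz by (auto simp: params_def intro!: complex_diff_intros intro: complex_diff_coord)
  show ?thesis
    unfolding ladder_poly_def coeff_diff coeff_smult 1 2
    by (intro complex_diff_intros w complex_diff_coeff_prod_list) (use c1 c2 in blast)+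
qed

lemma norm_prod_list_le:
  fixes F :: "'a \<Rightarrow> complex"
  assumes "\<And>g. g \<in> set gs \<Longrightarrow> norm (F g) \<le> K g"
  shows "norm (prod_list (map F gs)) \<le> prod_list (map K gs)"
  using assms
proof (induction gs)
  case (Cons g gs)
  have "norm (prod_list (map F gs)) \<le> prod_list (map K gs)" using Cons by simp
  then show ?case using Cons.prems[of g]
    by (auto simp: norm_mult intro!: mult_mono) (metis norm_ge_zero order_trans)
qed simp

context q_base
begin

lemma qpoch_inf_nonzeroI: "(\<And>k. qpoch q x k \<noteq> 0) \<Longrightarrow> qpoch_inf q x \<noteq> 0"
  unfolding qpoch_inf_nonzero_iff by (meson lessI qpoch_nonzero_iff)

lemma vwp_nonsing_iff: "vwp_nonsing q a us \<longleftrightarrow> a \<noteq> 1 \<and> (\<forall>u\<in>set us. qpoch_inf q (a * q / u) \<noteq> 0)"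
proof -
  have "qpochs q xs k \<noteq> 0 \<longleftrightarrow> (\<forall>x\<in>set xs. qpoch q x k \<noteq> 0)" for xs k
    by (induction xs) (auto simp: qpochs_Cons)
  then have "vwp_nonsing q a us \<longleftrightarrow> a \<noteq> 1 \<and> (\<forall>k. \<forall>u\<in>set us. qpoch q (a * q / u) k \<noteq> 0)"
    using qpoch_nonzero[OF qpoch_inf_q_nonzero] by (auto simp: vwp_nonsing_def)
  then show ?thesis using qpoch_nonzero qpoch_inf_nonzeroI by metis
qed

lemma W8_7_nonsing_eq: "W8_7_nonsing q x \<longleftrightarrow> fst x \<noteq> 0 \<and> 0 \<notin> set (params x) \<and> fst x \<noteq> 1 \<and>
   (\<forall>u\<in>set (params x). qpoch_inf q (fst x * q / u) \<noteq> 0) \<and> (\<forall>k. W8_7_arg q x * q ^ k \<noteq> 1)"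
  by (cases x) (simp only: W8_7_nonsing_def vwp_nonsing_iff params_tuple, auto)

lemma exists_small_power: "\<exists>J. norm (z * q ^ J) < 1"
  using q_power_small[of 1 "norm z"] by (auto simp: norm_mult norm_power)

lemma wp_W_eq:
  assumes "\<And>u. u \<in> set us \<Longrightarrow> qpoch_inf q (a * q / u) \<noteq> 0"
    and "norm (z * q ^ J) < 1" and "\<And>j. z * q ^ j \<noteq> 1"
  shows "wp_W q a us z = (wp_cont q a us z J 0 - a * wp_cont q a us z J 2) / (1 - a)"
proof -
  define J' where "J' = (LEAST J. norm (z * q ^ J) < 1)"
  have "norm (z * q ^ J') < 1" unfolding J'_def by (rule LeastI[where P = "\<lambda>J. norm (z * q ^ J) < 1" and k = J]) (rule assms(2))
  then have "wp_cont q a us z J' j = wp_cont q a us z J j" for j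
    by (intro wp_cont_cong assms) (use assms(3) in auto)
  then show ?thesis by (simp add: wp_W_def Let_def J'_def)
qed

lemma wp_W_eq_series:
  assumes Q: "\<And>u. u \<in> set us \<Longrightarrow> qpoch_inf q (a * q / u) \<noteq> 0" and z: "norm z < 1"
  shows "vwp_series q a us z = wp_W q a us z"
proof -
  have small: "norm (z * q ^ j) < 1" for j
    by (rule norm_z_q_power_less[of z 0]) (use z in auto)
  then have z1: "z * q ^ j \<noteq> 1" for j using small[of j] by (metis norm_one less_irrefl)
  have sm: "summable (\<lambda>k. wp_term q a us k * (z * q ^ j) ^ k)" for j
    using summable_wp_series[OF Q small] .
  have W: "wp_W q a us z = (wp_series q a us z 0 - a * wp_series q a us z 2) / (1 - a)"
    by (subst wp_W_eq[OF Q, where J = 0]) (use z z1 in \<open>auto simp: wp_cont.simps\<close>)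
  have "(\<lambda>k. (wp_term q a us k * (z * q ^ 0) ^ k - a * (wp_term q a us k * (z * q ^ 2) ^ k)) / (1 - a)) sums ((wp_series q a us z 0 - a * wp_series q a us z 2) / (1 - a))"
    unfolding wp_series_def by (intro sums_divide sums_diff sums_mult summable_sums sm)
  then have "(wp_series q a us z 0 - a * wp_series q a us z 2) / (1 - a)
     = (\<Sum>k. (wp_term q a us k * (z * q ^ 0) ^ k - a * (wp_term q a us k * (z * q ^ 2) ^ k)) / (1 - a))"
    by (rule sums_unique)
  also have "\<dots> = vwp_series q a us z"
    unfolding vwp_series_def wp_term_eq
    by (intro arg_cong[where f = suminf] ext) (simp add: power_mult_distrib power_mult[symmetric] diff_divide_distrib left_diff_distrib right_diff_distrib mult_ac)
  finally show ?thesis unfolding W ..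
qed

text \<open>Supplies the domination for \<open>complex_diff_series\<close>: numerators are bounded
  by an exponential of the norm of their base, denominators by
  \<open>inverse_qpoch_locally_bounded\<close>.\<close>

lemma locally_bounded_terms:
  assumes nz: "0 \<notin> set (params x0)"
    and Q: "\<And>u. u \<in> set (params x0) \<Longrightarrow> qpoch_inf q (fst x0 * q / u) \<noteq> 0"
  shows "\<exists>B. \<forall>\<^sub>F y in nhds x0. 0 \<notin> set (params y) \<and> (\<forall>u\<in>set (params y). qpoch_inf q (fst y * q / u) \<noteq> 0)
     \<and> (\<forall>k. norm (wp_term q (fst y) (params y) k) \<le> B)"
proof -
  define C where "C = (\<lambda>g. exp ((norm (g x0 :: complex) + 1) / (1 - norm q)))"
  have numb: "\<forall>\<^sub>F y in nhds x0. \<forall>k. norm (qpoch q (g y) k) \<le> C g" if "complex_diff g x0" for g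
  proof -
    have "\<forall>\<^sub>F y in nhds x0. norm (g y) < norm (g x0) + 1"
      by (rule order_tendstoD(2)[OF tendsto_norm[OF complex_diff_continuous[OF that]]]) simp
    then show ?thesis
    proof eventually_elim
      case (elim y)
      have "exp (norm (g y) / (1 - norm q)) \<le> C g"
        unfolding C_def using elim q_less by (intro exp_le_cancel_iff[THEN iffD2] divide_right_mono) auto
      then show ?case by (auto intro: order_trans[OF qpoch_norm_le])
    qed
  qed
  have "\<exists>B. \<forall>\<^sub>F y in nhds x0. g y \<noteq> 0 \<and> (\<forall>k. qpoch q (fst y * q / g y) k \<noteq> 0 \<and> norm (1 / qpoch q (fst y * q / g y) k) \<le> B)"
    if g: "g \<in> set coords" for g
  proof -
    have g0: "g x0 \<noteq> 0" "qpoch_inf q (fst x0 * q / g x0) \<noteq> 0"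
    proof -
      have "g x0 \<in> set (params x0)" unfolding params_def set_map using g by (rule imageI)
      then show "g x0 \<noteq> 0" "qpoch_inf q (fst x0 * q / g x0) \<noteq> 0" using nz Q by auto
    qed
    have gt: "(g \<longlongrightarrow> g x0) (nhds x0)" by (rule complex_diff_continuous[OF complex_diff_coord[OF g]])
    have "((\<lambda>y. fst y * q / g y) \<longlongrightarrow> fst x0 * q / g x0) (nhds x0)"
      by (intro tendsto_intros gt g0 filterlim_ident)
    from inverse_qpoch_locally_bounded[OF g0(2)] obtain B where
      "\<forall>\<^sub>F z in nhds (fst x0 * q / g x0). \<forall>k. qpoch q z k \<noteq> 0 \<and> norm (1 / qpoch q z k) \<le> B" by blast
    then have "\<forall>\<^sub>F y in nhds x0. \<forall>k. qpoch q (fst y * q / g y) k \<noteq> 0 \<and> norm (1 / qpoch q (fst y * q / g y) k) \<le> B"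
      using \<open>((\<lambda>y. fst y * q / g y) \<longlongrightarrow> fst x0 * q / g x0) (nhds x0)\<close> by (rule eventually_compose_filterlim)
    moreover have "\<forall>\<^sub>F y in nhds x0. g y \<noteq> 0" by (rule tendsto_imp_eventually_ne[OF gt g0(1)])
    ultimately have "\<forall>\<^sub>F y in nhds x0. g y \<noteq> 0 \<and>
        (\<forall>k. qpoch q (fst y * q / g y) k \<noteq> 0 \<and> norm (1 / qpoch q (fst y * q / g y) k) \<le> B)"
      by eventually_elim simp
    then show ?thesis by blast
  qed
  then have "\<forall>g\<in>set coords. \<exists>B. \<forall>\<^sub>F y in nhds x0. g y \<noteq> 0 \<and>
     (\<forall>k. qpoch q (fst y * q / g y) k \<noteq> 0 \<and> norm (1 / qpoch q (fst y * q / g y) k) \<le> B)" ..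
  from bchoice[OF this] obtain B where "\<forall>g\<in>set coords. \<forall>\<^sub>F y in nhds x0. g y \<noteq> 0 \<and>
     (\<forall>k. qpoch q (fst y * q / g y) k \<noteq> 0 \<and> norm (1 / qpoch q (fst y * q / g y) k) \<le> B g)" ..
  then have B: "\<forall>\<^sub>F y in nhds x0. g y \<noteq> 0 \<and>
     (\<forall>k. qpoch q (fst y * q / g y) k \<noteq> 0 \<and> norm (1 / qpoch q (fst y * q / g y) k) \<le> B g)"
    if "g \<in> set coords" for g using that ..
  obtain B0 where B0: "\<And>k. norm (1 / qpoch q q k) \<le> B0"
    using inverse_qpoch_bounded[OF qpoch_inf_q_nonzero] by blast
  have "\<forall>\<^sub>F y in nhds x0. \<forall>g\<in>set coords. g y \<noteq> 0 \<and>
     (\<forall>k. qpoch q (fst y * q / g y) k \<noteq> 0 \<and> norm (1 / qpoch q (fst y * q / g y) k) \<le> B g)"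
    by (intro eventually_ball_finite ballI finite_set B)
  moreover have "\<forall>\<^sub>F y in nhds x0. \<forall>g\<in>set coords. \<forall>k. norm (qpoch q (g y) k) \<le> C g"
    by (intro eventually_ball_finite ballI finite_set numb complex_diff_coord)
  moreover have "\<forall>\<^sub>F y in nhds x0. \<forall>k. norm (qpoch q (fst y) k) \<le> C fst"
    by (intro numb complex_diff_coords)
  ultimately have "\<forall>\<^sub>F y in nhds x0. 0 \<notin> set (params y) \<and> (\<forall>u\<in>set (params y). qpoch_inf q (fst y * q / u) \<noteq> 0)
     \<and> (\<forall>k. norm (wp_term q (fst y) (params y) k) \<le> C fst * B0 * prod_list (map (\<lambda>g. C g * B g) coords))"
  proof eventually_elim
    case (elim y)
    have "0 \<notin> set (params y)" using elim(1) unfolding params_def set_map by auto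
    moreover have "\<forall>u\<in>set (params y). qpoch_inf q (fst y * q / u) \<noteq> 0"
      using elim(1) unfolding params_def set_map by (auto intro!: qpoch_inf_nonzeroI)
    moreover have "norm (wp_term q (fst y) (params y) k) \<le> C fst * B0 * prod_list (map (\<lambda>g. C g * B g) coords)" for k
    proof -
      have "norm (qpoch q (fst y) k / qpoch q q k) = norm (qpoch q (fst y) k) * norm (1 / qpoch q q k)"
        by (simp add: norm_divide)
      also have "\<dots> \<le> C fst * B0" using elim(3) by (intro mult_mono B0) (auto simp: C_def)
      finally have 1: "norm (qpoch q (fst y) k / qpoch q q k) \<le> C fst * B0" .
      have pr: "norm (wp_pair q (fst y) (g y) k) \<le> C g * B g" if "g \<in> set coords" for g
      proof -
        have "norm (wp_pair q (fst y) (g y) k) = norm (qpoch q (g y) k) * norm (1 / qpoch q (fst y * q / g y) k)"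
          by (simp add: wp_pair_def norm_divide)
        also have "\<dots> \<le> C g * B g" using elim(1,2) that by (intro mult_mono) (auto simp: C_def)
        finally show ?thesis .
      qed
      have 2: "norm (prod_list (map (\<lambda>g. wp_pair q (fst y) (g y) k) coords)) \<le> prod_list (map (\<lambda>g. C g * B g) coords)"
        by (rule norm_prod_list_le) (rule pr)
      have "norm (wp_term q (fst y) (params y) k) = norm (qpoch q (fst y) k / qpoch q q k) * norm (prod_list (map (\<lambda>g. wp_pair q (fst y) (g y) k) coords))"
        by (simp only: wp_term_def params_def list.map_comp o_def norm_mult)
      also have "\<dots> \<le> C fst * B0 * prod_list (map (\<lambda>g. C g * B g) coords)"
        by (rule mult_mono[OF 1 2]) (use 1 norm_ge_zero order_trans in blast)+
      finally show ?thesis .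
    qed
    ultimately show ?case by blast
  qed
  then show ?thesis by blast
qed

lemma complex_diff_wp_term:
  assumes nz: "0 \<notin> set (params x)"
    and Q: "\<And>u. u \<in> set (params x) \<Longrightarrow> qpoch_inf q (fst x * q / u) \<noteq> 0"
  shows "complex_diff (\<lambda>y. wp_term q (fst y) (params y) k) x"
proof -
  have nz: "g x \<noteq> 0" "qpoch q (fst x * q / g x) k \<noteq> 0" if "g \<in> set coords" for g
  proof -
    have "g x \<in> set (params x)" unfolding params_def set_map using that by (rule imageI)
    then show "g x \<noteq> 0" "qpoch q (fst x * q / g x) k \<noteq> 0" using nz qpoch_nonzero[OF Q] by auto
  qed
  have eq: "wp_term q (fst y) (params y) k = qpoch q (fst y) k / qpoch q q k *
     prod_list (map (\<lambda>g. qpoch q (g y) k / qpoch q (fst y * q / g y) k) coords)" for y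
    by (simp only: wp_term_def params_def list.map_comp o_def wp_pair_def)
  show ?thesis
    unfolding eq
    by (intro complex_diff_intros) (use nz qpoch_nonzero[OF qpoch_inf_q_nonzero] complex_diff_coord in auto)
qed

lemma complex_diff_wp_series:
  assumes nz: "0 \<notin> set (params x)"
    and Q: "\<And>u. u \<in> set (params x) \<Longrightarrow> qpoch_inf q (fst x * q / u) \<noteq> 0"
    and z: "norm (W8_7_arg q x * q ^ j) < 1"
  shows "complex_diff (\<lambda>y. wp_series q (fst y) (params y) (W8_7_arg q y) j) x"
proof -
  obtain \<rho> where \<rho>: "norm (W8_7_arg q x * q ^ j) < \<rho>" "\<rho> < 1" using dense[OF z] by blast
  then have \<rho>0: "0 \<le> \<rho>" by (meson norm_ge_zero order_trans less_imp_le)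
  have cd: "complex_diff (\<lambda>y. W8_7_arg q y * q ^ j) y" if "0 \<notin> set (params y)" for y
    by (intro complex_diff_intros complex_diff_W8_7_arg that)
  obtain B where B: "\<forall>\<^sub>F y in nhds x. 0 \<notin> set (params y) \<and> (\<forall>u\<in>set (params y). qpoch_inf q (fst y * q / u) \<noteq> 0)
     \<and> (\<forall>k. norm (wp_term q (fst y) (params y) k) \<le> B)"
    using locally_bounded_terms[OF nz Q] by blast
  moreover have "\<forall>\<^sub>F y in nhds x. norm (W8_7_arg q y * q ^ j) < \<rho>"
    by (rule order_tendstoD(2)[OF tendsto_norm[OF complex_diff_continuous[OF cd[OF nz]]] \<rho>(1)])
  ultimately have "\<forall>\<^sub>F y in nhds x. \<forall>k. complex_diff (\<lambda>y. wp_term q (fst y) (params y) k * (W8_7_arg q y * q ^ j) ^ k) y \<and>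
      norm (wp_term q (fst y) (params y) k * (W8_7_arg q y * q ^ j) ^ k) \<le> B * \<rho> ^ k"
  proof eventually_elim
    case (elim y)
    show ?case
    proof (intro allI conjI)
      fix k
      show "complex_diff (\<lambda>y. wp_term q (fst y) (params y) k * (W8_7_arg q y * q ^ j) ^ k) y"
        using elim(1) by (intro complex_diff_mult complex_diff_power complex_diff_wp_term cd) auto
      show "norm (wp_term q (fst y) (params y) k * (W8_7_arg q y * q ^ j) ^ k) \<le> B * \<rho> ^ k"
        unfolding norm_mult[of "wp_term q (fst y) (params y) k"] norm_power[of _ k] using elim
        by (intro mult_mono power_mono) (auto intro: order_trans[OF norm_ge_zero])
    qed
  qed
  then show ?thesis
    unfolding wp_series_def
    by (rule complex_diff_series) (use \<rho> \<rho>0 in \<open>auto intro!: summable_mult summable_geometric\<close>)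
qed

lemma complex_diff_wp_cont:
  assumes nz: "0 \<notin> set (params x)"
    and Q: "\<And>u. u \<in> set (params x) \<Longrightarrow> qpoch_inf q (fst x * q / u) \<noteq> 0"
    and J: "norm (W8_7_arg q x * q ^ J) < 1" and z: "\<And>j. W8_7_arg q x * q ^ j \<noteq> 1"
  shows "complex_diff (\<lambda>y. wp_cont q (fst y) (params y) (W8_7_arg q y) J j) x"
proof (induction "J - j" arbitrary: j rule: less_induct)
  case less
  have len: "length (params y) = 5" for y by (simp add: params_def coords_def)
  show ?case
  proof (cases "J \<le> j")
    case True
    then show ?thesis
      using complex_diff_wp_series[OF nz Q norm_z_q_power_less[OF J True]] by (simp add: wp_cont.simps)
  next
    case False
    have arg: "complex_diff (\<lambda>y. W8_7_arg q y * q ^ j) x"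
      by (intro complex_diff_intros complex_diff_W8_7_arg nz)
    have eq: "wp_cont q (fst y) (params y) (W8_7_arg q y) J j =
      (\<Sum>m\<in>{1..6}. coeff (ladder_poly (fst y) (params y) (W8_7_arg q y * q ^ j)) m
          * wp_cont q (fst y) (params y) (W8_7_arg q y) J (j + m)) / (1 - W8_7_arg q y * q ^ j)" for y
      using False by (subst wp_cont.simps) (simp add: len)
    have IH: "complex_diff (\<lambda>y. wp_cont q (fst y) (params y) (W8_7_arg q y) J (j + m)) x" if "m \<in> {1..6}" for m
      using False that by (intro less) auto
    show ?thesis
      unfolding eq
      by (intro complex_diff_divide complex_diff_sum complex_diff_mult complex_diff_ladder_poly complex_diff_diff
            complex_diff_const nz arg IH) (use z in auto)
  qed
qed

lemma W8_7_continuation_wp_W: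
  "W8_7_continuation q (\<lambda>x. wp_W q (fst x) (params x) (W8_7_arg q x))"
  unfolding W8_7_continuation_def
proof (intro conjI allI impI holomorphic6_onI)
  fix x assume "x \<in> {x. W8_7_nonsing q x}"
  then have ns: "fst x \<noteq> 0" "0 \<notin> set (params x)" "fst x \<noteq> 1"
      "\<And>u. u \<in> set (params x) \<Longrightarrow> qpoch_inf q (fst x * q / u) \<noteq> 0" "\<And>k. W8_7_arg q x * q ^ k \<noteq> 1"
    by (auto simp: W8_7_nonsing_eq)
  obtain J where J: "norm (W8_7_arg q x * q ^ J) < 1" using exists_small_power by blast
  have arg: "complex_diff (\<lambda>y. W8_7_arg q y * q ^ j) x" for j
    by (intro complex_diff_intros complex_diff_W8_7_arg ns)
  note cont = arg[THEN complex_diff_continuous]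
  have cd: "complex_diff (\<lambda>y. (wp_cont q (fst y) (params y) (W8_7_arg q y) J 0
      - fst y * wp_cont q (fst y) (params y) (W8_7_arg q y) J 2) / (1 - fst y)) x"
    by (intro complex_diff_intros complex_diff_wp_cont ns J) (use ns in auto)
  have 1: "\<forall>\<^sub>F y in nhds x. \<forall>u\<in>set (params y). qpoch_inf q (fst y * q / u) \<noteq> 0"
    using locally_bounded_terms[OF ns(2,4)] by (auto elim: eventually_mono)
  have 2: "\<forall>\<^sub>F y in nhds x. norm (W8_7_arg q y * q ^ J) < 1"
    by (rule order_tendstoD(2)[OF tendsto_norm[OF cont] J])
  \<comment> \<open>From index \<open>J\<close> on the modulus is below 1, so only finitely many
    poles must be avoided near x.\<close>
  have 3: "\<forall>\<^sub>F y in nhds x. \<forall>j\<in>{..<J}. W8_7_arg q y * q ^ j \<noteq> 1"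
    using tendsto_imp_eventually_ne[OF cont ns(5)] by (intro eventually_ball_finite) auto
  show "complex_diff (\<lambda>x. wp_W q (fst x) (params x) (W8_7_arg q x)) x"
  \<comment> \<open>The least index inside \<open>wp_W\<close> may jump between neighbouring points;
    with the cutoff \<open>J\<close> of x held fixed the expression is differentiable and has the
    same values.\<close>
  proof (rule complex_diff_cong[OF cd])
    from 1 2 3 show "\<forall>\<^sub>F y in nhds x. wp_W q (fst y) (params y) (W8_7_arg q y) =
      (wp_cont q (fst y) (params y) (W8_7_arg q y) J 0 - fst y * wp_cont q (fst y) (params y) (W8_7_arg q y) J 2) / (1 - fst y)"
    proof eventually_elim
      case (elim y)
      have "W8_7_arg q y * q ^ j \<noteq> 1" for j
      proof (cases "j < J")
        case False
        then have "norm (W8_7_arg q y * q ^ j) < 1" by (intro norm_z_q_power_less[OF elim(2)]) simp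
        then show ?thesis by (metis norm_one less_irrefl)
      qed (use elim(3) in auto)
      then show ?case using elim(1,2) by (intro wp_W_eq) auto
    qed
  qed
next
  fix x assume x: "W8_7_nonsing q x \<and> norm (W8_7_arg q x) < 1"
  then have Q: "\<And>u. u \<in> set (params x) \<Longrightarrow> qpoch_inf q (fst x * q / u) \<noteq> 0" by (auto simp: W8_7_nonsing_eq)
  show "wp_W q (fst x) (params x) (W8_7_arg q x) = W8_7_series q x"
    using wp_W_eq_series[where us = "params x" and a = "fst x" and z = "W8_7_arg q x", OF Q] x
    by (cases x) (simp add: W8_7_series_def params_tuple)
qed

section \<open>Uniqueness of the continuation\<close>

lemma complement_of_null_sequences:
  fixes x y :: complex
  defines "K \<equiv> insert 0 (range (\<lambda>j. x * q ^ j) \<union> range (\<lambda>j. y * q ^ j))"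
  shows "open (- K)" "connected (- K)" "bounded K"
proof -
  have lim: "(\<lambda>j. u * q ^ j) \<longlonglongrightarrow> 0" for u
    using tendsto_mult[OF tendsto_const[of u] q_power_tendsto_0] by simp
  have "K = insert 0 (range (\<lambda>j. x * q ^ j)) \<union> insert 0 (range (\<lambda>j. y * q ^ j))"
    by (auto simp: K_def)
  then have "compact K"
    using compact_sequence_with_limit[OF lim] by (metis compact_Un)
  then show "open (- K)" "bounded K"
    using compact_imp_closed compact_imp_bounded by (auto simp: open_Compl)
  have "countable K" by (simp add: K_def)
  then show "connected (- K)"
    by (intro path_connected_imp_connected path_connected_complement_countable) simp_all
qed

text \<open>The identity theorem in one variable suffices. With f t in place of f the argument
  becomes z / t, so large t lies in the region of convergence, and the possible singular values of t
  are 0 and two sequences tending to 0, whose complement is connected.\<close>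

lemma W8_7_continuation_unique:
  assumes F: "W8_7_continuation q F" and G: "W8_7_continuation q G"
    and x: "W8_7_nonsing q x"
  shows "F x = G x"
proof -
  obtain a b c d e f where xt: "x = (a, b, c, d, e, f)" by (cases x)
  define z where "z = W8_7_arg q x"
  define \<gamma> where "\<gamma> = (\<lambda>t. (a, b, c, d, e, f * t) :: complex6)"
  have \<gamma>1: "\<gamma> 1 = x" by (simp add: \<gamma>_def xt)
  have f: "f \<noteq> 0" using x by (auto simp: W8_7_nonsing_def xt)
  have arg: "W8_7_arg q (\<gamma> t) = z / t" for t by (simp add: W8_7_arg_def \<gamma>_def z_def xt)
  define K where "K = insert 0 (range (\<lambda>j. (a * q / f) * q ^ j) \<union> range (\<lambda>j. z * q ^ j))"
  have K: "open (- K)" "connected (- K)" "bounded K"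
    unfolding K_def by (rule complement_of_null_sequences)+
  have ns: "W8_7_nonsing q (\<gamma> t)" if t: "t \<in> - K" for t
  proof -
    have t0: "t \<noteq> 0" using t by (auto simp: K_def)
    have "qpoch_inf q (a * q / (f * t)) \<noteq> 0"
    proof (subst qpoch_inf_nonzero_iff, intro allI notI)
      fix j assume "a * q / (f * t) * q ^ j = 1"
      then have "t = (a * q / f) * q ^ j" using t0 f by (simp add: field_simps)
      then show False using t by (auto simp: K_def)
    qed
    moreover have "z / t * q ^ k \<noteq> 1" for k
    proof
      assume "z / t * q ^ k = 1"
      then have "t = z * q ^ k" using t0 by (simp add: field_simps)
      then show False using t by (auto simp: K_def)
    qed
    ultimately show ?thesis
      using x t0 by (auto simp: W8_7_nonsing_def vwp_nonsing_iff arg xt) (auto simp: \<gamma>_def vwp_nonsing_iff arg[unfolded \<gamma>_def])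
  qed
  have hol: "(\<lambda>t. F (\<gamma> t)) holomorphic_on - K" if F: "W8_7_continuation q F" for F
  proof (rule holomorphic_onI)
    fix t assume t: "t \<in> - K"
    from F ns[OF t] obtain A1 A2 A3 A4 A5 A6 where A: "(F has_derivative
          (\<lambda>(u1, u2, u3, u4, u5, u6). A1*u1 + A2*u2 + A3*u3 + A4*u4 + A5*u5 + A6*u6)) (at (\<gamma> t))"
      unfolding W8_7_continuation_def holomorphic6_on_def by blast
    have "(\<gamma> has_derivative (\<lambda>h. (0, 0, 0, 0, 0, f * h))) (at t)"
      unfolding \<gamma>_def by (auto intro!: derivative_eq_intros)
    from has_derivative_compose[OF this A]
    have "((\<lambda>t. F (\<gamma> t)) has_derivative (\<lambda>h. A6 * f * h)) (at t)" by (simp add: mult.assoc)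
    then have "((\<lambda>t. F (\<gamma> t)) has_field_derivative (A6 * f)) (at t)"
      by (simp add: has_field_derivative_def)
    then show "(\<lambda>t. F (\<gamma> t)) field_differentiable at t within - K"
      by (metis field_differentiable_at_within field_differentiable_def)
  qed
  define U where "U = {t. norm z < norm t} \<inter> - K"
  have "open {t::complex. norm z < norm t}" by (intro open_Collect_less continuous_intros)
  then have "open U" unfolding U_def using K by (intro open_Int)
  moreover have "U \<noteq> {}"
  proof -
    obtain R where R: "\<And>t. t \<in> K \<Longrightarrow> norm t \<le> R" using K(3) by (auto simp: bounded_iff)
    define t where "t = complex_of_real (max R (norm z) + 1)"
    have "norm t \<ge> max R (norm z) + 1" unfolding t_def norm_of_real by (rule abs_ge_self)
    then have "t \<in> U" using R[of t] by (auto simp: U_def)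
    then show ?thesis by blast
  qed
  moreover have "F (\<gamma> t) = G (\<gamma> t)" if "t \<in> U" for t
  proof -
    have "norm (W8_7_arg q (\<gamma> t)) < 1" "t \<in> - K"
      using that by (auto simp: U_def arg norm_divide divide_less_eq_1 K_def)
    then show ?thesis
      using F G ns[of t] unfolding W8_7_continuation_def by metis
  qed
  moreover have "1 \<in> - K"
  proof -
    have "qpoch_inf q (a * q / f) \<noteq> 0" "z * q ^ k \<noteq> 1" for k
      using x by (auto simp: W8_7_nonsing_def vwp_nonsing_iff xt z_def)
    then show ?thesis unfolding qpoch_inf_nonzero_iff K_def by (auto simp: eq_commute[of 1])
  qed
  ultimately have "F (\<gamma> 1) = G (\<gamma> 1)"
    using analytic_continuation_open[of U "- K" "\<lambda>t. F (\<gamma> t)" "\<lambda>t. G (\<gamma> t)" 1] K hol F G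
    by (auto simp: U_def)
  then show ?thesis by (simp add: \<gamma>1)
qed

text \<open>Uniqueness identifies the arbitrary choice in \<open>W8_7\<close> with the explicit
  continuation; inside the disc of convergence both are the series.\<close>

lemma W8_7_eq:
  assumes "W8_7_nonsing q (a, b, c, d, e, f)"
  shows "W8_7 q (a, b, c, d, e, f) = wp_W q a [b, c, d, e, f] (a\<^sup>2 * q\<^sup>2 / (b * c * d * e * f))"
proof -
  let ?x = "(a, b, c, d, e, f)"
  let ?F = "\<lambda>x. wp_W q (fst x) (params x) (W8_7_arg q x)"
  have "W8_7 q ?x = ?F ?x"
  proof (cases "norm (W8_7_arg q ?x) < 1")
    case True
    then show ?thesis
      using W8_7_continuation_wp_W assms by (simp add: W8_7_def W8_7_continuation_def)
  next
    case False
    have "W8_7_continuation q (SOME F. W8_7_continuation q F)"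
      by (rule someI[of "W8_7_continuation q", OF W8_7_continuation_wp_W])
    from W8_7_continuation_unique[OF this W8_7_continuation_wp_W assms] show ?thesis
      using False by (simp add: W8_7_def)
  qed
  then show ?thesis by (simp add: params_tuple W8_7_arg_def)
qed

end

section \<open>The limits of the solutions\<close>

text \<open>Only the limiting relations lose the term of index 0. Dividing the deviations \<open>E n i - S i\<close> by
  \<open>1 + M n\<close>, with \<open>M n\<close> the sum of their norms, makes this term negligible for finite \<open>n\<close> as well.\<close>

lemma ladder_limit:
  fixes c :: "nat \<Rightarrow> nat \<Rightarrow> nat \<Rightarrow> complex" and c' :: "nat \<Rightarrow> nat \<Rightarrow> complex"
    and E :: "nat \<Rightarrow> nat \<Rightarrow> complex" and S :: "nat \<Rightarrow> complex"
  assumes c: "\<And>i m. (\<lambda>n. c n i m) \<longlonglongrightarrow> c' i m"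
    and c'0: "\<And>i. c' i 0 = 0" and c'1: "\<And>i. c' i 1 \<noteq> 0" and c0: "\<And>n. c n 0 0 = 0"
    and E: "\<And>n i. (\<Sum>m\<le>Suc d. c n i m * E n (i + m)) = 0"
    and S: "\<And>i. (\<Sum>m\<le>Suc d. c' i m * S (i + m)) = 0"
    and large: "\<And>i. i \<ge> J \<Longrightarrow> (\<lambda>n. E n i) \<longlonglongrightarrow> S i"
  shows "i \<ge> 1 \<Longrightarrow> (\<lambda>n. E n i) \<longlonglongrightarrow> S i"
proof -
  define M where "M = (\<lambda>n. \<Sum>i\<in>{1..<J}. norm (E n i - S i))"
  have M: "0 \<le> M n" for n by (simp add: M_def sum_nonneg)
  define \<theta> where "\<theta> = (\<lambda>i n. (E n i - S i) / of_real (1 + M n))"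
  have norm_\<theta>: "norm (\<theta> i n) = norm (E n i - S i) / (1 + M n)" for i n
    using M[of n] by (simp add: \<theta>_def norm_divide del: of_real_add)
  have bounded_\<theta>: "norm (\<theta> i n) \<le> norm (E n i - S i)" for i n
    unfolding norm_\<theta> using M[of n] by (simp add: divide_le_eq mult_le_cancel_left1)
  have \<theta>_large: "\<theta> i \<longlonglongrightarrow> 0" if "i \<ge> J" for i
    by (rule Lim_null_comparison[of _ "\<lambda>n. norm (E n i - S i)"])
      (use bounded_\<theta> large[OF that] in \<open>auto simp: tendsto_norm_zero LIM_zero\<close>)
  have le1: "norm (\<theta> i n) \<le> 1" if "1 \<le> i" "i < J" for i n
  proof -
    have "norm (E n i - S i) \<le> M n" unfolding M_def using that by (intro member_le_sum) auto
    then show ?thesis unfolding norm_\<theta> using M[of n] by (simp add: divide_le_eq)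
  qed
  have rel: "c n i 1 * \<theta> (Suc i) n = - (\<Sum>m\<le>Suc d. c n i m * S (i + m)) / of_real (1 + M n)
      - c n i 0 * \<theta> i n - (\<Sum>m\<in>{2..Suc d}. c n i m * \<theta> (i + m) n)" for n i
  proof -
    have split: "(\<Sum>m\<le>Suc d. g m) = g 0 + g 1 + (\<Sum>m\<in>{2..Suc d}. g m)" for g :: "nat \<Rightarrow> complex"
    proof -
      have "{..Suc d} = insert 0 (insert 1 {2..Suc d})" by auto
      then show ?thesis by (simp add: add.assoc)
    qed
    have "(\<Sum>m\<le>Suc d. c n i m * \<theta> (i + m) n) = (\<Sum>m\<le>Suc d. c n i m * (E n (i + m) - S (i + m))) / of_real (1 + M n)"
      by (simp only: \<theta>_def sum_divide_distrib times_divide_eq_right)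
    also have "\<dots> = - (\<Sum>m\<le>Suc d. c n i m * S (i + m)) / of_real (1 + M n)"
      using E[of n i] by (simp only: right_diff_distrib sum_subtractf) simp
    finally have "c n i 0 * \<theta> i n + c n i 1 * \<theta> (Suc i) n + (\<Sum>m\<in>{2..Suc d}. c n i m * \<theta> (i + m) n)
       = - (\<Sum>m\<le>Suc d. c n i m * S (i + m)) / of_real (1 + M n)"
      unfolding split[of "\<lambda>m. c n i m * \<theta> (i + m) n"] by simp
    moreover have "y = v - x - w" if "x + y + w = v" for x y w v :: complex
      using that by (auto simp: algebra_simps)
    ultimately show ?thesis by blast
  qed
  \<comment> \<open>Downwards in i: the coefficient of index 1 has a nonzero limit, the terms of
    higher index are already known to vanish, and the term of index 0 is a bounded factor times a
    vanishing coefficient.\<close>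
  have \<theta>_lim: "\<theta> (Suc i) \<longlonglongrightarrow> 0" for i
  proof (induction "J - i" arbitrary: i rule: less_induct)
    case less
    show ?case
    proof (cases "J \<le> Suc i")
      case False
      have 1: "(\<lambda>n. - (\<Sum>m\<le>Suc d. c n i m * S (i + m)) / of_real (1 + M n)) \<longlonglongrightarrow> 0"
      proof (rule Lim_null_comparison)
        have "(\<lambda>n. \<Sum>m\<le>Suc d. c n i m * S (i + m)) \<longlonglongrightarrow> (\<Sum>m\<le>Suc d. c' i m * S (i + m))"
          by (intro tendsto_intros c)
        then show "(\<lambda>n. norm (\<Sum>m\<le>Suc d. c n i m * S (i + m))) \<longlonglongrightarrow> 0"
          unfolding S by (rule tendsto_norm_zero)
        show "\<forall>\<^sub>F n in sequentially. norm (- (\<Sum>m\<le>Suc d. c n i m * S (i + m)) / of_real (1 + M n))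
            \<le> norm (\<Sum>m\<le>Suc d. c n i m * S (i + m))"
        proof (intro always_eventually allI)
          fix n
          have "x / (1 + M n) \<le> x" if "0 \<le> x" for x
            using that M[of n] by (simp add: divide_le_eq mult_le_cancel_left1)
          then show "norm (- (\<Sum>m\<le>Suc d. c n i m * S (i + m)) / of_real (1 + M n))
            \<le> norm (\<Sum>m\<le>Suc d. c n i m * S (i + m))"
            using M[of n] by (simp only: norm_divide norm_minus_cancel norm_of_real abs_of_nonneg) simp
        qed
      qed
      \<comment> \<open>\<open>le1\<close> bounds \<theta> only from index 1 on; at i = 0 the
        coefficient is exactly 0.\<close>
      have 2: "(\<lambda>n. c n i 0 * \<theta> i n) \<longlonglongrightarrow> 0"
      proof (cases "i = 0")
        case True
        then show ?thesis by (simp add: c0)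
      next
        case i: False
        show ?thesis
        proof (rule Lim_null_comparison)
          show "(\<lambda>n. norm (c n i 0)) \<longlonglongrightarrow> 0"
            using c[of i 0] unfolding c'0 by (rule tendsto_norm_zero)
          show "\<forall>\<^sub>F n in sequentially. norm (c n i 0 * \<theta> i n) \<le> norm (c n i 0)"
            using le1[of i] i False by (intro always_eventually allI) (auto simp: norm_mult intro: mult_left_le)
        qed
      qed
      have 3: "(\<lambda>n. \<Sum>m\<in>{2..Suc d}. c n i m * \<theta> (i + m) n) \<longlonglongrightarrow> (\<Sum>m\<in>{2..Suc d}. c' i m * 0)"
      proof (intro tendsto_sum tendsto_mult c)
        fix m assume m: "m \<in> {2..Suc d}"
        have "\<theta> (Suc (i + m - 1)) \<longlonglongrightarrow> 0" using m False by (intro less) auto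
        moreover have "Suc (i + m - 1) = i + m" using m by simp
        ultimately show "\<theta> (i + m) \<longlonglongrightarrow> 0" by simp
      qed
      have "(\<lambda>n. c n i 1 * \<theta> (Suc i) n) \<longlonglongrightarrow> 0 - 0 - (\<Sum>m\<in>{2..Suc d}. c' i m * 0)"
        unfolding rel by (intro tendsto_diff 1 2 3)
      then have "(\<lambda>n. c n i 1 * \<theta> (Suc i) n / c n i 1) \<longlonglongrightarrow> 0 / c' i 1"
        using c'1 by (intro tendsto_divide c) auto
      moreover have "\<forall>\<^sub>F n in sequentially. c n i 1 * \<theta> (Suc i) n / c n i 1 = \<theta> (Suc i) n"
        using tendsto_imp_eventually_ne[OF c[of i 1] c'1] by eventually_elim simp
      ultimately show ?thesis by (simp add: tendsto_cong)
    qed (use \<theta>_large in auto)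
  qed
  \<comment> \<open>The normalized norms add up to M / (1 + M); once this tends to 0, so does M, and
    with it the deviations themselves.\<close>
  have "(\<lambda>n. \<Sum>i\<in>{1..<J}. norm (\<theta> i n)) \<longlonglongrightarrow> (\<Sum>i\<in>{1..<J}. 0)"
  proof (intro tendsto_sum tendsto_norm_zero)
    fix i assume "i \<in> {1..<J}"
    then show "\<theta> i \<longlonglongrightarrow> 0" using \<theta>_lim[of "i - 1"] by simp
  qed
  then have t: "(\<lambda>n. M n / (1 + M n)) \<longlonglongrightarrow> 0"
    unfolding norm_\<theta> by (simp add: M_def sum_divide_distrib)
  then have "(\<lambda>n. (M n / (1 + M n)) / (1 - M n / (1 + M n))) \<longlonglongrightarrow> 0 / (1 - 0)"
    by (intro tendsto_intros) auto
  moreover have "(M n / (1 + M n)) / (1 - M n / (1 + M n)) = M n" for n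
    using M[of n] by (simp add: divide_simps)
  ultimately have M0: "M \<longlonglongrightarrow> 0" by simp
  assume i: "i \<ge> 1"
  show "(\<lambda>n. E n i) \<longlonglongrightarrow> S i"
  proof (cases "i < J")
    case True
    have "(\<lambda>n. E n i - S i) \<longlonglongrightarrow> 0"
    proof (rule Lim_null_comparison[OF _ M0])
      show "\<forall>\<^sub>F n in sequentially. norm (E n i - S i) \<le> M n"
        unfolding M_def using True i by (intro always_eventually allI member_le_sum) auto
    qed
    then show ?thesis by (simp add: LIM_zero_iff)
  qed (use large in auto)
qed

lemma poly_monom_mult_expand:
  fixes x :: complex
  assumes "degree H \<le> d"
  shows "poly (monom 1 i * H) x = (\<Sum>m\<le>d. coeff H m * poly (monom 1 (i + m)) x)"
  by (simp add: poly_monom poly_sum_atMost[OF assms] sum_distrib_left power_add mult_ac)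

context q_base
begin

text \<open>Telescoping with the weight V x^i. For i > 0 the boundary term at infinity dies with
  x^i; for i = 0 it is the limit of V.\<close>

lemma suminf_ladder:
  fixes V x :: "nat \<Rightarrow> complex"
  assumes V: "V \<longlonglongrightarrow> L" and x: "\<And>k. x k = y * q ^ k"
    and rat: "\<And>k. V (Suc k) * poly D (x (Suc k)) = V k * poly N (x k)" and D0: "poly D (x 0) = 0"
    and c: "coeff D 0 = 1"
  shows "(\<Sum>k. V k * poly (monom 1 i * (smult (q ^ i) N - D)) (x k)) = (if i = 0 then L else 0)"
proof -
  have x0: "x \<longlonglongrightarrow> 0"
    unfolding x using tendsto_mult[OF tendsto_const[of y] q_power_tendsto_0] by simp
  define W where "W = (\<lambda>k. V k * x k ^ i)"
  have "W (Suc k) * poly D (x (Suc k)) = W k * (q ^ i * poly N (x k))" for k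
  proof -
    have "W (Suc k) * poly D (x (Suc k)) = x (Suc k) ^ i * (V (Suc k) * poly D (x (Suc k)))"
      by (simp only: W_def mult_ac)
    also have "x (Suc k) ^ i = x k ^ i * q ^ i" by (simp add: x power_mult_distrib mult_ac)
    finally show ?thesis unfolding rat by (simp only: W_def mult_ac)
  qed
  from lattice_telescope[where V = W and D = "\<lambda>k. poly D (x k)" and N = "\<lambda>k. q ^ i * poly N (x k)", OF this]
  have tel: "(\<Sum>k<K. W k * (q ^ i * poly N (x k) - poly D (x k))) = W K * poly D (x K)" for K
    using D0 by simp
  have "(\<lambda>K. W K * poly D (x K)) \<longlonglongrightarrow> L * 0 ^ i * poly D 0"
    unfolding W_def by (intro tendsto_intros V x0)
  then have "(\<lambda>k. W k * (q ^ i * poly N (x k) - poly D (x k))) sums (L * 0 ^ i * poly D 0)"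
    unfolding sums_def tel .
  moreover have "W k * (q ^ i * poly N (x k) - poly D (x k)) = V k * poly (monom 1 i * (smult (q ^ i) N - D)) (x k)" for k
    by (simp add: W_def poly_monom mult_ac)
  ultimately show ?thesis
    using c by (simp add: sums_iff poly_0_coeff_0 power_0_left)
qed

text \<open>At i = 0 each lattice leaves the boundary term \<open>wp_limit\<close>; the difference
  of the lattices removes it.\<close>

lemma wp_pairing_ladder:
  assumes nz: "p \<noteq> 0" "a \<noteq> 0"
    and Q: "\<And>u. u \<in> set (p # rs) \<Longrightarrow> qpoch_inf q (a * q / u) \<noteq> 0"
    and Q': "\<And>u. u \<in> set (a # p # rs) \<Longrightarrow> qpoch_inf q (u * (p / a)) \<noteq> 0"
  shows "wp_pairing q a p rs (monom 1 i * (smult (q ^ i) (num_poly a (p # rs)) - den_poly a (p # rs))) = 0"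
proof -
  have 1: "(\<Sum>k. wp_term q a (p # rs) k * poly (monom 1 i * (smult (q ^ i) (num_poly a (p # rs)) - den_poly a (p # rs))) (q ^ k))
     = (if i = 0 then wp_limit q a (p # rs) else 0)"
  proof (rule suminf_ladder[where y = 1])
    show "wp_term q a (p # rs) \<longlonglongrightarrow> wp_limit q a (p # rs)" by (rule wp_term_tendsto[OF Q])
    show "wp_term q a (p # rs) (Suc k) * poly (den_poly a (p # rs)) (q ^ Suc k)
      = wp_term q a (p # rs) k * poly (num_poly a (p # rs)) (q ^ k)" for k
      by (rule wp_term_ratio[OF Q])
  qed (simp_all add: poly_den_poly)
  have 2: "(\<Sum>k. wp_weight q a (p # rs) (p / a * q ^ k) * poly (monom 1 i * (smult (q ^ i) (num_poly a (p # rs)) - den_poly a (p # rs))) (p / a * q ^ k))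
     = (if i = 0 then wp_limit q a (p # rs) else 0)"
  proof (rule suminf_ladder[where y = "p / a"])
    show "(\<lambda>k. wp_weight q a (p # rs) (p / a * q ^ k)) \<longlonglongrightarrow> wp_limit q a (p # rs)"
      by (rule wp_weight_tendsto)
    fix k
    have "wp_weight q a (p # rs) (p / a * q ^ k * q) * poly (den_poly a (p # rs)) (p / a * q ^ k * q)
      = wp_weight q a (p # rs) (p / a * q ^ k) * poly (num_poly a (p # rs)) (p / a * q ^ k)"
    proof (rule wp_weight_ratio)
      fix u assume "u \<in> set (a # p # rs)"
      from qpoch_inf_shift_nonzero[OF Q'[OF this], of k]
      show "qpoch_inf q (u * (p / a * q ^ k)) \<noteq> 0" by (simp only: mult.assoc not_False_eq_True)
    qed
    then show "wp_weight q a (p # rs) (p / a * q ^ Suc k) * poly (den_poly a (p # rs)) (p / a * q ^ Suc k)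
      = wp_weight q a (p # rs) (p / a * q ^ k) * poly (num_poly a (p # rs)) (p / a * q ^ k)"
      by (simp only: power_Suc2 mult.assoc)
  next
    show "poly (den_poly a (p # rs)) (p / a * q ^ 0) = 0" using nz by (simp add: poly_den_poly)
  qed simp_all
  show ?thesis unfolding wp_pairing_def 1 2 by simp
qed

end

lemma wp_term_Cons: "wp_term q a (u # us) k = wp_pair q a u k * wp_term q a us k"
  by (simp add: wp_term_def)

lemma wp_term_append: "wp_term q a (us @ [u]) k = wp_term q a us k * wp_pair q a u k"
  by (simp add: wp_term_def)

lemma tendsto_coeff_mult:
  fixes P R :: "nat \<Rightarrow> complex poly"
  assumes "\<And>m. (\<lambda>n. coeff (P n) m) \<longlonglongrightarrow> coeff P' m" "\<And>m. (\<lambda>n. coeff (R n) m) \<longlonglongrightarrow> coeff R' m"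
  shows "(\<lambda>n. coeff (P n * R n) m) \<longlonglongrightarrow> coeff (P' * R') m"
  unfolding coeff_mult by (intro tendsto_intros assms)

section \<open>Estimates uniform in the shift of the parameters\<close>

context q_base
begin

lemma qpoch_inf_norm_le: "norm (qpoch_inf q x) \<le> exp (norm x / (1 - norm q))"
  by (rule tendsto_upperbound[OF tendsto_norm[OF qpoch_tendsto]]) (auto intro: always_eventually qpoch_norm_le)

lemma qpoch_inf_norm_le_mono: "norm x \<le> B \<Longrightarrow> norm (qpoch_inf q x) \<le> exp (B / (1 - norm q))"
  using q_less by (intro order_trans[OF qpoch_inf_norm_le]) (auto intro!: divide_right_mono)

lemma qpoch_norm_le_mono: "norm x \<le> B \<Longrightarrow> norm (qpoch q x k) \<le> exp (B / (1 - norm q))"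
  using q_less by (intro order_trans[OF qpoch_norm_le]) (auto intro!: divide_right_mono)

lemma norm_mult_q_power_le: "norm (x * q ^ m) \<le> norm x"
  using q_less by (simp add: norm_mult norm_power mult_left_le power_le_one)

lemma inverse_qpoch_inf_shift_bounded:
  assumes "qpoch_inf q x \<noteq> 0"
  shows "\<exists>B. \<forall>m. norm (1 / qpoch_inf q (x * q ^ m)) \<le> B"
proof (intro exI allI)
  fix m
  have "1 / qpoch_inf q (x * q ^ m) = qpoch q x m * (1 / qpoch_inf q x)"
    using qpoch_inf_split[of x m] qpoch_nonzero[OF assms, of m] by simp
  also have "norm \<dots> \<le> exp (norm x / (1 - norm q)) * norm (1 / qpoch_inf q x)"
    unfolding norm_mult by (intro mult_right_mono qpoch_norm_le) simp
  finally show "norm (1 / qpoch_inf q (x * q ^ m)) \<le> exp (norm x / (1 - norm q)) * norm (1 / qpoch_inf q x)" .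
qed

text \<open>The quotient \<open>(1 - x q\<^sup>j) / (1 - y q\<^sup>j)\<close> is bounded over all integers \<open>j\<close>, having finite limits
  at both ends.\<close>

lemma qpoch_ratio_bounded:
  assumes "y \<noteq> 0"
  shows "\<exists>K\<ge>1. \<forall>n k. norm (qpoch q (x / q ^ n) k / qpoch q (y / q ^ n) k) \<le> K ^ k"
proof -
  have "(\<lambda>j. (1 - x * q ^ j) / (1 - y * q ^ j)) \<longlonglongrightarrow> (1 - x * 0) / (1 - y * 0)"
    by (intro tendsto_intros q_power_tendsto_0) auto
  then have "Bseq (\<lambda>j. (1 - x * q ^ j) / (1 - y * q ^ j))"
    by (intro convergent_imp_Bseq) (auto simp: convergent_def)
  then obtain K1 where K1: "\<And>j. norm ((1 - x * q ^ j) / (1 - y * q ^ j)) \<le> K1" by (auto simp: Bseq_def)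
  have "(\<lambda>j. (q ^ j - x) / (q ^ j - y)) \<longlonglongrightarrow> (0 - x) / (0 - y)"
    using assms by (intro tendsto_intros q_power_tendsto_0) auto
  then have "Bseq (\<lambda>j. (q ^ j - x) / (q ^ j - y))"
    by (intro convergent_imp_Bseq) (auto simp: convergent_def)
  then obtain K2 where K2: "\<And>j. norm ((q ^ j - x) / (q ^ j - y)) \<le> K2" by (auto simp: Bseq_def)
  define K where "K = max 1 (max K1 K2)"
  have fac: "norm ((1 - x / q ^ n * q ^ i) / (1 - y / q ^ n * q ^ i)) \<le> K" for n i
  proof (cases "n \<le> i")
    case True
    then have "u / q ^ n * q ^ i = u * q ^ (i - n)" for u by (simp add: power_diff)
    then show ?thesis using K1[of "i - n"] by (simp add: K_def)
  next
    case False
    then have "q ^ n = q ^ (n - i) * q ^ i" by (simp flip: power_add)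
    then have "1 - u / q ^ n * q ^ i = (q ^ (n - i) - u) / q ^ (n - i)" for u by (simp add: field_simps)
    then show ?thesis using K2[of "n - i"] by (simp add: K_def)
  qed
  have "norm (qpoch q (x / q ^ n) k / qpoch q (y / q ^ n) k) \<le> K ^ k" for n k
  proof -
    have "norm (qpoch q (x / q ^ n) k / qpoch q (y / q ^ n) k)
       = (\<Prod>i<k. norm ((1 - x / q ^ n * q ^ i) / (1 - y / q ^ n * q ^ i)))"
      by (simp only: qpoch_def prod_dividef[symmetric] prod_norm)
    also have "\<dots> \<le> (\<Prod>i<k. K)" by (intro prod_mono conjI norm_ge_zero fac)
    finally show ?thesis by simp
  qed
  then show ?thesis by (intro exI[of _ K]) (auto simp: K_def)
qed

lemma qpoch_ratio_tendsto:
  assumes "y \<noteq> 0"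
  shows "(\<lambda>n. qpoch q (x / q ^ n) k / qpoch q (y / q ^ n) k) \<longlonglongrightarrow> (x / y) ^ k"
proof -
  have eq: "qpoch q (x / q ^ n) k / qpoch q (y / q ^ n) k = (\<Prod>i<k. (q ^ n - x * q ^ i) / (q ^ n - y * q ^ i))" for n
  proof -
    have "1 - u / q ^ n * q ^ i = (q ^ n - u * q ^ i) / q ^ n" for u i by (simp add: field_simps)
    then show ?thesis by (simp add: qpoch_def prod_dividef)
  qed
  have "(\<lambda>n. \<Prod>i<k. (q ^ n - x * q ^ i) / (q ^ n - y * q ^ i)) \<longlonglongrightarrow> (\<Prod>i<k. (0 - x * q ^ i) / (0 - y * q ^ i))"
    using assms by (intro tendsto_intros q_power_tendsto_0) auto
  then show ?thesis unfolding eq by simp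
qed

end

text \<open>The family p q^n, r / q^n with constant product; p r / a is the argument of the limiting
  series. The conditions are stated at n = 0 and propagate to every n.\<close>

locale wp_family = q_base +
  fixes a p r :: complex and us :: "complex list"
  assumes nz: "a \<noteq> 0" "p \<noteq> 0" "r \<noteq> 0" "0 \<notin> set us" and a1: "a \<noteq> 1"
    and Qp: "qpoch_inf q p \<noteq> 0" and Qpa: "qpoch_inf q (p / a) \<noteq> 0" and Qap: "qpoch_inf q (a / p) \<noteq> 0"
    and Qar: "qpoch_inf q (a * q / r) \<noteq> 0" and Qpp: "qpoch_inf q (p\<^sup>2 / a) \<noteq> 0"
    and Qz: "qpoch_inf q (p * r / a) \<noteq> 0" and Qpr: "qpoch_inf q (p * q / r) \<noteq> 0"
    and Qus: "\<And>u. u \<in> set us \<Longrightarrow> qpoch_inf q (a * q / u) \<noteq> 0"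
    and Qups: "\<And>u. u \<in> set us \<Longrightarrow> qpoch_inf q (p * u / a) \<noteq> 0"
    and Qpus: "\<And>u. u \<in> set us \<Longrightarrow> qpoch_inf q (p * q / u) \<noteq> 0"
begin

abbreviation "z \<equiv> p * r / a"
abbreviation "\<pi> n \<equiv> p * q ^ n"
abbreviation "\<rho> n \<equiv> r / q ^ n"
abbreviation "\<tau> n \<equiv> wp_term q a (\<pi> n # us @ [\<rho> n])"
abbreviation "\<omega> n k \<equiv> wp_weight q a (\<pi> n # us @ [\<rho> n]) (\<pi> n / a * q ^ k)"
abbreviation "\<Phi> n \<equiv> Phi q a (\<pi> n) (us @ [\<rho> n])"

text \<open>For j >= n this is a factor of (a/p)_inf; for j < n inverting the equation gives p/a
  times a power of q, excluded by (p/a)_inf.\<close>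

lemma Qap_n: "qpoch_inf q (a / \<pi> n) \<noteq> 0"
proof (subst qpoch_inf_nonzero_iff, intro allI notI)
  fix j assume eq: "a / \<pi> n * q ^ j = 1"
  show False
  proof (cases "n \<le> j")
    case True
    then have "a / p * q ^ (j - n) = 1" using eq nz by (simp add: power_diff field_simps)
    then show False using Qap qpoch_inf_nonzero_iff by blast
  next
    case False
    then have "q ^ n = q ^ (n - j) * q ^ j" by (simp flip: power_add)
    then have "p / a * q ^ (n - j) = 1" using eq nz by (simp add: field_simps)
    then show False using Qpa qpoch_inf_nonzero_iff by blast
  qed
qed

lemma Qaqp_n: "qpoch_inf q (a * q / \<pi> n) \<noteq> 0"
  using qpoch_inf_shift_nonzero[OF Qap_n[of n], of 1] by simp

lemma z_rho: "\<pi> n * \<rho> n / a = z" "\<rho> n * (\<pi> n / a) = z"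
  by simp_all

lemma first_lattice_nonzero: "u \<in> set (\<pi> n # us @ [\<rho> n]) \<Longrightarrow> qpoch_inf q (a * q / u) \<noteq> 0"
  using Qaqp_n[of n] Qus qpoch_inf_shift_nonzero[OF Qar, of n] by auto

lemma second_lattice_nonzero:
  assumes "u \<in> set (a # \<pi> n # us @ [\<rho> n])"
  shows "qpoch_inf q (u * (\<pi> n / a)) \<noteq> 0"
proof -
  have "qpoch_inf q (a * (\<pi> n / a)) \<noteq> 0" using qpoch_inf_shift_nonzero[OF Qp, of n] nz by simp
  moreover have "qpoch_inf q (\<pi> n * (\<pi> n / a)) \<noteq> 0"
    using qpoch_inf_shift_nonzero[OF Qpp, of "n + n"] by (simp add: power2_eq_square power_add mult_ac)
  moreover have "qpoch_inf q (u * (\<pi> n / a)) \<noteq> 0" if "u \<in> set us" for u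
    using qpoch_inf_shift_nonzero[OF Qups[OF that], of n] by (simp add: mult_ac)
  moreover have "qpoch_inf q (\<rho> n * (\<pi> n / a)) \<noteq> 0" unfolding z_rho by (rule Qz)
  ultimately show ?thesis using assms by (auto simp del: times_divide_eq_left times_divide_eq_right)
qed

definition moment :: "nat \<Rightarrow> nat \<Rightarrow> complex" where
  "moment n i = wp_pairing q a (\<pi> n) (us @ [\<rho> n]) (monom 1 i)"

text \<open>The sums for the constant monomial need not converge, so the moment of index 0 may enter
  only with coefficient 0.\<close>

lemma wp_pairing_expand:
  assumes "degree H \<le> d" and "i > 0 \<or> coeff H 0 = 0"
  shows "wp_pairing q a (\<pi> n) (us @ [\<rho> n]) (monom 1 i * H) = (\<Sum>m\<le>d. coeff H m * moment n (i + m))"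
proof -
  have sm1: "summable (\<lambda>k. \<tau> n k * poly (monom 1 m) (q ^ k))" if "m > 0" for m
    by (rule summable_wp_term[OF first_lattice_nonzero]) (use that in \<open>auto simp: poly_monom\<close>)
  have sm2: "summable (\<lambda>k. \<omega> n k * poly (monom 1 m) (\<pi> n / a * q ^ k))" if "m > 0" for m
    by (rule summable_wp_weight) (use that in \<open>auto simp: poly_monom\<close>)
  have expand: "(\<Sum>k. V k * poly (monom 1 i * H) (x k)) = (\<Sum>m\<le>d. coeff H m * (\<Sum>k. V k * poly (monom 1 (i + m)) (x k)))"
    if sm: "\<And>m. m > 0 \<Longrightarrow> summable (\<lambda>k. V k * poly (monom 1 m) (x k))" for V x :: "nat \<Rightarrow> complex"
  proof -
    have "(\<lambda>k. \<Sum>m\<le>d. coeff H m * (V k * poly (monom 1 (i + m)) (x k))) sums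
        (\<Sum>m\<le>d. coeff H m * (\<Sum>k. V k * poly (monom 1 (i + m)) (x k)))"
    proof (rule sums_sum)
      fix m
      show "(\<lambda>k. coeff H m * (V k * poly (monom 1 (i + m)) (x k))) sums
          (coeff H m * (\<Sum>k. V k * poly (monom 1 (i + m)) (x k)))"
      proof (cases "i + m > 0")
        case True
        then show ?thesis by (intro sums_mult summable_sums sm)
      qed (use assms(2) in auto)
    qed
    moreover have "V k * poly (monom 1 i * H) (x k) = (\<Sum>m\<le>d. coeff H m * (V k * poly (monom 1 (i + m)) (x k)))" for k
      unfolding poly_monom_mult_expand[OF assms(1)] sum_distrib_left by (simp only: mult_ac)
    ultimately show ?thesis by (simp add: sums_iff)
  qed
  have 1: "(\<Sum>k. \<tau> n k * poly (monom 1 i * H) (q ^ k))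
      = (\<Sum>m\<le>d. coeff H m * (\<Sum>k. \<tau> n k * poly (monom 1 (i + m)) (q ^ k)))"
    by (rule expand) (rule sm1)
  have 2: "(\<Sum>k. \<omega> n k * poly (monom 1 i * H) (\<pi> n / a * q ^ k))
      = (\<Sum>m\<le>d. coeff H m * (\<Sum>k. \<omega> n k * poly (monom 1 (i + m)) (\<pi> n / a * q ^ k)))"
    by (rule expand) (rule sm2)
  show ?thesis
    by (simp only: wp_pairing_def moment_def 1 2 sum_subtractf right_diff_distrib)
qed

text \<open>The ladder polynomial times - p q^n / a. Without this factor the coefficients of 1 - r
  q^(-n) x and 1 - a x / (p q^n) are unbounded in n; with it they converge, to those of x times
  \<open>ladder_poly\<close> for the remaining parameters.\<close>

definition scaled_poly :: "nat \<Rightarrow> nat \<Rightarrow> complex poly" where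
  "scaled_poly n i = smult (z * q ^ i) (num_poly a us * [:1, - \<pi> n:] * [:- (q ^ n / r), 1:])
     - den_poly a us * [:- (\<pi> n / a), 1:] * [:1, - (a / r * q ^ n):]"

lemma scaled_poly_eq:
  "scaled_poly n i = smult (- (\<pi> n / a)) (smult (q ^ i) (num_poly a (\<pi> n # us @ [\<rho> n])) - den_poly a (\<pi> n # us @ [\<rho> n]))"
proof -
  have 1: "smult (z * q ^ i) (X * Y * [:- (q ^ n / r), 1:]) = smult (- (\<pi> n / a)) (smult (q ^ i) (X * Y * [:1, - \<rho> n:]))" for X Y
  proof -
    have "[:- (q ^ n / r), 1:] = smult (- (q ^ n / r)) [:1, - \<rho> n:]" using nz by simp
    moreover have "z * q ^ i * (- (q ^ n / r)) = - (\<pi> n / a) * q ^ i" using nz by simp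
    ultimately show ?thesis by (simp only: mult_smult_right smult_smult)
  qed
  have 2: "X * [:- (\<pi> n / a), 1:] * Y = smult (- (\<pi> n / a)) (X * [:1, - (a / \<pi> n):] * Y)" for X Y
  proof -
    have "[:- (\<pi> n / a), 1:] = smult (- (\<pi> n / a)) [:1, - (a / \<pi> n):]" using nz by simp
    then show ?thesis by (simp only: mult_smult_left mult_smult_right)
  qed
  have 3: "num_poly a (\<pi> n # us @ [\<rho> n]) = num_poly a us * [:1, - \<pi> n:] * [:1, - \<rho> n:]"
    by (simp only: num_poly_def list.map map_append prod_list.Cons prod_list.append prod_list.Nil mult_1_left mult_1_right mult_ac)
  have 4: "den_poly a (\<pi> n # us @ [\<rho> n]) = den_poly a us * [:1, - (a / \<pi> n):] * [:1, - (a / r * q ^ n):]"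
  proof -
    have "a / r * q ^ n = a / \<rho> n" by simp
    then show ?thesis
      by (simp only: den_poly_def list.map map_append prod_list.Cons prod_list.append prod_list.Nil mult_1_left mult_1_right mult_ac)
  qed
  show ?thesis unfolding scaled_poly_def 1 2 3 4 by (simp only: smult_diff_right)
qed

lemma degree_scaled_poly: "degree (scaled_poly n i) \<le> Suc (length us + 2)"
  unfolding scaled_poly_eq
  using degree_num_poly[of a "\<pi> n # us @ [\<rho> n]"] degree_den_poly[of a "\<pi> n # us @ [\<rho> n]"]
  by (intro order_trans[OF degree_smult_le] degree_diff_le) (auto intro: order_trans[OF degree_smult_le])

lemma coeff_scaled_poly_0: "coeff (scaled_poly n 0) 0 = 0"
  unfolding scaled_poly_eq by simp

lemma moment_ladder: "(\<Sum>m\<le>Suc (length us + 2). coeff (scaled_poly n i) m * moment n (i + m)) = 0"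
proof -
  have "wp_pairing q a (\<pi> n) (us @ [\<rho> n]) (monom 1 i * scaled_poly n i)
     = - (\<pi> n / a) * wp_pairing q a (\<pi> n) (us @ [\<rho> n])
        (monom 1 i * (smult (q ^ i) (num_poly a (\<pi> n # us @ [\<rho> n])) - den_poly a (\<pi> n # us @ [\<rho> n])))"
  proof -
    define G where "G = monom 1 i * (smult (q ^ i) (num_poly a (\<pi> n # us @ [\<rho> n])) - den_poly a (\<pi> n # us @ [\<rho> n]))"
    have G0: "poly G 0 = 0" by (simp add: G_def poly_monom power_0_left poly_num_poly poly_den_poly)
    have G: "monom 1 i * scaled_poly n i = smult (- (\<pi> n / a)) G"
      by (simp only: scaled_poly_eq G_def mult_smult_right)
    have l: "V * poly (smult c G) y = c * (V * poly G y)" for V c y by simp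
    show ?thesis
      unfolding wp_pairing_def G l G_def[symmetric]
      using suminf_mult[OF summable_wp_term[OF first_lattice_nonzero[of _ n] G0]] suminf_mult[OF summable_wp_weight[OF G0]]
      by (simp only: right_diff_distrib)
  qed
  also have "\<dots> = 0"
    by (subst wp_pairing_ladder) (use nz first_lattice_nonzero second_lattice_nonzero in auto)
  finally show ?thesis
    using wp_pairing_expand[OF degree_scaled_poly, of i n i n] coeff_scaled_poly_0[of n] by (cases "i = 0") auto
qed

lemma coeff_scaled_poly_tendsto:
  "(\<lambda>n. coeff (scaled_poly n i) m) \<longlonglongrightarrow> coeff (pCons 0 (ladder_poly a us (z * q ^ i))) m"
proof -
  have lin: "(\<lambda>n. coeff [:f n, g n:] m) \<longlonglongrightarrow> coeff [:f', g':] m" if "f \<longlonglongrightarrow> f'" "g \<longlonglongrightarrow> g'"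
    for f g :: "nat \<Rightarrow> complex" and f' g' m
    using that by (auto simp: coeff_pCons split: nat.split)
  have 0: "(\<lambda>n. c * q ^ n) \<longlonglongrightarrow> 0" for c
    using tendsto_mult[OF tendsto_const[of c] q_power_tendsto_0] by simp
  have m: "(\<lambda>n. - (c * q ^ n)) \<longlonglongrightarrow> 0" for c
    using tendsto_minus[OF 0[of c]] by simp
  have m2: "(\<lambda>n. - (\<pi> n / a)) \<longlonglongrightarrow> 0" "(\<lambda>n. - (q ^ n / r)) \<longlonglongrightarrow> 0"
    using m[of "p / a"] m[of "1 / r"] by simp_all
  have "(\<lambda>n. coeff (scaled_poly n i) m) \<longlonglongrightarrow>
      coeff (smult (z * q ^ i) (num_poly a us * [:1, 0:] * [:0, 1:]) - den_poly a us * [:0, 1:] * [:1, 0:]) m"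
    unfolding scaled_poly_def coeff_diff coeff_smult
    by (intro tendsto_intros tendsto_coeff_mult lin m m2)
  also have "smult (z * q ^ i) (num_poly a us * [:1, 0:] * [:0, 1:]) - den_poly a us * [:0, 1:] * [:1, 0:]
     = pCons 0 (ladder_poly a us (z * q ^ i))"
    by (simp add: ladder_poly_def)
  finally show ?thesis .
qed

text \<open>Tannery's theorem. The quotient with negative powers of q is bounded by K^k uniformly in
  n, so the domination asks for K |q|^i < 1/2; smaller i are left to
  \<open>ladder_limit\<close>.\<close>

lemma first_lattice_limit:
  "\<exists>J. \<forall>i\<ge>J. (\<lambda>n. \<Sum>k. \<tau> n k * poly (monom 1 i) (q ^ k))
     \<longlonglongrightarrow> (\<Sum>k. wp_term q a us k * (z / q * q ^ i) ^ k)"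
proof -
  obtain K where K: "K \<ge> 1" "\<And>n k. norm (qpoch q (r / q ^ n) k / qpoch q (a * q / p / q ^ n) k) \<le> K ^ k"
    using qpoch_ratio_bounded[of "a * q / p" r] nz by auto
  obtain B where B: "\<And>k. norm (wp_term q a us k) \<le> B" using wp_term_bounded[OF Qus] by blast
  obtain B2 where B2: "\<And>m k. norm (1 / qpoch q (a * q / r * q ^ m) k) \<le> B2"
    using inverse_qpoch_shift_bounded[OF Qar] by blast
  obtain J where J: "\<And>i. i \<ge> J \<Longrightarrow> K * norm q ^ i < 1 / 2" using q_power_small[of "1/2" K] by auto
  define C where "C = exp (norm p / (1 - norm q))"
  have eq: "\<tau> n k * poly (monom 1 i) (q ^ k) =
      wp_term q a us k * (qpoch q (p * q ^ n) k * (1 / qpoch q (a * q / r * q ^ n) k)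
        * (qpoch q (r / q ^ n) k / qpoch q (a * q / p / q ^ n) k)) * (q ^ i) ^ k" for n k i
  proof -
    have 1: "a * q / (r / q ^ n) = a * q / r * q ^ n" "a * q / (p * q ^ n) = a * q / p / q ^ n" by simp_all
    have 2: "(q ^ k) ^ i = (q ^ i) ^ k" by (simp flip: power_mult add: mult.commute)
    show ?thesis
      by (simp only: wp_term_Cons wp_term_append wp_pair_def 1 poly_monom 2) (simp add: mult_ac)
  qed
  have "(\<lambda>n. \<Sum>k. \<tau> n k * poly (monom 1 i) (q ^ k))
     \<longlonglongrightarrow> (\<Sum>k. wp_term q a us k * (z / q * q ^ i) ^ k)" if i: "i \<ge> J" for i
  proof -
    have "eventually (\<lambda>n. summable (\<lambda>k. norm (\<tau> n k * poly (monom 1 i) (q ^ k)))) sequentially \<and>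
      summable (\<lambda>k. norm (wp_term q a us k * (z / q * q ^ i) ^ k)) \<and>
      ((\<lambda>n. \<Sum>k. \<tau> n k * poly (monom 1 i) (q ^ k))
     \<longlonglongrightarrow> (\<Sum>k. wp_term q a us k * (z / q * q ^ i) ^ k))"
    proof (rule tannerys_theorem)
      fix k
      have p0: "(\<lambda>n. qpoch q (x * q ^ n) k) \<longlonglongrightarrow> 1" for x
      proof -
        have "(\<lambda>n. qpoch q (x * q ^ n) k) \<longlonglongrightarrow> qpoch q (x * 0) k"
          unfolding qpoch_def by (intro tendsto_intros q_power_tendsto_0)
        then show ?thesis by (simp add: qpoch_def)
      qed
      have "(\<lambda>n. wp_term q a us k * (qpoch q (p * q ^ n) k * (1 / qpoch q (a * q / r * q ^ n) k)
        * (qpoch q (r / q ^ n) k / qpoch q (a * q / p / q ^ n) k)) * (q ^ i) ^ k)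
        \<longlonglongrightarrow> wp_term q a us k * (1 * (1 / 1) * (r / (a * q / p)) ^ k) * (q ^ i) ^ k"
        using nz by (intro tendsto_intros p0 qpoch_ratio_tendsto) auto
      moreover have "wp_term q a us k * (1 * (1 / 1) * (r / (a * q / p)) ^ k) * (q ^ i) ^ k = wp_term q a us k * (z / q * q ^ i) ^ k"
        by (simp add: mult.assoc flip: power_mult_distrib) (simp add: mult_ac)
      ultimately show "(\<lambda>n. \<tau> n k * poly (monom 1 i) (q ^ k)) \<longlonglongrightarrow> wp_term q a us k * (z / q * q ^ i) ^ k"
        unfolding eq by (simp only:)
    next
      have "norm (\<tau> n k * poly (monom 1 i) (q ^ k)) \<le> B * (C * B2) * (1 / 2) ^ k" for n k
      proof -
        have C: "norm (qpoch q (p * q ^ n) k) \<le> C"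
          unfolding C_def by (rule qpoch_norm_le_mono[OF norm_mult_q_power_le])
        have B0: "0 \<le> B" "0 \<le> B2" "0 \<le> C"
          using order_trans[OF norm_ge_zero B] order_trans[OF norm_ge_zero B2] order_trans[OF norm_ge_zero C] by auto
        have "norm (\<tau> n k * poly (monom 1 i) (q ^ k)) =
          norm (wp_term q a us k) * (norm (qpoch q (p * q ^ n) k) * norm (1 / qpoch q (a * q / r * q ^ n) k)
          * norm (qpoch q (r / q ^ n) k / qpoch q (a * q / p / q ^ n) k)) * (norm q ^ i) ^ k"
          unfolding eq by (simp only: norm_mult norm_power)
        also have "\<dots> \<le> B * (C * B2 * K ^ k) * (norm q ^ i) ^ k"
          using K(1) B0 by (intro mult_mono B C B2 K(2)) (auto intro!: mult_nonneg_nonneg)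
        also have "\<dots> = B * (C * B2) * (K * norm q ^ i) ^ k" by (simp add: power_mult_distrib)
        also have "\<dots> \<le> B * (C * B2) * (1 / 2) ^ k"
          using J[OF i] K(1) B0 by (intro mult_left_mono power_mono) auto
        finally show ?thesis .
      qed
      then show "\<forall>\<^sub>F (k, n) in sequentially \<times>\<^sub>F sequentially.
          norm (\<tau> n k * poly (monom 1 i) (q ^ k)) \<le> B * (C * B2) * (1 / 2) ^ k"
        by (intro always_eventually) auto
      show "summable (\<lambda>k. B * (C * B2) * (1 / 2) ^ k)" by (intro summable_mult summable_geometric) simp
    qed simp
    then show ?thesis by blast
  qed
  then show ?thesis by blast
qed

text \<open>The first n factors of the products with negative powers of q cost at most K^n, and
  everything else is bounded. The monomial at p q^n q^k / a gains |q|^(i n), which wins once K |q|^i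
  < 1/2.\<close>

lemma second_lattice_limit:
  "\<exists>J. \<forall>i\<ge>J. (\<lambda>n. \<Sum>k. \<omega> n k * poly (monom 1 i) (\<pi> n / a * q ^ k)) \<longlonglongrightarrow> 0"
proof -
  define h where "h = (\<lambda>x::complex. exp (norm x / (1 - norm q)))"
  have h: "norm (qpoch_inf q (x * q ^ m)) \<le> h x" for x m
    unfolding h_def by (rule qpoch_inf_norm_le_mono[OF norm_mult_q_power_le])
  have h0: "0 \<le> h x" for x by (simp add: h_def)
  obtain g where g: "\<And>x m. qpoch_inf q x \<noteq> 0 \<Longrightarrow> norm (1 / qpoch_inf q (x * q ^ m)) \<le> g x"
    using inverse_qpoch_inf_shift_bounded by metis
  have g0: "0 \<le> g x" if "qpoch_inf q x \<noteq> 0" for x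
    using order_trans[OF norm_ge_zero g[OF that]] .
  obtain K where K: "K \<ge> 1" "\<And>n k. norm (qpoch q (r / q ^ n) k / qpoch q (a * q / p / q ^ n) k) \<le> K ^ k"
    using qpoch_ratio_bounded[of "a * q / p" r] nz by auto
  obtain J where J: "\<And>i. i \<ge> J \<Longrightarrow> K * norm q ^ i < 1 / 2" using q_power_small[of "1/2" K] by auto
  define c where "c = (\<lambda>u. norm (qpoch_inf q u / qpoch_inf q (a * q / u)) * (h (p * q / u) * g (p * u / a)))"
  define C0 where "C0 = norm (qpoch_inf q a / qpoch_inf q q) * (h (p * q / a) * g p)"
  define Cp where "Cp = h p * (h q * g (p\<^sup>2 / a))"
  define Cr where "Cr = norm (qpoch_inf q r / qpoch_inf q (a * q / p)) * g (a * q / r) * (h (p * q / r) * g z)"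
  have bound: "norm (\<omega> n k) \<le> C0 * (Cp * Cr * prod_list (map c us)) * K ^ n" for n k
  proof -
    define x where "x = \<pi> n / a * q ^ k"
    have e: "q * x = p * q / a * q ^ (n + k)" "a * x = p * q ^ (n + k)" "a * q * x / \<pi> n = q * q ^ k"
      "\<pi> n * x = p\<^sup>2 / a * q ^ (n + n + k)" "a * q * x / \<rho> n = p * q / r * q ^ (n + n + k)" "\<rho> n * x = z * q ^ k"
      using nz by (simp_all add: x_def power_add power2_eq_square)
    have eu: "a * q * x / u = p * q / u * q ^ (n + k)" "u * x = p * u / a * q ^ (n + k)" for u
      using nz by (simp_all add: x_def power_add)
    have W0: "norm (qpoch_inf q a / qpoch_inf q q * (qpoch_inf q (q * x) / qpoch_inf q (a * x))) \<le> C0"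
    proof -
      have "norm (qpoch_inf q a / qpoch_inf q q * (qpoch_inf q (q * x) / qpoch_inf q (a * x)))
        = norm (qpoch_inf q a / qpoch_inf q q) * (norm (qpoch_inf q (p * q / a * q ^ (n + k))) * norm (1 / qpoch_inf q (p * q ^ (n + k))))"
        unfolding e by (simp add: norm_mult norm_divide)
      also have "\<dots> \<le> C0" unfolding C0_def by (intro mult_mono h g Qp order_refl) (auto intro!: mult_nonneg_nonneg h0 g0 Qp)
      finally show ?thesis .
    qed
    have Wu: "norm (wp_pair_inf q a u x) \<le> c u" if "u \<in> set us" for u
    proof -
      have "norm (wp_pair_inf q a u x) = norm (qpoch_inf q u / qpoch_inf q (a * q / u)) *
        (norm (qpoch_inf q (p * q / u * q ^ (n + k))) * norm (1 / qpoch_inf q (p * u / a * q ^ (n + k))))"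
        unfolding wp_pair_inf_def eu[of u] by (simp add: norm_mult norm_divide)
      also have "\<dots> \<le> c u" unfolding c_def
        by (intro mult_mono h g Qups[OF that] order_refl) (auto intro!: mult_nonneg_nonneg h0 g0 Qups[OF that])
      finally show ?thesis .
    qed
    have Wus: "norm (prod_list (map (\<lambda>u. wp_pair_inf q a u x) us)) \<le> prod_list (map c us)"
      by (rule norm_prod_list_le) (rule Wu)
    have ratio: "qpoch_inf q (\<rho> n) / qpoch_inf q (a * q / \<pi> n) =
       (qpoch q (r / q ^ n) n / qpoch q (a * q / p / q ^ n) n) * (qpoch_inf q r / qpoch_inf q (a * q / p))"
      using qpoch_inf_split[of "\<rho> n" n] qpoch_inf_split[of "a * q / \<pi> n" n] by simp
    have pr: "wp_pair_inf q a (\<pi> n) x * wp_pair_inf q a (\<rho> n) x = (qpoch_inf q (p * q ^ n) * (qpoch_inf q (q * q ^ k) * (1 / qpoch_inf q (p\<^sup>2 / a * q ^ (n + n + k))))) *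
       ((qpoch_inf q r / qpoch_inf q (a * q / p)) * (1 / qpoch_inf q (a * q / r * q ^ n)) * (qpoch_inf q (p * q / r * q ^ (n + n + k)) * (1 / qpoch_inf q (z * q ^ k))))
       * (qpoch q (r / q ^ n) n / qpoch q (a * q / p / q ^ n) n)"
    proof -
      have ar: "a * q / \<rho> n = a * q / r * q ^ n" by simp
      have "wp_pair_inf q a (\<pi> n) x * wp_pair_inf q a (\<rho> n) x = (qpoch_inf q (\<rho> n) / qpoch_inf q (a * q / \<pi> n)) *
        (qpoch_inf q (p * q ^ n) * (qpoch_inf q (q * q ^ k) * (1 / qpoch_inf q (p\<^sup>2 / a * q ^ (n + n + k))))) *
        ((1 / qpoch_inf q (a * q / r * q ^ n)) * (qpoch_inf q (p * q / r * q ^ (n + n + k)) * (1 / qpoch_inf q (z * q ^ k))))"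
        unfolding wp_pair_inf_def e ar by (simp add: mult_ac)
      then show ?thesis unfolding ratio by (simp only: mult_ac)
    qed
    have W2: "norm (wp_pair_inf q a (\<pi> n) x * wp_pair_inf q a (\<rho> n) x) \<le> Cp * Cr * K ^ n"
      unfolding pr Cp_def Cr_def norm_mult
      by (intro mult_mono h g K(2) Qpp Qar Qz order_refl)
        (use K(1) in \<open>auto intro!: mult_nonneg_nonneg h0 g0 Qpp Qar Qz\<close>)
    have CC: "0 \<le> C0" "0 \<le> Cp" "0 \<le> Cr"
      unfolding C0_def Cp_def Cr_def by (auto intro!: mult_nonneg_nonneg h0 g0 Qpp Qar Qz Qp)
    have "norm (wp_weight q a (\<pi> n # us @ [\<rho> n]) x) = norm (qpoch_inf q a / qpoch_inf q q * (qpoch_inf q (q * x) / qpoch_inf q (a * x)))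
      * (norm (wp_pair_inf q a (\<pi> n) x * wp_pair_inf q a (\<rho> n) x) * norm (prod_list (map (\<lambda>u. wp_pair_inf q a u x) us)))"
      unfolding wp_weight_def norm_mult[symmetric] by (simp add: mult_ac)
    also have "\<dots> \<le> C0 * ((Cp * Cr * K ^ n) * prod_list (map c us))"
      using CC K(1) by (intro mult_mono W0 W2 Wus) (auto intro!: mult_nonneg_nonneg)
    finally show ?thesis unfolding x_def by (simp only: mult_ac)
  qed
  define C where "C = C0 * (Cp * Cr * prod_list (map c us))"
  have C0: "0 \<le> C" using order_trans[OF norm_ge_zero bound[of 0 0]] by (simp add: C_def)
  have "(\<lambda>n. \<Sum>k. \<omega> n k * poly (monom 1 i) (\<pi> n / a * q ^ k)) \<longlonglongrightarrow> 0"
    if i: "i \<ge> max J 1" for i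
  proof (rule Lim_null_comparison)
    define D where "D = C * norm (p / a) ^ i / (1 - norm q)"
    show "(\<lambda>n. D * (1 / 2) ^ n) \<longlonglongrightarrow> 0"
      using tendsto_mult[OF tendsto_const[of D] LIMSEQ_power_zero[of "1 / 2 :: real"]] by simp
    show "\<forall>\<^sub>F n in sequentially. norm (\<Sum>k. \<omega> n k * poly (monom 1 i) (\<pi> n / a * q ^ k)) \<le> D * (1 / 2) ^ n"
    proof (intro always_eventually allI)
      fix n
      have le: "norm (\<omega> n k * poly (monom 1 i) (\<pi> n / a * q ^ k))
        \<le> C * norm (p / a) ^ i * (1 / 2) ^ n * norm q ^ k" for k
      proof -
        have 1: "norm (poly (monom 1 i) (\<pi> n / a * q ^ k)) = norm (p / a) ^ i * (norm q ^ i) ^ n * (norm q ^ k) ^ i"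
          by (simp add: poly_monom norm_mult norm_divide norm_power power_mult_distrib power_divide flip: power_mult)
            (simp add: mult.commute)
        have 2: "(norm q ^ k) ^ i \<le> norm q ^ k"
          using i q_less by (intro power_le_one_iff[THEN iffD2] order_trans[OF power_decreasing[of 1 i]]) (auto intro: power_le_one)
        have "norm (\<omega> n k * poly (monom 1 i) (\<pi> n / a * q ^ k))
          \<le> (C * K ^ n) * (norm (p / a) ^ i * (norm q ^ i) ^ n * (norm q ^ k) ^ i)"
          unfolding norm_mult 1 using bound[of n k] by (intro mult_right_mono) (auto simp: C_def)
        also have "\<dots> = C * norm (p / a) ^ i * (K * norm q ^ i) ^ n * (norm q ^ k) ^ i"
          by (simp only: power_mult_distrib mult_ac)
        also have "\<dots> \<le> C * norm (p / a) ^ i * (1 / 2) ^ n * norm q ^ k"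
          using J[of i] i K(1) C0 2 by (intro mult_mono power_mono) (auto intro!: mult_nonneg_nonneg)
        finally show ?thesis .
      qed
      have sm: "summable (\<lambda>k. C * norm (p / a) ^ i * (1 / 2) ^ n * norm q ^ k)"
        using q_less by (intro summable_mult summable_geometric) simp
      have sm2: "summable (\<lambda>k. norm (\<omega> n k * poly (monom 1 i) (\<pi> n / a * q ^ k)))"
        by (rule summable_comparison_test'[OF sm, where N = 0]) (simp only: real_norm_def abs_norm_cancel le)
      have "norm (\<Sum>k. \<omega> n k * poly (monom 1 i) (\<pi> n / a * q ^ k))
        \<le> (\<Sum>k. C * norm (p / a) ^ i * (1 / 2) ^ n * norm q ^ k)"
        by (rule order_trans[OF summable_norm[OF sm2] suminf_le[OF le sm2 sm]])
      also have "\<dots> = D * (1 / 2) ^ n"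
        using q_less by (subst suminf_mult) (auto intro!: summable_geometric simp: suminf_geometric D_def)
      finally show "norm (\<Sum>k. \<omega> n k * poly (monom 1 i) (\<pi> n / a * q ^ k)) \<le> D * (1 / 2) ^ n" .
    qed
  qed
  then show ?thesis by blast
qed

lemma Phi_eq_pairing_n:
  "(1 - a) * \<Phi> n = wp_pairing q a (\<pi> n) (us @ [\<rho> n]) [:0, 1, 0, - a:]"
proof -
  have 0: "0 \<notin> set (us @ [\<rho> n])" "\<pi> n \<noteq> 0" using nz by auto
  show "(1 - a) * \<Phi> n = wp_pairing q a (\<pi> n) (us @ [\<rho> n]) [:0, 1, 0, - a:]"
  proof (rule Phi_eq_pairing[OF nz(1) 0(2,1) a1])
    show "qpoch_inf q (\<pi> n) \<noteq> 0" by (rule qpoch_inf_shift_nonzero[OF Qp])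
    show "qpoch_inf q (\<pi> n / a) \<noteq> 0" using qpoch_inf_shift_nonzero[OF Qpa, of n] by simp
    show "qpoch_inf q (a / \<pi> n) \<noteq> 0" by (rule Qap_n)
    show "qpoch_inf q ((\<pi> n)\<^sup>2 / a) \<noteq> 0"
      using qpoch_inf_shift_nonzero[OF Qpp, of "n + n"] by (simp add: power2_eq_square power_add mult_ac)
    show "qpoch_inf q (a * q / u) \<noteq> 0" if "u \<in> set (us @ [\<rho> n])" for u
      using first_lattice_nonzero[of u n] that by simp
    show "qpoch_inf q (\<pi> n * u / a) \<noteq> 0" if "u \<in> set (us @ [\<rho> n])" for u
      using second_lattice_nonzero[of u n] that by (simp add: mult.commute)
    show "qpoch_inf q (\<pi> n * q / u) \<noteq> 0" if u: "u \<in> set (us @ [\<rho> n])" for u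
    proof (cases "u = \<rho> n")
      case True
      then show ?thesis
        using qpoch_inf_shift_nonzero[OF Qpr, of "n + n"] by (simp add: power_add mult_ac)
    next
      case False
      then show ?thesis
        using qpoch_inf_shift_nonzero[OF Qpus[of u], of n] u by (simp add: mult_ac)
    qed
  qed
qed

lemma Phi_tendsto:
  assumes z: "\<And>j. z * q ^ j \<noteq> 1"
  shows "(\<lambda>n. \<Phi> n) \<longlonglongrightarrow> wp_W q a us z"
proof -
  obtain J0 where J0: "norm (z * q ^ J0) < 1" using exists_small_power by blast
  have z': "1 - z * q ^ j \<noteq> 0" for j using z[of j] by simp
  \<comment> \<open>Shifted by one because a moment of index i tends to a series with ratio z
    q^(i-1). The value at 0 is a placeholder that meets only the zero coefficient of
    \<open>pCons 0\<close>.\<close>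
  define S where "S = (\<lambda>i. if i = 0 then 0 else wp_cont q a us z J0 (i - 1))"
  obtain J1 where J1: "\<And>i. i \<ge> J1 \<Longrightarrow> (\<lambda>n. \<Sum>k. \<tau> n k * poly (monom 1 i) (q ^ k))
     \<longlonglongrightarrow> (\<Sum>k. wp_term q a us k * (z / q * q ^ i) ^ k)" using first_lattice_limit by blast
  obtain J2 where J2: "\<And>i. i \<ge> J2 \<Longrightarrow> (\<lambda>n. \<Sum>k. \<omega> n k * poly (monom 1 i) (\<pi> n / a * q ^ k)) \<longlonglongrightarrow> 0"
    using second_lattice_limit by blast
  have large: "(\<lambda>n. moment n i) \<longlonglongrightarrow> S i" if i: "i \<ge> max (max J1 J2) (Suc J0)" for i
  proof -
    have "(\<lambda>n. moment n i) \<longlonglongrightarrow> (\<Sum>k. wp_term q a us k * (z / q * q ^ i) ^ k) - 0"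
      unfolding moment_def wp_pairing_def using i by (intro tendsto_diff J1 J2) auto
    moreover have "z / q * q ^ i = z * q ^ (i - 1)" using i by (cases i) auto
    moreover have "J0 \<le> i - 1" "i \<noteq> 0" using i by auto
    ultimately show ?thesis by (simp add: S_def wp_cont.simps wp_series_def)
  qed
  have lim: "(\<lambda>n. moment n i) \<longlonglongrightarrow> S i" if "i \<ge> 1" for i
  proof (rule ladder_limit[where c = "\<lambda>n i m. coeff (scaled_poly n i) m" and d = "length us + 2"
        and c' = "\<lambda>i m. coeff (pCons 0 (ladder_poly a us (z * q ^ i))) m" and J = "max (max J1 J2) (Suc J0)"])
    show "(\<lambda>n. coeff (scaled_poly n i) m) \<longlonglongrightarrow> coeff (pCons 0 (ladder_poly a us (z * q ^ i))) m" for i m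
      by (rule coeff_scaled_poly_tendsto)
    show "coeff (pCons 0 (ladder_poly a us (z * q ^ i))) 1 \<noteq> 0" for i
      using z[of i] by (simp add: ladder_poly_def)
    show "(\<Sum>m\<le>Suc (length us + 2). coeff (scaled_poly n i) m * moment n (i + m)) = 0" for n i
      by (rule moment_ladder)
    show "(\<Sum>m\<le>Suc (length us + 2). coeff (pCons 0 (ladder_poly a us (z * q ^ i))) m * S (i + m)) = 0" for i
    proof -
      have "(\<Sum>m\<le>Suc (length us + 2). coeff (pCons 0 (ladder_poly a us (z * q ^ i))) m * S (i + m))
        = (\<Sum>m\<le>length us + 2. coeff (ladder_poly a us (z * q ^ i)) m * wp_cont q a us z J0 (i + m))"
        by (subst sum.atMost_Suc_shift) (simp add: S_def)
      also have "\<dots> = (\<Sum>m\<le>Suc (length us). coeff (ladder_poly a us (z * q ^ i)) m * wp_cont q a us z J0 (i + m))"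
        using degree_ladder_poly[of a us "z * q ^ i"] by (intro sum.mono_neutral_right) (auto simp: coeff_eq_0)
      also have "\<dots> = 0" by (rule wp_cont_ladder[OF Qus J0 z'])
      finally show ?thesis .
    qed
  qed (use large that coeff_scaled_poly_0 in auto)
  \<comment> \<open>From x - a x^3 = x (1 - a x^2): the moments 1 and 3 correspond to the members 0
    and 2 of the ladder in \<open>wp_W\<close>.\<close>
  have Phi: "\<Phi> n = (moment n 1 - a * moment n 3) / (1 - a)" for n
  proof -
    note Phi_eq_pairing_n
    also have "[:0, 1, 0, - a:] = monom 1 1 * [:1, 0, - a:]" by (simp add: monom_altdef)
    also have "wp_pairing q a (\<pi> n) (us @ [\<rho> n]) (monom 1 1 * [:1, 0, - a:]) = (\<Sum>m\<le>2. coeff [:1, 0, - a:] m * moment n (1 + m))"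
      by (rule wp_pairing_expand) auto
    also have "\<dots> = moment n 1 - a * moment n 3"
      by (simp add: eval_nat_numeral)
    finally show ?thesis using a1 by (simp add: field_simps)
  qed
  have "(\<lambda>n. (moment n 1 - a * moment n 3) / (1 - a)) \<longlonglongrightarrow> (S 1 - a * S 3) / (1 - a)"
    using a1 by (intro tendsto_intros lim) auto
  also have "(S 1 - a * S 3) / (1 - a) = wp_W q a us z"
    using wp_W_eq[OF Qus J0 z] by (simp add: S_def)
  finally show ?thesis unfolding Phi .
qed

end

section \<open>Summable convergence of functions of q^n\<close>

context q_base
begin

text \<open>The difference quotient at 0 along x = q^n is bounded, so the deviations are dominated
  by a geometric series.\<close>

lemma summable_of_differentiable:
  assumes "f field_differentiable at 0"
  shows "summable (\<lambda>n. norm (f (q ^ n) - f 0))"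
proof -
  obtain D where "(f has_field_derivative D) (at 0)"
    using assms field_differentiable_def by blast
  then have "((\<lambda>x. (f x - f 0) / x) \<longlongrightarrow> D) (at 0)"
    by (simp add: has_field_derivative_iff)
  moreover have "filterlim (\<lambda>n. q ^ n) (at 0) sequentially"
    using q_power_tendsto_0 by (auto simp: filterlim_at)
  ultimately have "(\<lambda>n. (f (q ^ n) - f 0) / q ^ n) \<longlonglongrightarrow> D"
    by (rule filterlim_compose)
  then have "Bseq (\<lambda>n. (f (q ^ n) - f 0) / q ^ n)"
    by (intro convergent_imp_Bseq) (auto simp: convergent_def)
  then obtain B where B: "\<And>n. norm ((f (q ^ n) - f 0) / q ^ n) \<le> B" by (auto simp: Bseq_def)
  show ?thesis
  proof (rule summable_comparison_test'[where N = 0])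
    show "summable (\<lambda>n. B * norm q ^ n)" using q_less by (intro summable_mult summable_geometric) simp
    show "norm (norm (f (q ^ n) - f 0)) \<le> B * norm q ^ n" for n
      using B[of n] by (simp add: norm_divide norm_power divide_le_eq)
  qed
qed

lemma summable_norm_add_diff:
  fixes f g :: "nat \<Rightarrow> complex"
  assumes "summable (\<lambda>n. norm (f n - x))" "summable (\<lambda>n. norm (g n - y))"
  shows "summable (\<lambda>n. norm ((f n + g n) - (x + y)))"
proof (rule summable_comparison_test'[OF summable_add[OF assms], where N = 0])
  fix n
  have "(f n + g n) - (x + y) = (f n - x) + (g n - y)" by simp
  then show "norm (norm ((f n + g n) - (x + y))) \<le> norm (f n - x) + norm (g n - y)"
    by (metis abs_norm_cancel norm_triangle_ineq real_norm_def)
qed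

lemma summable_norm_mult_diff:
  fixes f g :: "nat \<Rightarrow> complex"
  assumes f: "summable (\<lambda>n. norm (f n - 1))" and g: "summable (\<lambda>n. norm (g n - y))"
  shows "summable (\<lambda>n. norm (f n * g n - y))"
proof -
  have "(\<lambda>n. f n - 1) \<longlonglongrightarrow> 0" using summable_LIMSEQ_zero[OF f] by (rule tendsto_norm_zero_cancel)
  then have "f \<longlonglongrightarrow> 1" by (simp add: LIM_zero_iff)
  then have "Bseq f" by (intro convergent_imp_Bseq) (auto simp: convergent_def)
  then obtain K where K: "\<And>n. norm (f n) \<le> K" by (auto simp: Bseq_def)
  have sm: "summable (\<lambda>n. K * norm (g n - y) + norm (f n - 1) * norm y)"
    by (intro summable_add summable_mult summable_mult2 f g)
  show ?thesis
  proof (rule summable_comparison_test'[OF sm, where N = 0])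
    fix n
    have "f n * g n - y = f n * (g n - y) + (f n - 1) * y" by algebra
    then have "norm (f n * g n - y) \<le> norm (f n) * norm (g n - y) + norm (f n - 1) * norm y"
      by (metis norm_mult norm_triangle_ineq)
    also have "\<dots> \<le> K * norm (g n - y) + norm (f n - 1) * norm y"
      by (intro add_mono mult_right_mono K) auto
    finally show "norm (norm (f n * g n - y)) \<le> K * norm (g n - y) + norm (f n - 1) * norm y"
      by (simp only: real_norm_def abs_norm_cancel)
  qed
qed

end

text \<open>The recurrence is specific to five further parameters in balance, whereas the limits in
  \<open>wp_family\<close> come from the weight alone.\<close>

locale wp_family5 = wp_family q a p r "[b, c, d, e, f]" for q a p r b c d e f +
  assumes balanced: "b * c * d * e * f * p * r = a ^ 3 * q\<^sup>2"
    and Qqr: "qpoch_inf q (q / r) \<noteq> 0" and Qar': "qpoch_inf q (a / r) \<noteq> 0"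
    and Qarr: "qpoch_inf q (a * q\<^sup>2 / r\<^sup>2) \<noteq> 0" and Qpr': "qpoch_inf q (p / r) \<noteq> 0"
    and Qz': "qpoch_inf q (a * q / (p * r)) \<noteq> 0"
    and Qaur: "\<And>u. u \<in> {b, c, d, e, f} \<Longrightarrow> qpoch_inf q (a * q / (u * r)) \<noteq> 0"
begin

abbreviation "us \<equiv> [b, c, d, e, f]"
abbreviation "A n \<equiv> shift_up q a us (\<pi> n) (\<rho> n)"
abbreviation "B n \<equiv> shift_down q a us (\<pi> n) (\<rho> n)"
abbreviation "R n \<equiv> shift_rest q a us (\<pi> n) (\<rho> n)"

lemma q_shift_ne_1: "qpoch_inf q x \<noteq> 0 \<Longrightarrow> x * q ^ j \<noteq> 1"
  using qpoch_inf_nonzero_iff by blast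

lemma Phi_contiguous:
  "A (Suc n) * \<Phi> (Suc (Suc n))
    - (A (Suc n) + B (Suc n) + R (Suc n)) * \<Phi> (Suc n)
    + B (Suc n) * \<Phi> n = 0"
proof -
  define P where "P = \<pi> (Suc n)"
  define T where "T = \<rho> (Suc n)"
  have nzPT: "P \<noteq> 0" "T \<noteq> 0" using nz by (auto simp: P_def T_def)
  have nzs: "b \<noteq> 0" "c \<noteq> 0" "d \<noteq> 0" "e \<noteq> 0" "f \<noteq> 0" using nz by auto
  have PT: "P * q = \<pi> (Suc (Suc n))" "T / q = \<rho> (Suc (Suc n))" "P / q = \<pi> n" "T * q = \<rho> n"
    using nz by (simp_all add: P_def T_def)
  have rel: "A (Suc n) * wp_pairing q a (P * q) (us @ [T / q]) [:0, 1, 0, - a:]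
    - (A (Suc n) + B (Suc n) + R (Suc n)) * wp_pairing q a P (us @ [T]) [:0, 1, 0, - a:]
    + B (Suc n) * wp_pairing q a (P / q) (us @ [T * q]) [:0, 1, 0, - a:] = 0"
    unfolding P_def[symmetric] T_def[symmetric]
  proof (rule wp_pairing_contiguous)
    show "b * c * d * e * f * P * T = a ^ 3 * q\<^sup>2"
      unfolding balanced[symmetric] by (simp add: P_def T_def)
    show "T \<noteq> 1" using q_shift_ne_1[OF Qqr, of n] nz by (simp add: T_def field_simps)
    show "T \<noteq> q" using q_shift_ne_1[OF Qqr, of "Suc n"] nz by (simp add: T_def field_simps)
    show "T\<^sup>2 \<noteq> a * q\<^sup>2" using q_shift_ne_1[OF Qarr, of "Suc n + Suc n"] nz
      by (simp add: T_def field_simps power2_eq_square power_add)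
    show "P \<noteq> T" using q_shift_ne_1[OF Qpr', of "Suc n + Suc n"] nz
      by (simp add: P_def T_def field_simps power_add)
    show "P \<noteq> q * T" using q_shift_ne_1[OF Qpr', of "Suc (n + n)"] nz
      by (simp add: P_def T_def field_simps power_add)
    show "P * q \<noteq> T" using q_shift_ne_1[OF Qpr', of "Suc (Suc n + Suc n)"] nz
      by (simp add: P_def T_def field_simps power_add)
    show "qpoch_inf q (P / q) \<noteq> 0" unfolding PT by (rule qpoch_inf_shift_nonzero[OF Qp])
    show "qpoch_inf q (a / P) \<noteq> 0" unfolding P_def by (rule Qap_n)
    show "qpoch_inf q (a / T) \<noteq> 0"
      using qpoch_inf_shift_nonzero[OF Qar', of "Suc n"] by (simp add: T_def)
    have "P\<^sup>2 / (a * q\<^sup>2) = p\<^sup>2 / a * q ^ (n + n)"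
      by (simp add: P_def power2_eq_square power_add)
    then show "qpoch_inf q (P\<^sup>2 / (a * q\<^sup>2)) \<noteq> 0"
      using qpoch_inf_shift_nonzero[OF Qpp, of "n + n"] by simp
    have PTz: "P * T = p * r" by (simp add: P_def T_def)
    \<comment> \<open>The factors j = 0 and j = 1 vanish exactly when a factor of (a q / (p r))_inf
      does; from j = 2 on they are factors of (p r / a)_inf.\<close>
    show "qpoch_inf q (P * T / (a * q\<^sup>2)) \<noteq> 0"
    proof (subst qpoch_inf_nonzero_iff, intro allI notI)
      fix j assume eq: "P * T / (a * q\<^sup>2) * q ^ j = 1"
      consider "j = 0" | "j = 1" | k where "j = Suc (Suc k)" by (metis not0_implies_Suc One_nat_def)
      then show False
      proof cases
        case 1
        then show ?thesis using eq q_shift_ne_1[OF Qz', of 1] nz by (simp add: PTz field_simps power2_eq_square)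
      next
        case 2
        then show ?thesis using eq q_shift_ne_1[OF Qz', of 0] nz by (simp add: PTz field_simps power2_eq_square)
      next
        case 3
        then show ?thesis using eq q_shift_ne_1[OF Qz, of k] nz by (simp add: PTz power2_eq_square mult.assoc)
      qed
    qed
    show "qpoch_inf q (a * q / u) \<noteq> 0" if "u \<in> set us" for u using Qus[OF that] .
    show "qpoch_inf q (u * P / (a * q)) \<noteq> 0" if "u \<in> set us" for u
    proof -
      have "u * P / (a * q) = p * u / a * q ^ n" by (simp add: P_def)
      then show ?thesis using qpoch_inf_shift_nonzero[OF Qups[OF that], of n] by simp
    qed
  qed (use nz nzPT nzs a1 in auto)
  have "(1 - a) * (A (Suc n) * \<Phi> (Suc (Suc n))
    - (A (Suc n) + B (Suc n) + R (Suc n)) * \<Phi> (Suc n)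
    + B (Suc n) * \<Phi> n)
    = A (Suc n) * ((1 - a) * \<Phi> (Suc (Suc n)))
    - (A (Suc n) + B (Suc n) + R (Suc n)) * ((1 - a) * \<Phi> (Suc n))
    + B (Suc n) * ((1 - a) * \<Phi> n)"
  proof -
    have "k * (x * y1 - s * y2 + w * y3) = x * (k * y1) - s * (k * y2) + w * (k * y3)" for k x s w y1 y2 y3 :: complex
      by algebra
    then show ?thesis .
  qed
  also have "\<dots> = 0"
    unfolding Phi_eq_pairing_n using rel[unfolded PT, unfolded P_def T_def] .
  finally show ?thesis using a1 by (simp only: mult_eq_0_iff) simp
qed

text \<open>A normalization characterized by its ratio: a step multiplies it by \<open>A n\<close>,
  which makes the leading coefficient of the contiguous relation 1 and the last one
  \<open>A n * B (Suc n)\<close>.\<close>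

definition prefactor :: "nat \<Rightarrow> complex" where
  "prefactor n = qpoch_inf q (\<pi> n / \<rho> n) * qpoch_inf q (a * q / \<rho> n) /
     (qpoch_inf q (\<pi> n) * qpoch_inf q (\<pi> n / a) * prod_list (map (\<lambda>u. qpoch_inf q (a * q / (u * \<rho> n))) us))"

definition solution :: "nat \<Rightarrow> complex" where
  "solution n = prefactor n * \<Phi> n"

lemma prefactor_Suc: "prefactor (Suc n) = A n * prefactor n"
proof -
  have s1: "qpoch_inf q (\<pi> n) = (1 - \<pi> n) * qpoch_inf q (\<pi> (Suc n))"
    using qpoch_inf_Suc[of "\<pi> n"] by (simp add: mult_ac)
  have s2: "qpoch_inf q (\<pi> n / a) = (1 - \<pi> n / a) * qpoch_inf q (\<pi> (Suc n) / a)"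
    using qpoch_inf_Suc[of "\<pi> n / a"] by (simp add: mult_ac)
  have s3: "qpoch_inf q (a * q / \<rho> n) = (1 - a * q / \<rho> n) * qpoch_inf q (a * q / \<rho> (Suc n))"
    using qpoch_inf_Suc[of "a * q / \<rho> n"] by (simp add: mult_ac)
  have s4: "qpoch_inf q (a * q / (u * \<rho> n)) = (1 - a * q / (u * \<rho> n)) * qpoch_inf q (a * q / (u * \<rho> (Suc n)))" for u
    using qpoch_inf_Suc[of "a * q / (u * \<rho> n)"] by (simp add: mult_ac)
  have s5: "qpoch_inf q (\<pi> n / \<rho> n) = (1 - \<pi> n / \<rho> n) * (1 - \<pi> n * q / \<rho> n) * qpoch_inf q (\<pi> (Suc n) / \<rho> (Suc n))"
    using qpoch_inf_Suc[of "\<pi> n / \<rho> n"] qpoch_inf_Suc[of "\<pi> n * q / \<rho> n"] by (simp add: mult_ac)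
  have n1: "1 - \<pi> n \<noteq> 0" using qpoch_inf_shift_nonzero[OF Qp, of n] unfolding s1 by auto
  have n2: "1 - \<pi> n / a \<noteq> 0" using qpoch_inf_shift_nonzero[OF Qpa, of n] unfolding times_divide_eq_left s2 by auto
  have n3: "1 - a * q / \<rho> n \<noteq> 0" using q_shift_ne_1[OF Qar, of n] by simp
  have n4: "prod_list (map (\<lambda>u. 1 - a * q / (u * \<rho> n)) us) \<noteq> 0"
    using q_shift_ne_1[OF Qaur, of _ n] by simp
  have n5: "1 - \<pi> n / \<rho> n \<noteq> 0" "1 - \<pi> n * q / \<rho> n \<noteq> 0"
    using q_shift_ne_1[OF Qpr', of "n + n"] q_shift_ne_1[OF Qpr', of "Suc (n + n)"] by (simp_all add: power_add mult_ac)
  have alg: "x5 * x3 / (x1 * x2 * x4) = (y1 * y2 * y4 / (y6 * y5 * y3)) * (y5 * y6 * x5 * (y3 * x3) / ((y1 * x1) * (y2 * x2) * (y4 * x4)))"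
    if "y1 \<noteq> 0" "y2 \<noteq> 0" "y3 \<noteq> 0" "y4 \<noteq> 0" "y5 \<noteq> 0" "y6 \<noteq> 0"
    for x1 x2 x3 x4 x5 y1 y2 y3 y4 y5 y6 :: complex
    using that by simp
  show ?thesis
    unfolding prefactor_def[of n] shift_up_def s1 s2 s3 s5 s4 prod_list_map_mult
    unfolding prefactor_def by (rule alg[OF n1 n2 n3 n4 n5])
qed

lemma solution_recurrence:
  "solution (Suc (Suc n)) = (A (Suc n) + B (Suc n) + R (Suc n)) * solution (Suc n) - A n * B (Suc n) * solution n"
proof -
  have "solution (Suc (Suc n)) = prefactor (Suc n) * (A (Suc n) * \<Phi> (Suc (Suc n)))"
    by (simp only: solution_def prefactor_Suc[of "Suc n"] mult_ac)
  also have "A (Suc n) * \<Phi> (Suc (Suc n))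
     = (A (Suc n) + B (Suc n) + R (Suc n)) * \<Phi> (Suc n)
      - B (Suc n) * \<Phi> n"
  proof -
    have "x = y - w" if "x - y + w = 0" for x y w :: complex using that by algebra
    then show ?thesis using Phi_contiguous[of n] by blast
  qed
  also have "prefactor (Suc n) * \<dots> = (A (Suc n) + B (Suc n) + R (Suc n)) * solution (Suc n) - A n * B (Suc n) * solution n"
    by (simp only: solution_def prefactor_Suc[of n] right_diff_distrib mult_ac)
  finally show ?thesis .
qed

lemma solution_tendsto:
  assumes "\<And>j. p * r / a * q ^ j \<noteq> 1"
  shows "solution \<longlonglongrightarrow> wp_W q a us (p * r / a)"
proof -
  have q1: "(\<lambda>n. qpoch_inf q (x * q ^ n)) \<longlonglongrightarrow> 1" for x by (rule qpoch_inf_geometric_tendsto_1)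
  have q2: "(\<lambda>n. qpoch_inf q (x * q ^ (n + n))) \<longlonglongrightarrow> 1" for x
    using LIMSEQ_subseq_LIMSEQ[OF q1[of x], of "\<lambda>n. n + n"] by (simp add: strict_mono_def o_def)
  have eq: "prefactor n = qpoch_inf q (p / r * q ^ (n + n)) * qpoch_inf q (a * q / r * q ^ n) /
     (qpoch_inf q (p * q ^ n) * qpoch_inf q (p / a * q ^ n) * prod_list (map (\<lambda>u. qpoch_inf q (a * q / (u * r) * q ^ n)) us))" for n
  proof -
    have "\<pi> n / \<rho> n = p / r * q ^ (n + n)" "a * q / \<rho> n = a * q / r * q ^ n" "\<pi> n / a = p / a * q ^ n"
      "a * q / (u * \<rho> n) = a * q / (u * r) * q ^ n" for u
      by (simp_all add: power_add)
    then show ?thesis unfolding prefactor_def by (simp only:)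
  qed
  have "prefactor \<longlonglongrightarrow> 1 * 1 / (1 * 1 * prod_list (map (\<lambda>u. 1) us))"
    unfolding eq[abs_def] by (intro tendsto_divide tendsto_mult q1 q2 tendsto_prod_list) auto
  then have "prefactor \<longlonglongrightarrow> 1" by simp
  then have "solution \<longlonglongrightarrow> 1 * wp_W q a us (p * r / a)"
    unfolding solution_def by (intro tendsto_mult Phi_tendsto assms)
  then show ?thesis by simp
qed

text \<open>As functions of x = q^n the three coefficients are rational and regular at 0, with the
  values 1, q and 0 there.\<close>

lemma summable_coefficients:
  shows "summable (\<lambda>n. norm (A (Suc n) + B (Suc n) + R (Suc n) - (1 + q)))"
    and "summable (\<lambda>n. norm (A n * B (Suc n) - q))"
proof -
  define fA where "fA = (\<lambda>x. (1 - p * x) * (1 - p / a * x) * ((1 - a * q / (b * r) * x) * (1 - a * q / (c * r) * x)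
    * (1 - a * q / (d * r) * x) * (1 - a * q / (e * r) * x) * (1 - a * q / (f * r) * x))
    / ((1 - p * q / r * x\<^sup>2) * (1 - p / r * x\<^sup>2) * (1 - a * q / r * x)))"
  define fB where "fB = (\<lambda>x. q * (1 - 1 / r * x) * (1 - a / r * x) * ((1 - b * p / (a * q) * x) * (1 - c * p / (a * q) * x)
    * (1 - d * p / (a * q) * x) * (1 - e * p / (a * q) * x) * (1 - f * p / (a * q) * x))
    / ((1 - p / r * x\<^sup>2) * (1 - p / (q * r) * x\<^sup>2) * (1 - p / (a * q) * x)))"
  define fR where "fR = (\<lambda>x. p / (a * r) * x\<^sup>2 * (1 - p * r / (a * q)) * prod_list (map (\<lambda>b. 1 - b) us)
    / ((1 - a * q / r * x) * (1 - p / (a * q) * x)))"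
  have eq: "A n = fA (q ^ n)" "B n = fB (q ^ n)" "R n = fR (q ^ n)" for n
    unfolding shift_up_def shift_down_def shift_rest_def fA_def fB_def fR_def
    by (simp_all add: power2_eq_square mult_ac)
  have dA: "fA field_differentiable at 0" unfolding fA_def by (intro derivative_intros) auto
  have dB: "fB field_differentiable at 0" unfolding fB_def by (intro derivative_intros) auto
  have dR: "fR field_differentiable at 0" unfolding fR_def by (intro derivative_intros) auto
  have f0: "fA 0 = 1" "fB 0 = q" "fR 0 = 0" by (simp_all add: fA_def fB_def fR_def)
  have sA: "summable (\<lambda>n. norm (A n - 1))" and sB: "summable (\<lambda>n. norm (B n - q))" and sR: "summable (\<lambda>n. norm (R n - 0))"
    unfolding eq using summable_of_differentiable[OF dA] summable_of_differentiable[OF dB] summable_of_differentiable[OF dR]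
    by (simp_all add: f0)
  have "summable (\<lambda>n. norm (A n + B n + R n - (1 + q + 0)))"
    by (intro summable_norm_add_diff sA sB sR)
  then show "summable (\<lambda>n. norm (A (Suc n) + B (Suc n) + R (Suc n) - (1 + q)))"
    by (subst (asm) summable_Suc_iff[symmetric]) simp
  have sB': "summable (\<lambda>n. norm (B (Suc n) - q))" using sB by (subst summable_Suc_iff[where f = "\<lambda>n. norm (B n - q)"])
  show "summable (\<lambda>n. norm (A n * B (Suc n) - q))"
    by (rule summable_norm_mult_diff[OF sA sB'])
qed

end

section \<open>The continued fraction\<close>

lemma powi_nat_diff: "q \<noteq> 0 \<Longrightarrow> q powi (int m - int k) = q ^ m / q ^ k" for q :: complex
  by (simp add: power_int_diff)

text \<open>The natural number N encodes the index n = N - 1, so that the sequences start at n =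
  -1.\<close>

lemma powi_shifted:
  fixes q :: complex
  assumes "q \<noteq> 0"
  shows "q powi (int N - 1 - 1) = q ^ N / q ^ 2" "q powi (int N - 1 + 1) = q ^ N" "q powi (int N - 1 - 2) = q ^ N / q ^ 3"
    "q powi (2 * (int N - 1)) = q ^ (N + N) / q ^ 2" "q powi (2 * (int N - 1) - 1) = q ^ (N + N) / q ^ 3"
    "q powi (2 * (int N - 1) - 2) = q ^ (N + N) / q ^ 4" "q powi (int N - 1) = q ^ N / q"
    "q powi (- (int N - 1)) = q / q ^ N" "q powi (- (int N - 1) + 2) = q ^ 3 / q ^ N"
proof -
  have e: "int N - 1 - 1 = int N - int 2" "int N - 1 + 1 = int N - int 0" "int N - 1 - 2 = int N - int 3"
    "2 * (int N - 1) = int (N + N) - int 2" "2 * (int N - 1) - 1 = int (N + N) - int 3"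
    "2 * (int N - 1) - 2 = int (N + N) - int 4" "int N - 1 = int N - int 1"
    "- (int N - 1) = int 1 - int N" "- (int N - 1) + 2 = int 3 - int N" by simp_all
  show "q powi (int N - 1 - 1) = q ^ N / q ^ 2" unfolding e(1) powi_nat_diff[OF assms] ..
  show "q powi (int N - 1 + 1) = q ^ N" unfolding e(2) powi_nat_diff[OF assms] by simp
  show "q powi (int N - 1 - 2) = q ^ N / q ^ 3" unfolding e(3) powi_nat_diff[OF assms] ..
  show "q powi (2 * (int N - 1)) = q ^ (N + N) / q ^ 2" unfolding e(4) powi_nat_diff[OF assms] ..
  show "q powi (2 * (int N - 1) - 1) = q ^ (N + N) / q ^ 3" unfolding e(5) powi_nat_diff[OF assms] ..
  show "q powi (2 * (int N - 1) - 2) = q ^ (N + N) / q ^ 4" unfolding e(6) powi_nat_diff[OF assms] ..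
  show "q powi (int N - 1) = q ^ N / q" unfolding e(7) powi_nat_diff[OF assms] by simp
  show "q powi (- (int N - 1)) = q / q ^ N" unfolding e(8) powi_nat_diff[OF assms] by simp
  show "q powi (- (int N - 1) + 2) = q ^ 3 / q ^ N" unfolding e(9) powi_nat_diff[OF assms] ..
qed

text \<open>Inversion exchanges the parameter products: the one in \<open>shift_up\<close> reappears
  in \<open>shift_down\<close> of the inverted family, and conversely.\<close>

lemma shift_product_inversion:
  fixes a q P T :: complex and us :: "complex list"
  assumes nz: "a \<noteq> 0" "q \<noteq> 0" "P \<noteq> 0" "T \<noteq> 0" "0 \<notin> set us"
    and ne: "P \<noteq> a" "P * q \<noteq> a" "T \<noteq> a" "T \<noteq> a * q"
  shows "shift_up q (q / a) (map (\<lambda>u. q / u) us) (q / T) (q / P)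
      * shift_down q (q / a) (map (\<lambda>u. q / u) us) (q / T * q) (q / P / q)
    = shift_up q a us P T * shift_down q a us (P * q) (T / q)"
proof -
  define X where "X = prod_list (map (\<lambda>u. 1 - a * q / (u * T)) us)"
  define Y where "Y = prod_list (map (\<lambda>u. 1 - u * P / a) us)"
  have X1: "prod_list (map (\<lambda>u. 1 - u * (q / T * q) / (q / a * q)) (map (\<lambda>u. q / u) us)) = X"
    unfolding X_def list.map_comp o_def using nz
    by (intro arg_cong[where f = prod_list] map_cong refl) (auto simp: field_simps)
  have Y1: "prod_list (map (\<lambda>u. 1 - q / a * q / (u * (q / P))) (map (\<lambda>u. q / u) us)) = Y"
    unfolding Y_def list.map_comp o_def using nz
    by (intro arg_cong[where f = prod_list] map_cong refl) (auto simp: field_simps)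
  have Y2: "prod_list (map (\<lambda>u. 1 - u * (P * q) / (a * q)) us) = Y"
    unfolding Y_def using nz by (intro arg_cong[where f = prod_list] map_cong refl) auto
  have n: "1 - P / a \<noteq> 0" "1 - P * q / a \<noteq> 0" "1 - a / T \<noteq> 0" "1 - a * q / T \<noteq> 0"
    using nz ne by auto
  have e: "q / T / (q / a) = a / T" "q / T * q / (q / P) = P * q / T" "q / T / (q / P) = P / T" "q / a * q / (q / P) = P * q / a"
    "1 / (q / P / q) = P" "q / a / (q / P / q) = P * q / a" "q / T * q / (q / P / q) = P * q * q / T"
    "q / T * q / (q * (q / P / q)) = P * q / T" "q / T * q / (q / a * q) = a / T"
    and e': "P * q / (T / q) = P * q * q / T" "P * q / (q * (T / q)) = P * q / T" "P * q / (a * q) = P / a"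
    "1 / (T / q) = q / T" "a / (T / q) = a * q / T"
    using nz by (simp_all add: field_simps)
  have alg: "(t1 * t3 * Y / (s1 * s2 * t2)) * (q * t4 * t2 * X / (s3 * s1 * t3)) = (t4 * t5 * X / (s1 * s2 * t6)) * (q * t1 * t6 * Y / (s3 * s1 * t5))"
    if "t2 \<noteq> 0" "t3 \<noteq> 0" "t5 \<noteq> 0" "t6 \<noteq> 0" for t1 t2 t3 t4 t5 t6 s1 s2 s3 :: complex
    using that by (simp add: mult_ac)
  show ?thesis
    unfolding shift_up_def shift_down_def X1 Y1 Y2 X_def[symmetric] e e'
    by (rule alg[OF n(2) n(3) n(1) n(4)])
qed

context wp_family5
begin

lemma A_nonzero: "A n \<noteq> 0"
proof -
  have 1: "1 - \<pi> n \<noteq> 0" "1 - \<pi> n / a \<noteq> 0" "1 - a * q / \<rho> n \<noteq> 0"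
    using q_shift_ne_1[OF Qp, of n] q_shift_ne_1[OF Qpa, of n] q_shift_ne_1[OF Qar, of n] by simp_all
  have 2: "prod_list (map (\<lambda>u. 1 - a * q / (u * \<rho> n)) us) \<noteq> 0"
    using q_shift_ne_1[OF Qaur, of _ n] by simp
  have 3: "1 - \<pi> n / \<rho> n \<noteq> 0" "1 - \<pi> n * q / \<rho> n \<noteq> 0"
    using q_shift_ne_1[OF Qpr', of "n + n"] q_shift_ne_1[OF Qpr', of "Suc (n + n)"] by (simp_all add: power_add mult_ac)
  show ?thesis unfolding shift_up_def using 1 2 3 by (simp only: divide_eq_0_iff mult_eq_0_iff) simp
qed

lemma B_Suc_nonzero: "B (Suc n) \<noteq> 0"
proof -
  have 1: "1 - 1 / \<rho> (Suc n) \<noteq> 0" "1 - a / \<rho> (Suc n) \<noteq> 0" "1 - \<pi> (Suc n) / (a * q) \<noteq> 0"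
    using q_shift_ne_1[OF Qqr, of n] q_shift_ne_1[OF Qar', of "Suc n"] q_shift_ne_1[OF Qpa, of n] by (simp_all add: mult_ac)
  have 2: "prod_list (map (\<lambda>u. 1 - u * \<pi> (Suc n) / (a * q)) us) \<noteq> 0"
    using q_shift_ne_1[OF Qups, of _ n] by (simp add: mult_ac)
  have 3: "1 - \<pi> (Suc n) / \<rho> (Suc n) \<noteq> 0" "1 - \<pi> (Suc n) / (q * \<rho> (Suc n)) \<noteq> 0"
    using q_shift_ne_1[OF Qpr', of "Suc n + Suc n"] q_shift_ne_1[OF Qpr', of "Suc (n + n)"] by (simp_all add: power_add mult_ac)
  show ?thesis unfolding shift_down_def using 1 2 3 q_nz by (simp only: divide_eq_0_iff mult_eq_0_iff) simp
qed

lemma parameters_ne: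
  "\<pi> n \<noteq> a" "\<pi> n * q \<noteq> a" "\<pi> (Suc n) \<noteq> a * q" "\<rho> n \<noteq> a" "\<rho> n \<noteq> a * q" "\<rho> (Suc n) * q \<noteq> a"
  "\<pi> n \<noteq> \<rho> n" "\<pi> (Suc n) \<noteq> q * \<rho> (Suc n)" "\<pi> n * q \<noteq> \<rho> n"
  using q_shift_ne_1[OF Qpa, of n] q_shift_ne_1[OF Qpa, of "Suc n"] q_shift_ne_1[OF Qar', of n] q_shift_ne_1[OF Qar, of n]
    q_shift_ne_1[OF Qpr', of "n + n"] q_shift_ne_1[OF Qpr', of "Suc (n + n)"] nz
  by (auto simp: power_add field_simps)

end

text \<open>Most conditions of the locale are denominators in \<open>Phi_nonsing\<close>. These
  yield (p q / r)_inf, and \<open>p \<noteq> r\<close> adds the missing first factor of (p /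
  r)_inf.\<close>

lemma wp_family5I:
  assumes q: "0 < norm q" "norm q < 1"
    and nz: "a \<noteq> 0" "p \<noteq> 0" "r \<noteq> 0" "b \<noteq> 0" "c \<noteq> 0" "d \<noteq> 0" "e \<noteq> 0" "f \<noteq> 0"
    and bal: "b * c * d * e * f * p * r = a ^ 3 * q\<^sup>2"
    and den: "qpoch_inf q p \<noteq> 0" "qpoch_inf q (p / a) \<noteq> 0" "\<And>u. u \<in> {b, c, d, e, f} \<Longrightarrow> qpoch_inf q (a * q / (u * r)) \<noteq> 0"
    and Phi: "Phi_nonsing q a p ([b, c, d, e, f] @ [r])"
    and Q: "qpoch_inf q (q / r) \<noteq> 0" "qpoch_inf q (a / r) \<noteq> 0" "qpoch_inf q (a * q\<^sup>2 / r\<^sup>2) \<noteq> 0"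
      "p \<noteq> r" "\<And>k. a * q / (p * r) * q ^ k \<noteq> 1"
  shows "wp_family5 q a p r b c d e f"
proof -
  interpret q_base q using q by unfold_locales
  have P2: "p\<^sup>2 / a * q / p = p * q / a" "p\<^sup>2 / a * q / (p * u / a) = p * q / u" if "u \<noteq> 0" for u
    using nz that by (simp_all add: power2_eq_square)
  have ns: "a \<noteq> 1" "\<And>u. u \<in> set (p # [b, c, d, e, f] @ [r]) \<Longrightarrow> qpoch_inf q (a * q / u) \<noteq> 0"
    "p\<^sup>2 / a \<noteq> 1" "\<And>u. u \<in> set (p # map (\<lambda>u. p * u / a) ([b, c, d, e, f] @ [r])) \<Longrightarrow> qpoch_inf q (p\<^sup>2 / a * q / u) \<noteq> 0"
    "qpochs_inf q [p\<^sup>2 * q / a, a / p] \<noteq> 0" "\<And>u. u \<in> set ([b, c, d, e, f] @ [r]) \<Longrightarrow> qpochs_inf q [a * q / u, p * u / a] \<noteq> 0"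
    using Phi unfolding Phi_nonsing_def vwp_nonsing_iff by blast+
  have pq: "qpoch_inf q (p * q / u) \<noteq> 0" if "u \<in> set ([b, c, d, e, f] @ [r])" for u
  proof -
    have "u \<noteq> 0" using that nz by auto
    moreover have "p * u / a \<in> set (p # map (\<lambda>u. p * u / a) ([b, c, d, e, f] @ [r]))"
      using that by (simp only: set_map list.set insert_iff image_eqI) blast
    ultimately show ?thesis using ns(4)[of "p * u / a"] P2(2)[of u] by simp
  qed
  show ?thesis
  proof (unfold_locales)
    show "qpoch_inf q (p\<^sup>2 / a) \<noteq> 0"
      using qpoch_inf_Suc[of "p\<^sup>2 / a"] ns(3,5) by (simp add: qpochs_inf_Cons)
    show "qpoch_inf q (p / r) \<noteq> 0"
      using qpoch_inf_Suc[of "p / r"] pq[of r] Q(4) nz by simp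
    show "qpoch_inf q (a * q / (p * r)) \<noteq> 0" using Q(5) qpoch_inf_nonzero_iff by blast
    show "0 \<notin> set [b, c, d, e, f]" using nz by simp
    show "qpoch_inf q (a * q / r) \<noteq> 0" using ns(2) by simp
    show "qpoch_inf q (p * r / a) \<noteq> 0" using ns(6)[of r] by (simp add: qpochs_inf_Cons)
    show "qpoch_inf q (a / p) \<noteq> 0" using ns(5) by (simp add: qpochs_inf_Cons)
    show "qpoch_inf q (p * q / r) \<noteq> 0" using pq[of r] by simp
    fix u assume u: "u \<in> set [b, c, d, e, f]"
    show "qpoch_inf q (a * q / u) \<noteq> 0" using ns(2)[of u] u by auto
    show "qpoch_inf q (p * u / a) \<noteq> 0" using ns(6)[of u] u by (auto simp: qpochs_inf_Cons)
    show "qpoch_inf q (p * q / u) \<noteq> 0" using pq[of u] u by auto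
  qed (use nz ns(1) den Q bal in auto)
qed

section \<open>The two mutually inverse families and the closed form of the quotient\<close>

theorem theorem3p1:
  fixes q a b c d e f h s W1 W2 N D :: complex and ps :: "complex list"
  assumes q: "0 < norm q" "norm q < 1"
    and nonzero: "a \<noteq> 0" "b \<noteq> 0" "c \<noteq> 0" "d \<noteq> 0" "e \<noteq> 0" "f \<noteq> 0" "h \<noteq> 0"
    and s_def: "s = a ^ 3 * q ^ 3 / (b * c * d * e * f)"
    and ps_def: "ps = [b, c, d, e, f]"
    and W1_def: "W1 = W8_7 q (a, b, c, d, e, f)"
    and W2_def: "W2 = W8_7 q (q / a, q / b, q / c, q / d, q / e, q / f)"
    and N_def: "N =
      W2 * (qpoch_inf q (a * q / h)
             / (qpochs_inf q [s / (h * q), s / (a * h * q)]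
                * prod_list (map (\<lambda>p. qpoch_inf q (a * q / (p * h))) ps)))
         * Phi q a (s / (h * q)) [b, c, d, e, f, h]
      - W1 * (qpoch_inf q (s / (a * h))
             / (qpochs_inf q [q / h, a / h]
                * prod_list (map (\<lambda>p. qpoch_inf q (p * s / (a * h * q))) ps)))
         * Phi q (q / a) (q / h) [q / b, q / c, q / d, q / e, q / f, h * q\<^sup>2 / s]"
    and D_def: "D =
      W2 * (((1 - 1 / h) * prod_list (map (\<lambda>p. 1 - p * s / (a * h * q\<^sup>2)) ps) * qpoch_inf q (a / h))
             / (qpochs_inf q [s / (h * q), s / (a * h * q\<^sup>2)]
                * prod_list (map (\<lambda>p. qpoch_inf q (a * q / (p * h))) ps)))
         * Phi q a (s / (h * q\<^sup>2)) [b, c, d, e, f, h * q]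
      - W1 * (((1 - s / (h * q\<^sup>2)) * prod_list (map (\<lambda>p. 1 - a / (p * h)) ps)
                * qpoch_inf q (s / (a * h * q)))
             / (qpochs_inf q [q / h, a / (q * h)]
                * prod_list (map (\<lambda>p. qpoch_inf q (p * s / (a * q * h))) ps)))
         * Phi q (q / a) (1 / h) [q / b, q / c, q / d, q / e, q / f, h * q ^ 3 / s]"
    and coeff_nonsing: "coeff_nonsing q a s h"
    and W_nonsing: "W8_7_nonsing q (a, b, c, d, e, f)"
      "W8_7_nonsing q (q / a, q / b, q / c, q / d, q / e, q / f)"
    and X1_nonsing: "X1_nonsing q a ps s h 0" "X1_nonsing q a ps s h (-1)"
    and X2_nonsing: "X2_nonsing q a ps s h 0" "X2_nonsing q a ps s h (-1)"
    and ratio_nonsing: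
      "coeff_b q a ps s h 0 * (W2 * X1 q a ps s h (-1) - W1 * X2 q a ps s h (-1)) \<noteq> 0"
  shows "cf_has_value (\<lambda>n. coeff_a q a ps s h (int n)) (\<lambda>n. coeff_b q a ps s h (int n))
           ((W2 * X1 q a ps s h 0 - W1 * X2 q a ps s h 0)
             / (coeff_b q a ps s h 0 * (W2 * X1 q a ps s h (-1) - W1 * X2 q a ps s h (-1))))
       \<and> (W2 * X1 q a ps s h 0 - W1 * X2 q a ps s h 0)
             / (coeff_b q a ps s h 0 * (W2 * X1 q a ps s h (-1) - W1 * X2 q a ps s h (-1)))
         = (1 - s / (h\<^sup>2 * q)) * (1 - s / (h\<^sup>2 * q\<^sup>2)) / q * (N / D)"
proof -
  interpret q_base q using q by unfold_locales
  have q0: "q \<noteq> 0" by simp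
  have s0: "s \<noteq> 0" using nonzero q0 by (simp add: s_def)
  \<comment> \<open>The values of s q^(n-1) / h and h q^(-n) at n = -1.\<close>
  define p0 r0 where "p0 = s / (h * q\<^sup>2)" and "r0 = h * q"
  \<comment> \<open>These are 1/h and h q^3 / s, the corresponding parameters of the second solution
    at n = -1: inversion exchanges the distinguished and the last parameter.\<close>
  define p1 r1 where "p1 = q / r0" and "r1 = q / p0"
  have nz0: "p0 \<noteq> 0" "r0 \<noteq> 0" "p1 \<noteq> 0" "r1 \<noteq> 0"
    using s0 q0 nonzero by (simp_all add: p0_def r0_def p1_def r1_def)
  have bal0: "b * c * d * e * f * p0 * r0 = a ^ 3 * q\<^sup>2"
    using nonzero q0 by (simp add: p0_def r0_def s_def eval_nat_numeral)
  have bal1: "q / b * (q / c) * (q / d) * (q / e) * (q / f) * p1 * r1 = (q / a) ^ 3 * q\<^sup>2"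
  proof -
    have "q / b * (q / c) * (q / d) * (q / e) * (q / f) * p1 * r1 = q ^ 7 / (b * c * d * e * f * p0 * r0)"
      by (simp add: p1_def r1_def eval_nat_numeral mult_ac)
    then show ?thesis unfolding bal0 using nonzero q0 by (simp add: eval_nat_numeral)
  qed
  have m1: "(- 1 :: int) = int 0 - 1" by simp
  have args: "s / h * (q ^ N / q\<^sup>2) = p0 * q ^ N" "s * (q ^ N / q\<^sup>2) / h = p0 * q ^ N" "s * (q ^ N / q\<^sup>2) / (a * h) = p0 * q ^ N / a"
      "a * q ^ N / (u * h) = a * q / (u * (r0 / q ^ N))" "a * q ^ N / h = a * q / (r0 / q ^ N)"
      "s * (q ^ (N + N) / q ^ 3) / h\<^sup>2 = p0 * q ^ N / (r0 / q ^ N)" "h * (q / q ^ N) = r0 / q ^ N"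
      "q ^ N / h = p1 * q ^ N" "a * (q ^ N / q) / h = p1 * q ^ N / (q / a)"
      "v * s * (q ^ N / q\<^sup>2) / (a * h) = q / a * q / (q / v * (r1 / q ^ N))"
      "s * (q ^ N / q) / (a * h) = q / a * q / (r1 / q ^ N)"
      "s * (q ^ (N + N) / q ^ 3) / h\<^sup>2 = p1 * q ^ N / (r1 / q ^ N)" "h * (q ^ 3 / q ^ N) / s = r1 / q ^ N" for N u v
    using nonzero q0 s0
    by (simp_all add: p0_def r0_def p1_def r1_def power_add eval_nat_numeral mult_ac)
  have X1den: "X1_den q a ps s h (int N - 1) = qpoch_inf q (p0 * q ^ N) * qpoch_inf q (p0 * q ^ N / a)
      * prod_list (map (\<lambda>u. qpoch_inf q (a * q / (u * (r0 / q ^ N)))) ps)" for N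
    unfolding X1_den_def powi_shifted[OF q0] args qpochs_inf_Cons qpochs_Nil mult_1_right ..
  have X2den: "X2_den q a ps s h (int N - 1) = qpoch_inf q (p1 * q ^ N) * qpoch_inf q (p1 * q ^ N / (q / a))
      * prod_list (map (\<lambda>u. qpoch_inf q (q / a * q / (u * (r1 / q ^ N)))) (map (\<lambda>u. q / u) ps))" for N
    unfolding X2_den_def powi_shifted[OF q0] args(8,9,10) qpochs_inf_Cons qpochs_Nil mult_1_right list.map_comp o_def ..
  have X1ns: "Phi_nonsing q a p0 (ps @ [r0])" "X1_den q a ps s h (int 0 - 1) \<noteq> 0"
    using X1_nonsing(2) args(1)[of 0] args(7)[of 0]
    unfolding X1_nonsing_def m1 powi_shifted[OF q0] by simp_all
  have X2ns: "Phi_nonsing q (q / a) p1 (map (\<lambda>p. q / p) ps @ [r1])" "X2_den q a ps s h (int 0 - 1) \<noteq> 0"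
    using X2_nonsing(2) args(8)[of 0] args(13)[of 0]
    unfolding X2_nonsing_def m1 powi_shifted[OF q0] by simp_all
  have d1: "qpoch_inf q p0 \<noteq> 0" "qpoch_inf q (p0 / a) \<noteq> 0" "\<And>u. u \<in> {b, c, d, e, f} \<Longrightarrow> qpoch_inf q (a * q / (u * r0)) \<noteq> 0"
    using X1ns(2) unfolding X1den by (auto simp: ps_def)
  have d2: "qpoch_inf q p1 \<noteq> 0" "qpoch_inf q (p1 / (q / a)) \<noteq> 0" "\<And>u. u \<in> {q / b, q / c, q / d, q / e, q / f} \<Longrightarrow> qpoch_inf q (q / a * q / (u * r1)) \<noteq> 0"
    using X2ns(2) unfolding X2den by (auto simp: ps_def)
  have sq1: "qpoch_inf q (p0\<^sup>2 * q / a) \<noteq> 0" using X1ns(1) by (simp add: Phi_nonsing_def qpochs_inf_Cons)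
  have sq2: "qpoch_inf q (p1\<^sup>2 * q / (q / a)) \<noteq> 0" using X2ns(1) by (simp only: Phi_nonsing_def qpochs_inf_Cons mult_eq_0_iff) blast
  \<comment> \<open>Taken from the denominators of the coefficients at n = -1, where s q^(2n-1) /
    h^2 is p0 / r0.\<close>
  have p0r0: "p0 \<noteq> r0"
  proof -
    have "(1 - s * q powi (2 * (int 0 - 1) - 1) / h\<^sup>2) \<noteq> 0"
      using coeff_nonsing[unfolded coeff_nonsing_def, THEN conjunct1, rule_format, of "int 0 - 1"]
      by (simp only: mult_eq_0_iff) auto
    then have "1 - p0 / r0 \<noteq> 0" unfolding powi_shifted[OF q0] args(6) by simp
    then show ?thesis using nz0 by auto
  qed
  have arg1: "W8_7_arg q (a, b, c, d, e, f) = p0 * r0 / a"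
    using bal0 nonzero q0 by (simp add: W8_7_arg_def field_simps eval_nat_numeral)
  have arg2: "W8_7_arg q (q / a, q / b, q / c, q / d, q / e, q / f) = p1 * r1 / (q / a)"
    using bal1 nonzero q0 by (simp add: W8_7_arg_def field_simps eval_nat_numeral)
  have z1: "p0 * r0 / a * q ^ k \<noteq> 1" and z2: "p1 * r1 / (q / a) * q ^ k \<noteq> 1" for k
    using W_nonsing arg1 arg2 by (simp_all only: W8_7_nonsing_def prod.case) blast+
  \<comment> \<open>The conditions still missing for one family are, apart from
    \<open>p0 \<noteq> r0\<close>, conditions on the other.\<close>
  have e1: "q / r0 = p1" "a / r0 = p1 / (q / a)" "a * q\<^sup>2 / r0\<^sup>2 = p1\<^sup>2 * q / (q / a)" "a * q / (p0 * r0) = p1 * r1 / (q / a)"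
    "q / r1 = p0" "q / a / r1 = p0 / a" "q / a * q\<^sup>2 / r1\<^sup>2 = p0\<^sup>2 * q / a" "q / a * q / (p1 * r1) = p0 * r0 / a"
    using nz0 q0 nonzero by (simp_all add: p1_def r1_def power2_eq_square mult_ac)
  interpret F1: wp_family5 q a p0 r0 b c d e f
    by (rule wp_family5I[OF q nonzero(1) nz0(1,2) nonzero(2-6) bal0 d1 X1ns(1)[unfolded ps_def]])
      (use d2 sq2 z2 p0r0 in \<open>simp_all only: e1 not_False_eq_True\<close>)
  interpret F2: wp_family5 q "q / a" p1 r1 "q / b" "q / c" "q / d" "q / e" "q / f"
  proof (rule wp_family5I[OF q _ nz0(3,4) _ _ _ _ _ bal1 d2])
    show "Phi_nonsing q (q / a) p1 ([q / b, q / c, q / d, q / e, q / f] @ [r1])"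
      using X2ns(1) by (simp add: ps_def)
    show "p1 \<noteq> r1" using p0r0 nz0 q0 by (simp add: p1_def r1_def)
  qed (use d1 sq1 z1 nonzero q0 in \<open>simp_all only: e1 not_False_eq_True divide_eq_0_iff simp_thms\<close>)
  have sol1: "X1 q a ps s h (int N - 1) = F1.solution N" for N
    unfolding X1_def powi_shifted[OF q0] X1den args qpochs_inf_Cons qpochs_Nil mult_1_right F1.solution_def F1.prefactor_def
    by (simp add: ps_def)
  have sol2: "X2 q a ps s h (int N - 1) = F2.solution N" for N
    unfolding X2_def powi_shifted[OF q0] X2den args(8,11,12,13) qpochs_inf_Cons qpochs_Nil mult_1_right F2.solution_def F2.prefactor_def
    by (simp add: ps_def)
  have cA: "coeff_A q a ps s h (int N - 1) = F1.A N" for N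
  proof -
    have e: "s * (q ^ (N + N) / q\<^sup>2) / h\<^sup>2 = p0 * q ^ N * q / (r0 / q ^ N)"
      using nonzero q0 by (simp add: p0_def r0_def power_add eval_nat_numeral mult_ac)
    show ?thesis
      unfolding coeff_A_def powi_shifted[OF q0] args(2,3,4,5,6) e shift_up_def ps_def ..
  qed
  have cB: "coeff_B q a ps s h (int N - 1) = F1.B N" for N
  proof -
    have e: "q ^ N / q / h = 1 / (r0 / q ^ N)" "a * (q ^ N / q) / h = a / (r0 / q ^ N)"
      "u * s * (q ^ N / q ^ 3) / (a * h) = u * (p0 * q ^ N) / (a * q)"
      "s * (q ^ (N + N) / q ^ 4) / h\<^sup>2 = p0 * q ^ N / (q * (r0 / q ^ N))" "s * (q ^ N / q ^ 3) / (a * h) = p0 * q ^ N / (a * q)" for u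
      using nonzero q0 by (simp_all add: p0_def r0_def power_add eval_nat_numeral mult_ac)
    show ?thesis
      unfolding coeff_B_def powi_shifted[OF q0] args(6) e shift_down_def ps_def ..
  qed
  have ca: "coeff_a q a ps s h (int N - 1) = F1.A N + F1.B N + F1.R N" for N
  proof -
    have e: "s * (q ^ (N + N) / q ^ 3) / (a * h\<^sup>2) = p0 * q ^ N / (a * (r0 / q ^ N))" "s * (q ^ N / q ^ 3) / (a * h) = p0 * q ^ N / (a * q)"
      "s / (a * q\<^sup>2) = p0 * q ^ N * (r0 / q ^ N) / (a * q)"
      using nonzero q0 by (simp_all add: p0_def r0_def power_add eval_nat_numeral mult_ac)
    show ?thesis
      unfolding coeff_a_def cA cB unfolding shift_rest_def powi_shifted[OF q0] args(5) e ps_def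
      by (simp only: times_divide_eq_right mult.assoc)
  qed
  have inN: "int n = int (Suc n) - 1" for n by simp
  have ca': "coeff_a q a ps s h (int n) = F1.A (Suc n) + F1.B (Suc n) + F1.R (Suc n)" for n
    unfolding inN[of n] ca ..
  have cb': "coeff_b q a ps s h (int n) = F1.A n * F1.B (Suc n)" for n
    unfolding coeff_b_def cA using cB[of "Suc n"] by simp
  have q1: "q \<noteq> 1" using q by auto
  have par: "q / (r0 / q ^ N) = p1 * q ^ N" "q / (p0 * q ^ N) = r1 / q ^ N" for N
    by (simp_all add: p1_def r1_def)
  have S_eq: "F2.A (Suc n) + F2.B (Suc n) + F2.R (Suc n) = F1.A (Suc n) + F1.B (Suc n) + F1.R (Suc n)" for n
  proof -
    have "b * c * d * e * f * (p0 * q ^ Suc n) * (r0 / q ^ Suc n) = a ^ 3 * q\<^sup>2" using bal0 by (simp add: mult.assoc)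
    from shift_sum_inversion[OF this nonzero(1) q0 nonzero(2-6)] show ?thesis
      unfolding par using nz0 q0 q1 F1.parameters_ne[of "Suc n"] F1.parameters_ne(3,6,8)[of n] by auto
  qed
  have AB_eq: "F2.A n * F2.B (Suc n) = F1.A n * F1.B (Suc n)" for n
  proof -
    have e: "p0 * q ^ Suc n = p0 * q ^ n * q" "r0 / q ^ Suc n = r0 / q ^ n / q" "p1 * q ^ Suc n = p1 * q ^ n * q"
      "r1 / q ^ Suc n = r1 / q ^ n / q"
      by simp_all
    have "0 \<notin> set [b, c, d, e, f]" "p0 * q ^ n \<noteq> 0" "r0 / q ^ n \<noteq> 0"
      using nonzero nz0 q0 by simp_all
    from shift_product_inversion[OF nonzero(1) q0 this(2,3,1) F1.parameters_ne(1,2,4,5)[of n]]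
    show ?thesis unfolding par e list.map .
  qed
  \<comment> \<open>The offset makes \<open>Y n\<close> the combination at index n, while
    \<open>y\<close> is b_0 times the one at index -1, as
    \<open>cf_has_value_minimal_solution\<close> expects.\<close>
  define Y where "Y = (\<lambda>n. W2 * F1.solution (Suc n) - W1 * F2.solution (Suc n))"
  define y where "y = coeff_b q a ps s h 0 * (W2 * X1 q a ps s h (-1) - W1 * X2 q a ps s h (-1))"
  have X0: "X1 q a ps s h 0 = F1.solution (Suc 0)" "X2 q a ps s h 0 = F2.solution (Suc 0)"
    using sol1[of 1] sol2[of 1] by simp_all
  have Xm: "X1 q a ps s h (-1) = F1.solution 0" "X2 q a ps s h (-1) = F2.solution 0"
    using sol1[of 0] sol2[of 0] by simp_all
  have lin: "w2 * (k * x1 - l * x0) - w1 * (k * y1 - l * y0) = k * (w2 * x1 - w1 * y1) - l * (w2 * x0 - w1 * y0)"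
    for w1 w2 k l x0 x1 y0 y1 :: complex by algebra
  have Yrec: "W2 * F1.solution (Suc (Suc n)) - W1 * F2.solution (Suc (Suc n))
      = coeff_a q a ps s h (int n) * Y n - coeff_b q a ps s h (int n) * (W2 * F1.solution n - W1 * F2.solution n)" for n
    unfolding F1.solution_recurrence F2.solution_recurrence S_eq AB_eq ca' cb' lin Y_def ..
  have W1_eq: "W1 = wp_W q a [b, c, d, e, f] (p0 * r0 / a)"
    using W8_7_eq[OF W_nonsing(1)] arg1 by (simp add: W1_def W8_7_arg_def)
  have W2_eq: "W2 = wp_W q (q / a) [q / b, q / c, q / d, q / e, q / f] (p1 * r1 / (q / a))"
    using W8_7_eq[OF W_nonsing(2)] arg2 unfolding W2_def W8_7_arg_def prod.case by (simp only:)
  have Ylim: "Y \<longlonglongrightarrow> 0"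
  proof -
    have "Y \<longlonglongrightarrow> W2 * W1 - W1 * W2"
      unfolding Y_def
      by (intro tendsto_diff tendsto_mult tendsto_const LIMSEQ_Suc)
        (use F1.solution_tendsto[OF z1] F2.solution_tendsto[OF z2] W1_eq W2_eq in simp_all)
    then show ?thesis by simp
  qed
  have "cf_has_value (\<lambda>n. coeff_a q a ps s h (int n)) (\<lambda>n. coeff_b q a ps s h (int n)) (Y 0 / y)"
  proof (rule cf_has_value_minimal_solution[OF q(2)])
    show "summable (\<lambda>n. norm (coeff_a q a ps s h (int n) - (1 + q)))" "summable (\<lambda>n. norm (coeff_b q a ps s h (int n) - q))"
      unfolding ca' cb' by (rule F1.summable_coefficients)+
    show "coeff_b q a ps s h (int (Suc n)) \<noteq> 0" for n
      unfolding cb' by (simp only: F1.A_nonzero F1.B_Suc_nonzero mult_eq_0_iff simp_thms)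
    show "Y (Suc 0) = coeff_a q a ps s h (int 0) * Y 0 - y"
      using Yrec[of 0] unfolding y_def Xm by (simp add: Y_def)
    show "Y (Suc (Suc n)) = coeff_a q a ps s h (int (Suc n)) * Y (Suc n) - coeff_b q a ps s h (int (Suc n)) * Y n" for n
      using Yrec[of "Suc n"] unfolding Y_def .
    show "y \<noteq> 0" unfolding y_def by (rule ratio_nonsing)
  qed (rule Ylim)
  moreover have "Y 0 = W2 * X1 q a ps s h 0 - W1 * X2 q a ps s h 0"
    unfolding X0 Y_def ..
  moreover have "(W2 * X1 q a ps s h 0 - W1 * X2 q a ps s h 0) / y
     = (1 - s / (h\<^sup>2 * q)) * (1 - s / (h\<^sup>2 * q\<^sup>2)) / q * (N / D)"
  proof -
    \<comment> \<open>The value of s q^(2n-1) / h^2 at n = -1; its value at n = 0 is u q^2, and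
      \<open>U\<close> is the infinite product shared by both solutions there.\<close>
    define u where "u = s / (h\<^sup>2 * q ^ 3)"
    define U where "U = qpoch_inf q (s / (h\<^sup>2 * q))"
    define \<Pi>A where "\<Pi>A = prod_list (map (\<lambda>p. 1 - a / (p * h)) ps)"
    define \<Pi>B where "\<Pi>B = prod_list (map (\<lambda>p. 1 - p * s / (a * h * q\<^sup>2)) ps)"
    define Q1 where "Q1 = prod_list (map (\<lambda>p. qpoch_inf q (a * q / (p * h))) ps)"
    define Q2 where "Q2 = prod_list (map (\<lambda>p. qpoch_inf q (p * s / (a * h * q))) ps)"
    have uq: "u * q = s / (h\<^sup>2 * q\<^sup>2)" "u * q * q = s / (h\<^sup>2 * q)" "p0 / r0 = u"
      by (simp_all add: u_def p0_def r0_def power2_eq_square power3_eq_cube)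
    have pe: "s * q powi (2 * 0 - 1) / h\<^sup>2 = s / (h\<^sup>2 * q)" "a * q powi (0 + 1) / h = a * q / h"
        "s * q powi (0 - 1) / h = s / (h * q)" "s * q powi (0 - 1) / (a * h) = s / (a * h * q)"
        "a * q powi (0 + 1) / (v * h) = a * q / (v * h)" "s / h * q powi (0 - 1) = s / (h * q)" "h * q powi (- 0) = h"
        "s * q powi 0 / (a * h) = s / (a * h)" "q powi (0 + 1) / h = q / h" "a * q powi 0 / h = a / h"
        "v * s * q powi (0 - 1) / (a * h) = v * s / (a * h * q)" "h * q powi (- 0 + 2) / s = h * q\<^sup>2 / s" for v
      by (simp_all add: power_int_minus field_simps)
    have me: "s * q powi (2 * - 1 - 1) / h\<^sup>2 = u" "a * q powi (- 1 + 1) / h = a / h"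
        "s * q powi (- 1 - 1) / h = p0" "s * q powi (- 1 - 1) / (a * h) = s / (a * h * q\<^sup>2)"
        "a * q powi (- 1 + 1) / (v * h) = a / (v * h)" "s / h * q powi (- 1 - 1) = s / (h * q\<^sup>2)" "h * q powi (- (- 1)) = h * q"
        "s * q powi - 1 / (a * h) = s / (a * h * q)" "q powi (- 1 + 1) / h = 1 / h" "a * q powi - 1 / h = a / (q * h)"
        "v * s * q powi (- 1 - 1) / (a * h) = v * s / (a * h * q\<^sup>2)" "h * q powi (- (- 1) + 2) / s = h * q ^ 3 / s" for v
      by (simp_all add: power_int_minus u_def p0_def field_simps)
    have ce: "s * q powi (0 - 1 - 1) / h = p0" "s * q powi (0 - 1 - 1) / (a * h) = s / (a * h * q\<^sup>2)"
        "a * q powi (0 - 1 + 1) / (v * h) = a / (v * h)" "s * q powi (2 * (0 - 1)) / h\<^sup>2 = u * q"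
        "s * q powi (2 * (0 - 1) - 1) / h\<^sup>2 = u" "a * q powi (0 - 1 + 1) / h = a / h" "q powi 0 / h = 1 / h"
        "a * q powi 0 / h = a / h" "v * s * q powi (0 - 2) / (a * h) = v * s / (a * h * q\<^sup>2)"
        "s * q powi (2 * 0 - 1) / h\<^sup>2 = u * q * q" "s * q powi (2 * 0 - 2) / h\<^sup>2 = u * q"
        "s * q powi (0 - 2) / (a * h) = s / (a * h * q\<^sup>2)" for v
      by (simp_all add: power_int_minus u_def p0_def field_simps power2_eq_square power3_eq_cube)
    have X10: "X1 q a ps s h 0 = U * (qpoch_inf q (a * q / h) / (qpochs_inf q [s / (h * q), s / (a * h * q)] * Q1)
        * Phi q a (s / (h * q)) [b, c, d, e, f, h])"
      unfolding X1_def X1_den_def pe U_def Q1_def by (simp add: ps_def qpochs_inf_Cons)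
    have X20: "X2 q a ps s h 0 = U * (qpoch_inf q (s / (a * h)) / (qpochs_inf q [q / h, a / h] * Q2)
        * Phi q (q / a) (q / h) [q / b, q / c, q / d, q / e, q / f, h * q\<^sup>2 / s])"
      unfolding X2_def X2_den_def pe U_def Q2_def by (simp add: ps_def qpochs_inf_Cons)
    have num: "W2 * X1 q a ps s h 0 - W1 * X2 q a ps s h 0 = U * N"
      unfolding X10 X20 N_def Q1_def[symmetric] Q2_def[symmetric] by (simp only: right_diff_distrib mult_ac)
    have Qu: "qpoch_inf q u = (1 - u) * (1 - u * q) * U"
      using qpoch_inf_Suc[of u] qpoch_inf_Suc[of "u * q"] by (simp only: U_def uq(2)[symmetric] mult.assoc)
    have Qp0: "qpoch_inf q p0 = (1 - p0) * qpoch_inf q (s / (h * q))"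
      using qpoch_inf_Suc[of p0] by (simp add: p0_def power2_eq_square)
    have Q1h: "qpoch_inf q (1 / h) = (1 - 1 / h) * qpoch_inf q (q / h)"
      using qpoch_inf_Suc[of "1 / h"] by simp
    have QA: "prod_list (map (\<lambda>p. qpoch_inf q (a / (p * h))) ps) = \<Pi>A * Q1"
    proof -
      have "qpoch_inf q (a / (v * h)) = (1 - a / (v * h)) * qpoch_inf q (a * q / (v * h))" for v
        using qpoch_inf_Suc[of "a / (v * h)"] by simp
      then show ?thesis by (simp only: \<Pi>A_def Q1_def prod_list_map_mult)
    qed
    have QB: "prod_list (map (\<lambda>p. qpoch_inf q (p * s / (a * h * q\<^sup>2))) ps) = \<Pi>B * Q2"
    proof -
      have "qpoch_inf q (v * s / (a * h * q\<^sup>2)) = (1 - v * s / (a * h * q\<^sup>2)) * qpoch_inf q (v * s / (a * h * q))" for v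
        using qpoch_inf_Suc[of "v * s / (a * h * q\<^sup>2)"] by (simp add: power2_eq_square mult.assoc)
      then show ?thesis by (simp only: \<Pi>B_def Q2_def prod_list_map_mult)
    qed
    have U_nz: "U \<noteq> 0"
      using qpoch_inf_shift_nonzero[OF F1.Qpr', of 2] unfolding U_def uq(2)[symmetric] uq(3)
      by (simp add: power2_eq_square mult.assoc)
    have n: "1 - u \<noteq> 0" "1 - u * q \<noteq> 0" "1 - u * q * q \<noteq> 0"
      using F1.q_shift_ne_1[OF F1.Qpr', of 0] F1.q_shift_ne_1[OF F1.Qpr', of 1] F1.q_shift_ne_1[OF F1.Qpr', of 2]
      unfolding uq(3) by (simp_all add: power2_eq_square mult.assoc)
    have n': "1 - a / h \<noteq> 0" "1 - s / (a * h * q\<^sup>2) \<noteq> 0" "1 - p0 \<noteq> 0" "1 - 1 / h \<noteq> 0"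
      using F1.q_shift_ne_1[OF F1.Qar, of 0] F1.q_shift_ne_1[OF F1.Qpa, of 0] F1.q_shift_ne_1[OF F1.Qp, of 0]
        F2.q_shift_ne_1[OF F2.Qp, of 0]
      by (simp_all add: r0_def p0_def p1_def mult_ac)
    have nA: "\<Pi>A \<noteq> 0"
      using F1.q_shift_ne_1[OF F1.Qaur, of _ 0] by (simp add: \<Pi>A_def ps_def r0_def)
    have nB: "\<Pi>B \<noteq> 0"
      using F1.q_shift_ne_1[OF F1.Qups, of _ 0] by (simp add: \<Pi>B_def ps_def p0_def mult_ac)
    have cb: "coeff_b q a ps s h 0 = ((1 - p0) * (1 - s / (a * h * q\<^sup>2)) * \<Pi>A / ((1 - u * q) * (1 - u) * (1 - a / h)))
       * (q * (1 - 1 / h) * (1 - a / h) * \<Pi>B / ((1 - u * q * q) * (1 - u * q) * (1 - s / (a * h * q\<^sup>2))))"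
      unfolding coeff_b_def coeff_A_def coeff_B_def ce \<Pi>A_def \<Pi>B_def ..
    define D1 where "D1 = ((1 - 1 / h) * \<Pi>B * qpoch_inf q (a / h))
             / (qpochs_inf q [s / (h * q), s / (a * h * q\<^sup>2)] * Q1) * Phi q a (s / (h * q\<^sup>2)) [b, c, d, e, f, h * q]"
    define D2 where "D2 = ((1 - s / (h * q\<^sup>2)) * \<Pi>A * qpoch_inf q (s / (a * h * q)))
             / (qpochs_inf q [q / h, a / (q * h)] * Q2)
         * Phi q (q / a) (1 / h) [q / b, q / c, q / d, q / e, q / f, h * q ^ 3 / s]"
    \<comment> \<open>In both products b_0 X_(-1) the coefficient b_0 cancels the extra factors of
      the denominators at n = -1; what is left outside \<open>D1\<close> and \<open>D2\<close> is
      this one constant.\<close>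
    define k where "k = q * U / ((1 - u * q) * (1 - u * q * q))"
    have bX1: "coeff_b q a ps s h 0 * X1 q a ps s h (- 1) = k * D1"
    proof -
      have eq: "X1 q a ps s h (- 1) = ((1 - u) * (1 - u * q) * U) * qpoch_inf q (a / h) /
          (((1 - p0) * qpoch_inf q (s / (h * q))) * qpoch_inf q (s / (a * h * q\<^sup>2)) * (\<Pi>A * Q1)) * Phi q a (s / (h * q\<^sup>2)) [b, c, d, e, f, h * q]"
        unfolding X1_def X1_den_def me qpochs_inf_Cons qpochs_Nil mult_1_right QA Qu Qp0 by (simp add: ps_def)
      have alg: "(n3 * n2 * pA / ((m2 * m1 * n1))) * (q * n4 * n1 * pB / (m3 * m2 * n2)) *
          ((m1 * m2 * U) * x / ((n3 * y) * w * (pA * Q1)) * F) = q * U / (m2 * m3) * (n4 * pB * x / (y * w * Q1) * F)"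
        if "n1 \<noteq> 0" "n2 \<noteq> 0" "n3 \<noteq> 0" "m1 \<noteq> 0" "m2 \<noteq> 0" "pA \<noteq> 0" for n1 n2 n3 n4 m1 m2 m3 pA pB x y w F :: complex
        using that by (simp add: mult_ac)
      show ?thesis
        unfolding cb k_def D1_def qpochs_inf_Cons qpochs_Nil mult_1_right eq by (rule alg[OF n'(1,2,3) n(1,2) nA])
    qed
    have bX2: "coeff_b q a ps s h 0 * X2 q a ps s h (- 1) = k * D2"
    proof -
      have eq: "X2 q a ps s h (- 1) = ((1 - u) * (1 - u * q) * U) * qpoch_inf q (s / (a * h * q)) /
          (((1 - 1 / h) * qpoch_inf q (q / h)) * qpoch_inf q (a / (q * h)) * (\<Pi>B * Q2)) * Phi q (q / a) (1 / h) [q / b, q / c, q / d, q / e, q / f, h * q ^ 3 / s]"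
        unfolding X2_def X2_den_def me qpochs_inf_Cons qpochs_Nil mult_1_right QB Qu Q1h by (simp add: ps_def)
      have alg: "(n3 * n2 * pA / ((m2 * m1 * n1))) * (q * n4 * n1 * pB / (m3 * m2 * n2)) *
          ((m1 * m2 * U) * x / ((n4 * y) * w * (pB * Q2)) * F) = q * U / (m2 * m3) * (n3 * pA * x / (y * w * Q2) * F)"
        if "n1 \<noteq> 0" "n2 \<noteq> 0" "n4 \<noteq> 0" "m1 \<noteq> 0" "m2 \<noteq> 0" "pB \<noteq> 0" for n1 n2 n3 n4 m1 m2 m3 pA pB x y w F :: complex
        using that by (simp add: mult_ac)
      show ?thesis
        unfolding cb k_def D2_def qpochs_inf_Cons qpochs_Nil mult_1_right p0_def[symmetric] eq by (rule alg[OF n'(1,2,4) n(1,2) nB])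
    qed
    have D: "D = W2 * D1 - W1 * D2"
    proof -
      have "Q2 = prod_list (map (\<lambda>p. qpoch_inf q (p * s / (a * q * h))) ps)" by (simp add: Q2_def mult_ac)
      then show ?thesis
        unfolding D_def D1_def D2_def \<Pi>A_def \<Pi>B_def Q1_def by (simp only: mult.assoc)
    qed
    have "y = k * D"
    proof -
      have "y = W2 * (coeff_b q a ps s h 0 * X1 q a ps s h (- 1)) - W1 * (coeff_b q a ps s h 0 * X2 q a ps s h (- 1))"
        by (simp only: y_def right_diff_distrib mult_ac)
      then show ?thesis unfolding bX1 bX2 D by (simp only: right_diff_distrib mult_ac)
    qed
    then have "(W2 * X1 q a ps s h 0 - W1 * X2 q a ps s h 0) / y = U * N / (k * D)" by (simp only: num)
    also have "\<dots> = (1 - u * q * q) * (1 - u * q) / q * (N / D)"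
      unfolding k_def using U_nz n q0 by simp
    finally show ?thesis unfolding uq(2) unfolding uq(1) .
  qed
  ultimately show ?thesis unfolding y_def by simp
qed

end
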